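(* Define $$C_{\exp}=\frac{\lambda_{\max}(S_{1/2})}{\sqrt2}.$$ As $\alpha\uparrow1/2$ and $d\to-\infty$, jointly, $$\frac{\Lambda_2(\alpha,d)}{\sqrt{1-2\alpha}}=C_{\exp}+O\bigl(1-2\alpha+(1-d)^{-2}\bigr),$$ where the implied constant is uniform for $\alpha<1/2$ sufficiently close to $1/2$ and $d\le0$. Moreover, for each fixed $d\le0$ the limit $$C_{2,d}=\lim_{\alpha\uparrow1/2}\frac{\Lambda_2(\alpha,d)}{\sqrt{1-2\alpha}}$$ exists and, putting $\kappa_0=1/2-d$, $$C_{2,d}=\frac{\lambda_{\max}(S_{1/2,\kappa_0})}{\sqrt2},\qquad 0<C_{\exp}-C_{2,d}\le\frac{\sqrt3}{48\kappa_0^2}.$$ The coefficient $C_{2,d}$ strictly increases as $d$ decreases (over $d\le0$). In particular, both iterated limits of $\Lambda_2(\alpha,d)/\sqrt{1-2\alpha}$ (as $\alpha\uparrow1/2$ and $d\to-\infty$, in either order) equal $C_{\exp}$.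
   Context: For $0<\alpha<1/2$ and $d\in\mathbb R$ with $2d+2\alpha<1$, let $T_{\alpha,d}$ be the positive Hilbert--Schmidt operator on $L^2(0,1)$, $(T_{\alpha,d}f)(x)=\int_0^1x^{-d/2}y^{-d/2}|x-y|^{-\alpha}f(y)\,dy$, and define the rank-two LIL constant $$\Lambda_2(\alpha,d)=\frac{\lambda_{\max}(T_{\alpha,d})}{\sqrt{2\operatorname{tr}(T_{\alpha,d}^2)}},\qquad \operatorname{tr}(T_{\alpha,d}^2)=\int_0^1\!\!\int_0^1x^{-d}y^{-d}|x-y|^{-2\alpha}\,dx\,dy.$$ Let $\nu(du)=e^{-u}\,du$ on $[0,\infty)$. $S_{1/2}$ is the positive compact operator on $L^2(\nu)$ given by $(S_{1/2}h)(u)=\int_0^\infty|u-v|^{-1/2}h(v)e^{-v}\,dv$, and for $\kappa\ge1/2$, $S_{1/2,\kappa}$ is the compact operator on $L^2(\nu)$ given by $$(S_{1/2,\kappa}h)(u)=\int_0^\infty\Bigl[2\kappa\sinh\Bigl(\frac{|u-v|}{2\kappa}\Bigr)\Bigr]^{-1/2}h(v)e^{-v}\,dv.$$ $\lambda_{\max}$ denotes the largest eigenvalue. *)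

theory Defs
  imports "HOL-Analysis.Analysis"
begin

section \<open>Eigenvalues of operators on real $L^2$ spaces\<close>

text \<open>Elements of $L^2(M)$ are represented by measurable square-integrable functions, and identities
  between them are understood almost everywhere. All operators considered below are symmetric with a
  real kernel, so real scalars suffice.\<close>

definition L2 :: "real measure \<Rightarrow> (real \<Rightarrow> real) set" where
  "L2 M = {f. f \<in> borel_measurable M \<and> integrable M (\<lambda>x. (f x)\<^sup>2)}"

definition is_eigenvalue :: "real measure \<Rightarrow> ((real \<Rightarrow> real) \<Rightarrow> (real \<Rightarrow> real)) \<Rightarrow> real \<Rightarrow> bool" where
  "is_eigenvalue M A l \<longleftrightarrow>
     (\<exists>f\<in>L2 M. \<not> (AE x in M. f x = 0) \<and> (AE x in M. A f x = l * f x))"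

definition lambda_max :: "real measure \<Rightarrow> ((real \<Rightarrow> real) \<Rightarrow> (real \<Rightarrow> real)) \<Rightarrow> real" where
  "lambda_max M A = (GREATEST l. is_eigenvalue M A l)"


section \<open>The rank-two constant\<close>

definition unit_interval :: "real measure" where
  "unit_interval = restrict_space lborel {0<..<1}"

text \<open>In the kernels below, \<^term>\<open>0 powr a = (0::real)\<close> only affects the diagonal, a null set.
  For \<open>f\<close> in the respective $L^2$ space the integrals converge absolutely for almost every value
  of the outer variable.\<close>

definition T_op :: "real \<Rightarrow> real \<Rightarrow> (real \<Rightarrow> real) \<Rightarrow> real \<Rightarrow> real" where
  "T_op \<alpha> d f x =
     (LBINT y:{0<..<1}. x powr (- d / 2) * y powr (- d / 2) * \<bar>x - y\<bar> powr (- \<alpha>) * f y)"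

definition trace_T_sq :: "real \<Rightarrow> real \<Rightarrow> real" where
  "trace_T_sq \<alpha> d =
     (LBINT y:{0<..<1}. (LBINT x:{0<..<1}.
        x powr (- d) * y powr (- d) * \<bar>x - y\<bar> powr (- 2 * \<alpha>)))"

definition Lambda2 :: "real \<Rightarrow> real \<Rightarrow> real" where
  "Lambda2 \<alpha> d = lambda_max unit_interval (T_op \<alpha> d) / sqrt (2 * trace_T_sq \<alpha> d)"


section \<open>The limiting operators\<close>

definition \<nu> :: "real measure" where
  "\<nu> = density (restrict_space lborel {0..}) (\<lambda>u. ennreal (exp (- u)))"

definition S_half :: "(real \<Rightarrow> real) \<Rightarrow> real \<Rightarrow> real" where
  "S_half h u = (LBINT v:{0..}. \<bar>u - v\<bar> powr (- 1 / 2) * h v * exp (- v))"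

definition S_half_kappa :: "real \<Rightarrow> (real \<Rightarrow> real) \<Rightarrow> real \<Rightarrow> real" where
  "S_half_kappa \<kappa> h u =
     (LBINT v:{0..}. (2 * \<kappa> * sinh (\<bar>u - v\<bar> / (2 * \<kappa>))) powr (- 1 / 2) * h v * exp (- v))"

definition C_exp :: real where
  "C_exp = lambda_max \<nu> S_half / sqrt 2"

definition C2 :: "real \<Rightarrow> real" where
  "C2 d = Lim (at_left (1 / 2)) (\<lambda>\<alpha>. Lambda2 \<alpha> d / sqrt (1 - 2 * \<alpha>))"

end

theory Submission
  imports Defs "HOL-Probability.Distributions" "HOL-Complex_Analysis.Great_Picard"
begin

text \<open>Substituting \<open>x = exp (- u / \<kappa>)\<close> with \<open>\<kappa> = 1 - d - \<alpha>\<close> makes the weights \<open>x\<^sup>-\<^sup>d\<^sup>/\<^sup>2\<close>, the Jacobian and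
the factor \<open>exp (- (u + v) / (2 \<kappa>))\<close> of \<open>\<bar>x - y\<bar>\<close> collapse to the density \<open>exp (- u)\<close> of the standard
exponential law. Up to a power of \<open>\<kappa>\<close>, which cancels in the quotient \<open>\<Lambda>\<^sub>2\<close>, the operator \<open>T\<close> becomes the
convolution-type operator with kernel \<open>k \<bar>u - v\<bar>\<close>, \<open>k t = (2 \<kappa> sinh (t / (2 \<kappa>)))\<^sup>-\<^sup>\<alpha>\<close>, on the \<open>L\<^sup>2\<close> space of
that law. Since \<open>\<bar>U - V\<bar>\<close> is again standard exponential for independent exponential \<open>U\<close>, \<open>V\<close>, the trace
becomes the single integral of \<open>k\<^sup>2\<close>. Hence (\<open>Lambda2_eq\<close>) \<open>\<Lambda>\<^sub>2 = \<lambda> / sqrt (2 I)\<close>, where \<open>\<lambda>\<close> is the top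
eigenvalue for \<open>k\<close> and \<open>I\<close> is the mean of \<open>k\<^sup>2\<close>.

The singularity at \<open>0\<close> gives \<open>(1 - 2 \<alpha>) I = 1 + O(1 - 2 \<alpha>)\<close> uniformly in \<open>\<kappa>\<close>
(\<open>sinh_kernel_trace_estimate\<close>), so everything reduces to the dependence of \<open>\<lambda>\<close> on the kernel.

For that the top eigenvalue has to be the supremum of the Rayleigh quotient (\<open>lambda_max_eq_top_value\<close>);
the point is that the supremum is attained although the kernel \<open>t\<^sup>-\<^sup>1\<^sup>/\<^sup>2\<close> is not Hilbert--Schmidt. For a
maximising sequence \<open>f\<^sub>n\<close> with supremum \<open>M\<close> one has \<open>A f\<^sub>n - M f\<^sub>n \<rightarrow> 0\<close>, hence \<open>A\<^sup>3 f\<^sub>n - M\<^sup>3 f\<^sub>n \<rightarrow> 0\<close>. Two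
applications of \<open>A\<close> turn square-integrable functions into bounded ones, and a third one gives
equicontinuity; a diagonal argument therefore extracts a pointwise, boundedly convergent subsequence of
\<open>A\<^sup>3 f\<^sub>n\<close>, and the limit is an eigenfunction.

Rayleigh quotients compare eigenvalues. Changing the exponent changes the kernel by
\<open>O((1/2 - \<alpha>) (1 + t\<^sup>-\<^sup>3\<^sup>/\<^sup>4))\<close>; this bound is not square integrable at \<open>0\<close> but has uniformly bounded
row integrals, so Schur's test applies. Replacing \<open>2 \<kappa> sinh (t / (2 \<kappa>))\<close> by \<open>t\<close> changes the kernel by at most
\<open>t\<^sup>3\<^sup>/\<^sup>2 / (48 \<kappa>\<^sup>2)\<close>, which has unbounded row integrals but Hilbert--Schmidt norm \<open>sqrt 6 / (48 \<kappa>\<^sup>2)\<close>; divided by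
\<open>sqrt 2\<close> this is the constant \<open>sqrt 3 / (48 \<kappa>\<^sup>2)\<close>. The kernels increase strictly with \<open>\<kappa>\<close>, and testing the
larger one with the absolute value of a top eigenfunction of the smaller one makes the eigenvalues
increase strictly as well.\<close>


section \<open>The standard exponential law\<close>

text \<open>The law is put on the whole line, so that measurability is Borel measurability; the measure
\<open>\<nu>\<close>, whose underlying space is the half-line, is related to it further below.\<close>

definition expm :: "real measure" where
  "expm = density lborel (\<lambda>u. ennreal (indicator {0..} u * exp (- u)))"

lemma sets_expm [simp, measurable_cong]: "sets expm = sets borel"
  by (simp add: expm_def)

lemma space_expm [simp]: "space expm = UNIV"
  by (simp add: expm_def)

lemma nn_integral_expm:
  assumes "f \<in> borel_measurable borel"
  shows "(\<integral>\<^sup>+u. f u \<partial>expm) = (\<integral>\<^sup>+u. ennreal (indicator {0..} u * exp (- u)) * f u \<partial>lborel)"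
  unfolding expm_def using assms by (subst nn_integral_density) auto

lemma AE_expm: "(AE u in expm. P u) \<longleftrightarrow> (AE u in lborel. 0 \<le> u \<longrightarrow> P u)"
proof -
  have "(AE u in expm. P u) \<longleftrightarrow> (AE u in lborel. 0 < ennreal (indicator {0..} u * exp (- u)) \<longrightarrow> P u)"
    unfolding expm_def by (subst AE_density) auto
  also have "\<dots> \<longleftrightarrow> (AE u in lborel. 0 \<le> u \<longrightarrow> P u)"
    by (intro AE_cong) (auto simp: indicator_def)
  finally show ?thesis .
qed

lemma moment_expm: "(\<integral>\<^sup>+u. ennreal (u ^ n) \<partial>expm) = ennreal (fact n)"
proof -
  have "(\<integral>\<^sup>+u. ennreal (u ^ n) \<partial>expm)
      = (\<integral>\<^sup>+u. ennreal (indicator {0..} u * exp (- u)) * ennreal (u ^ n) \<partial>lborel)"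
    by (rule nn_integral_expm) auto
  also have "\<dots> = (\<integral>\<^sup>+u. ennreal (u ^ n * exp (-u)) * indicator {0 ..} u \<partial>lborel)"
    by (intro nn_integral_cong) (auto simp: indicator_def ennreal_mult' mult.commute)
  finally show ?thesis
    by (simp add: nn_intergal_power_times_exp_Ici)
qed

lemma emeasure_expm_UNIV: "emeasure expm UNIV = 1"
  using moment_expm[of 0] by simp

interpretation expm: prob_space expm
  by (rule prob_spaceI) (simp add: emeasure_expm_UNIV)

interpretation expm2: pair_sigma_finite expm expm ..

abbreviation expm_sq :: "(real \<times> real) measure" where
  "expm_sq \<equiv> expm \<Otimes>\<^sub>M expm"

lemma AE_expm_neq: "AE u in expm. u \<noteq> a"
  unfolding AE_expm using AE_lborel_singleton[of a] by eventually_elim auto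

text \<open>The absolute difference of two independent exponential variables is again exponential: by
the lack of memory, the excess of the larger one over the smaller one is exponential. This turns
Hilbert--Schmidt norms of difference kernels into one-dimensional integrals.\<close>

lemma nn_integral_expm_abs_diff:
  fixes g :: "real \<Rightarrow> ennreal"
  assumes [measurable]: "g \<in> borel_measurable borel"
  shows "(\<integral>\<^sup>+u. (\<integral>\<^sup>+v. g \<bar>u - v\<bar> \<partial>expm) \<partial>expm) = (\<integral>\<^sup>+w. g w \<partial>expm)"
proof -
  define I where "I = (\<integral>\<^sup>+w. g w \<partial>expm)"
  have half: "(\<integral>\<^sup>+u. ennreal (exp (- u)) \<partial>expm) = ennreal (1 / 2)"
  proof -
    have "(\<integral>\<^sup>+u. ennreal (exp (- u)) \<partial>expm)
        = (\<integral>\<^sup>+u. ennreal (exp (- (2 * u))) * indicator {0..} u \<partial>lborel)"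
      by (subst nn_integral_expm)
        (auto intro!: nn_integral_cong simp: indicator_def simp flip: ennreal_mult' exp_add)
    also have "\<dots> = ennreal (0 - (- exp (- (2 * 0)) / 2))"
    proof (rule nn_integral_FTC_atLeast)
      show "((\<lambda>u::real. - exp (- (2 * u)) / 2) \<longlongrightarrow> 0) at_top"
        by real_asymp
    qed (auto intro!: derivative_eq_intros)
    finally show ?thesis by simp
  qed
  have shift: "(\<integral>\<^sup>+v. g \<bar>u - v\<bar> * indicator {u<..} v \<partial>expm) = ennreal (exp (- u)) * I"
    if "0 \<le> u" for u
  proof -
    have "(\<integral>\<^sup>+v. g \<bar>u - v\<bar> * indicator {u<..} v \<partial>expm)
        = (\<integral>\<^sup>+v. ennreal (indicator {0..} v * exp (- v)) * (g \<bar>u - v\<bar> * indicator {u<..} v) \<partial>lborel)"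
      by (rule nn_integral_expm) auto
    also have "\<dots> = (\<integral>\<^sup>+w. ennreal (indicator {0..} (u + w) * exp (- (u + w)))
        * (g \<bar>u - (u + w)\<bar> * indicator {u<..} (u + w)) \<partial>lborel)"
      using nn_integral_real_affine[where c = 1 and t = u and
         f = "\<lambda>v. ennreal (indicator {0..} v * exp (- v)) * (g \<bar>u - v\<bar> * indicator {u<..} v)"]
      by simp
    also have "\<dots> = (\<integral>\<^sup>+w. ennreal (exp (- u)) * (ennreal (indicator {0..} w * exp (- w)) * g w) \<partial>lborel)"
    proof (rule nn_integral_cong_AE)
      show "AE w in lborel. ennreal (indicator {0..} (u + w) * exp (- (u + w)))
          * (g \<bar>u - (u + w)\<bar> * indicator {u<..} (u + w))
        = ennreal (exp (- u)) * (ennreal (indicator {0..} w * exp (- w)) * g w)"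
        using AE_lborel_singleton[of "0::real"]
      proof eventually_elim
        case (elim w)
        have "exp (- (u + w)) = exp (- u) * exp (- w)"
          by (simp add: exp_add[symmetric])
        with elim that show ?case
          by (auto simp: indicator_def ennreal_mult' mult_ac)
      qed
    qed
    also have "\<dots> = ennreal (exp (- u)) * I"
      unfolding I_def by (subst nn_integral_cmult) (auto simp: nn_integral_expm)
    finally show ?thesis .
  qed
  have upper: "(\<integral>\<^sup>+u. (\<integral>\<^sup>+v. g \<bar>u - v\<bar> * indicator {u<..} v \<partial>expm) \<partial>expm) = ennreal (1 / 2) * I"
  proof -
    have "(\<integral>\<^sup>+u. (\<integral>\<^sup>+v. g \<bar>u - v\<bar> * indicator {u<..} v \<partial>expm) \<partial>expm)
        = (\<integral>\<^sup>+u. ennreal (exp (- u)) * I \<partial>expm)"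
      by (intro nn_integral_cong_AE) (auto simp: AE_expm shift)
    also have "\<dots> = ennreal (1 / 2) * I"
      by (subst nn_integral_multc) (auto simp: half)
    finally show ?thesis .
  qed
  have [measurable]: "(\<lambda>(u, v). g \<bar>u - v\<bar> * indicator {..<u} v) \<in> borel_measurable expm_sq"
  proof -
    have "(\<lambda>(u, v). g \<bar>u - v\<bar> * indicator {..<u} v)
        = (\<lambda>p. if snd p < fst p then g \<bar>fst p - snd p\<bar> else 0)"
      by (auto simp: indicator_def fun_eq_iff)
    then show ?thesis by simp
  qed
  have [measurable]: "(\<lambda>(u, v). g \<bar>u - v\<bar> * indicator {u<..} v) \<in> borel_measurable expm_sq"
  proof -
    have "(\<lambda>(u, v). g \<bar>u - v\<bar> * indicator {u<..} v)
        = (\<lambda>p. if fst p < snd p then g \<bar>fst p - snd p\<bar> else 0)"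
      by (auto simp: indicator_def fun_eq_iff)
    then show ?thesis by simp
  qed
  have "(\<integral>\<^sup>+u. (\<integral>\<^sup>+v. g \<bar>u - v\<bar> * indicator {..<u} v \<partial>expm) \<partial>expm)
      = (\<integral>\<^sup>+v. (\<integral>\<^sup>+u. g \<bar>u - v\<bar> * indicator {..<u} v \<partial>expm) \<partial>expm)"
    by (rule expm2.Fubini'[symmetric]) measurable
  also have "\<dots> = (\<integral>\<^sup>+v. (\<integral>\<^sup>+u. g \<bar>v - u\<bar> * indicator {v<..} u \<partial>expm) \<partial>expm)"
    by (intro nn_integral_cong) (auto simp: indicator_def abs_minus_commute)
  finally have lower: "(\<integral>\<^sup>+u. (\<integral>\<^sup>+v. g \<bar>u - v\<bar> * indicator {..<u} v \<partial>expm) \<partial>expm)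
      = ennreal (1 / 2) * I"
    using upper by simp
  have "(\<integral>\<^sup>+u. (\<integral>\<^sup>+v. g \<bar>u - v\<bar> \<partial>expm) \<partial>expm)
     = (\<integral>\<^sup>+u. (\<integral>\<^sup>+v. g \<bar>u - v\<bar> * indicator {u<..} v + g \<bar>u - v\<bar> * indicator {..<u} v \<partial>expm) \<partial>expm)"
  proof -
    have "AE v in expm. g \<bar>u - v\<bar> = g \<bar>u - v\<bar> * indicator {u<..} v + g \<bar>u - v\<bar> * indicator {..<u} v" for u
      using AE_expm_neq[of u] by eventually_elim (auto simp: indicator_def)
    then show ?thesis
      by (intro nn_integral_cong nn_integral_cong_AE)
  qed
  also have "\<dots> = (\<integral>\<^sup>+u. (\<integral>\<^sup>+v. g \<bar>u - v\<bar> * indicator {u<..} v \<partial>expm) \<partial>expm)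
      + (\<integral>\<^sup>+u. (\<integral>\<^sup>+v. g \<bar>u - v\<bar> * indicator {..<u} v \<partial>expm) \<partial>expm)"
    by (simp add: nn_integral_add)
  also have "\<dots> = ennreal (1 / 2 + 1 / 2) * I"
    by (subst ennreal_plus) (auto simp: upper lower distrib_right)
  finally show ?thesis by (simp add: I_def)
qed

lemma nn_integral_powr_01:
  fixes b :: real
  assumes "-1 < b"
  shows "(\<integral>\<^sup>+t. ennreal (t powr b) * indicator {0..1} t \<partial>lborel) = ennreal (1 / (b + 1))"
proof (rule nn_integral_has_integral_lebesgue')
  show "((\<lambda>t. t powr b) has_integral (1 / (b + 1))) {0..1}"
    using has_integral_powr_from_0[of b 1] assms by simp
qed simp

text \<open>Uniformity in \<open>u\<close> holds because the density is at most 1, which handles the singularity by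
translation invariance of Lebesgue measure, while at distance more than 1 from it the integrand is at
most 1.\<close>

lemma nn_integral_powr_shift_le:
  assumes p: "0 < p" "p < 1"
  shows "(\<integral>\<^sup>+v. ennreal (\<bar>u - v\<bar> powr (- p)) \<partial>expm) \<le> ennreal (1 + 2 / (1 - p))"
proof -
  let ?g = "\<lambda>s::real. ennreal (\<bar>s\<bar> powr (- p)) * indicator {- 1..1} s"
  have right: "(\<integral>\<^sup>+s. ennreal (\<bar>s\<bar> powr (- p)) * indicator {0..1} s \<partial>lborel) = ennreal (1 / (1 - p))"
  proof -
    have "(\<integral>\<^sup>+x. ennreal (x powr (- p)) * indicator {0..1} x \<partial>lborel) = ennreal (1 / (1 - p))"
      using nn_integral_powr_01[of "- p"] p by simp
    moreover have "(\<integral>\<^sup>+s. ennreal (\<bar>s\<bar> powr (- p)) * indicator {0..1} s \<partial>lborel)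
        = (\<integral>\<^sup>+x. ennreal (x powr (- p)) * indicator {0..1} x \<partial>lborel)"
      by (intro nn_integral_cong) (auto simp: indicator_def)
    ultimately show ?thesis by simp
  qed
  have left: "(\<integral>\<^sup>+s. ennreal (\<bar>s\<bar> powr (- p)) * indicator {- 1..0} s \<partial>lborel) = ennreal (1 / (1 - p))"
  proof -
    have "(\<integral>\<^sup>+s. ennreal (\<bar>s\<bar> powr (- p)) * indicator {- 1..0} s \<partial>lborel)
       = (\<integral>\<^sup>+s. ennreal (\<bar>- s\<bar> powr (- p)) * indicator {- 1..0} (- s) \<partial>lborel)"
      using nn_integral_real_affine[where c = "-1" and t = 0 and
         f = "\<lambda>s. ennreal (\<bar>s\<bar> powr (- p)) * indicator {- 1..0} s"] by simp
    also have "\<dots> = (\<integral>\<^sup>+s. ennreal (\<bar>s\<bar> powr (- p)) * indicator {0..1} s \<partial>lborel)"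
      by (intro nn_integral_cong) (auto simp: indicator_def)
    finally show ?thesis using right by simp
  qed
  have near: "(\<integral>\<^sup>+s. ?g s \<partial>lborel) \<le> ennreal (2 / (1 - p))"
  proof -
    have "(\<integral>\<^sup>+s. ?g s \<partial>lborel)
       \<le> (\<integral>\<^sup>+s. ennreal (\<bar>s\<bar> powr (- p)) * indicator {- 1..0} s
            + ennreal (\<bar>s\<bar> powr (- p)) * indicator {0..1} s \<partial>lborel)"
      by (intro nn_integral_mono) (auto simp: indicator_def)
    also have "\<dots> = ennreal (1 / (1 - p)) + ennreal (1 / (1 - p))"
      by (subst nn_integral_add) (auto simp: left right)
    also have "\<dots> = ennreal (2 / (1 - p))"
      using p by (subst ennreal_plus[symmetric]) auto
    finally show ?thesis .
  qed
  have "(\<integral>\<^sup>+v. ennreal (\<bar>u - v\<bar> powr (- p)) \<partial>expm)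
     = (\<integral>\<^sup>+v. ennreal (indicator {0..} v * exp (- v)) * ennreal (\<bar>u - v\<bar> powr (- p)) \<partial>lborel)"
    by (rule nn_integral_expm) auto
  also have "\<dots> \<le> (\<integral>\<^sup>+v. ennreal (indicator {0..} v * exp (- v)) + ?g (v - u) \<partial>lborel)"
  proof (rule nn_integral_mono)
    fix v :: real
    show "ennreal (indicator {0..} v * exp (- v)) * ennreal (\<bar>u - v\<bar> powr (- p))
        \<le> ennreal (indicator {0..} v * exp (- v)) + ?g (v - u)"
    proof (cases "\<bar>v - u\<bar> \<le> 1")
      case True
      then have "?g (v - u) = ennreal (\<bar>u - v\<bar> powr (- p))"
        by (auto simp: indicator_def abs_minus_commute)
      moreover have "ennreal (indicator {0..} v * exp (- v)) \<le> 1"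
        by (auto simp: indicator_def)
      ultimately show ?thesis
        by (metis add_increasing mult_1 mult_right_mono zero_le)
    next
      case False
      then have "\<bar>u - v\<bar> powr (- p) \<le> 1 powr (- p)"
        using p by (intro powr_mono2') auto
      then have "ennreal (\<bar>u - v\<bar> powr (- p)) \<le> 1"
        by (simp add: ennreal_le_1)
      then have "ennreal (indicator {0..} v * exp (- v)) * ennreal (\<bar>u - v\<bar> powr (- p))
          \<le> ennreal (indicator {0..} v * exp (- v)) * 1"
        by (intro mult_left_mono) auto
      then show ?thesis by (simp add: add_increasing2)
    qed
  qed
  also have "\<dots> = (\<integral>\<^sup>+v. ennreal (indicator {0..} v * exp (- v)) \<partial>lborel) + (\<integral>\<^sup>+v. ?g (v - u) \<partial>lborel)"
    by (subst nn_integral_add) auto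
  also have "(\<integral>\<^sup>+v. ennreal (indicator {0..} v * exp (- v)) \<partial>lborel) = 1"
    using nn_integral_expm[of "\<lambda>_. 1"] emeasure_expm_UNIV by simp
  also have "(\<integral>\<^sup>+v. ?g (v - u) \<partial>lborel) = (\<integral>\<^sup>+s. ?g s \<partial>lborel)"
    using nn_integral_real_affine[where c = 1 and t = "-u" and f = ?g] by (simp add: add.commute)
  also have "1 + (\<integral>\<^sup>+s. ?g s \<partial>lborel) \<le> ennreal 1 + ennreal (2 / (1 - p))"
    using near by (simp add: add_left_mono)
  also have "\<dots> = ennreal (1 + 2 / (1 - p))"
    using p by (subst ennreal_plus) auto
  finally show ?thesis .
qed


section \<open>Square-integrable functions\<close>

text \<open>With \<open>ennreal\<close> integrals no integrability has to be known in advance. The inequality is the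
optimised form of \<open>\<bar>F G\<bar> \<le> (t F\<^sup>2 + G\<^sup>2 / t) / 2\<close>; the bounds are enlarged by \<open>e\<close> so that the optimal \<open>t\<close>
exists even if one of them vanishes.\<close>

lemma nn_integral_Cauchy_Schwarz:
  fixes F G :: "'a \<Rightarrow> real"
  assumes [measurable]: "F \<in> borel_measurable M" "G \<in> borel_measurable M"
    and F: "(\<integral>\<^sup>+x. ennreal ((F x)\<^sup>2) \<partial>M) \<le> ennreal a" "0 \<le> a"
    and G: "(\<integral>\<^sup>+x. ennreal ((G x)\<^sup>2) \<partial>M) \<le> ennreal b" "0 \<le> b"
  shows "(\<integral>\<^sup>+x. ennreal \<bar>F x * G x\<bar> \<partial>M) \<le> ennreal (sqrt (a * b))"
proof -
  have eps: "(\<integral>\<^sup>+x. ennreal \<bar>F x * G x\<bar> \<partial>M) \<le> ennreal (sqrt ((a + e) * (b + e)))" if "e > 0" for e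
  proof -
    define t where "t = sqrt ((b + e) / (a + e))"
    have t: "t > 0" using that F G by (simp add: t_def)
    have t2: "t\<^sup>2 = (b + e) / (a + e)" using that F G by (simp add: t_def)
    have st: "t * (a + e) = sqrt ((a + e) * (b + e))" "(b + e) / t = sqrt ((a + e) * (b + e))"
    proof -
      have "(t * (a + e))\<^sup>2 = (b + e) / (a + e) * (a + e)\<^sup>2"
        by (simp only: power_mult_distrib t2)
      moreover have "((b + e) / t)\<^sup>2 = (b + e)\<^sup>2 / ((b + e) / (a + e))"
        by (simp only: power_divide t2)
      ultimately have "(t * (a + e))\<^sup>2 = (a + e) * (b + e)" "((b + e) / t)\<^sup>2 = (a + e) * (b + e)"
        using that F(2) G(2) by (auto simp: power2_eq_square)
      moreover have "0 \<le> t * (a + e)" "0 \<le> (b + e) / t"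
        using that F G t by auto
      ultimately show "t * (a + e) = sqrt ((a + e) * (b + e))" "(b + e) / t = sqrt ((a + e) * (b + e))"
        by (metis real_sqrt_unique)+
    qed
    have amgm: "\<bar>F x * G x\<bar> \<le> t / 2 * (F x)\<^sup>2 + 1 / (2 * t) * (G x)\<^sup>2" for x
    proof -
      have "0 \<le> (t * \<bar>F x\<bar> - \<bar>G x\<bar>)\<^sup>2" by simp
      then have "2 * t * \<bar>F x * G x\<bar> \<le> t\<^sup>2 * (F x)\<^sup>2 + (G x)\<^sup>2"
        by (simp add: power2_diff power_mult_distrib abs_mult mult_ac)
      then show ?thesis using t by (simp add: field_simps power2_eq_square)
    qed
    have "(\<integral>\<^sup>+x. ennreal \<bar>F x * G x\<bar> \<partial>M)
       \<le> (\<integral>\<^sup>+x. ennreal (t / 2) * ennreal ((F x)\<^sup>2) + ennreal (1 / (2 * t)) * ennreal ((G x)\<^sup>2) \<partial>M)"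
    proof (rule nn_integral_mono)
      fix x
      have "ennreal \<bar>F x * G x\<bar> \<le> ennreal (t / 2 * (F x)\<^sup>2 + 1 / (2 * t) * (G x)\<^sup>2)"
        using amgm by (rule ennreal_leI)
      also have "\<dots> = ennreal (t / 2) * ennreal ((F x)\<^sup>2) + ennreal (1 / (2 * t)) * ennreal ((G x)\<^sup>2)"
        using t by (subst ennreal_plus) (auto simp flip: ennreal_mult)
      finally show "ennreal \<bar>F x * G x\<bar> \<le> \<dots>" .
    qed
    also have "\<dots> = ennreal (t / 2) * (\<integral>\<^sup>+x. ennreal ((F x)\<^sup>2) \<partial>M)
        + ennreal (1 / (2 * t)) * (\<integral>\<^sup>+x. ennreal ((G x)\<^sup>2) \<partial>M)"
      by (simp add: nn_integral_add nn_integral_cmult)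
    also have "\<dots> \<le> ennreal (t / 2) * ennreal (a + e) + ennreal (1 / (2 * t)) * ennreal (b + e)"
      using that F G by (intro add_mono mult_left_mono order.trans[OF F(1)] order.trans[OF G(1)] ennreal_leI) auto
    also have "\<dots> = ennreal ((t * (a + e) + (b + e) / t) / 2)"
      using t that F G by (simp add: ennreal_mult[symmetric] ennreal_plus[symmetric] field_simps del: ennreal_plus)
    also have "\<dots> = ennreal (sqrt ((a + e) * (b + e)))"
      by (simp add: st)
    finally show ?thesis .
  qed
  have "((\<lambda>e. ennreal (sqrt ((a + e) * (b + e)))) \<longlongrightarrow> ennreal (sqrt ((a + 0) * (b + 0)))) (at_right 0)"
    by (intro tendsto_intros)
  then have "((\<lambda>e. ennreal (sqrt ((a + e) * (b + e)))) \<longlongrightarrow> ennreal (sqrt (a * b))) (at_right 0)"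
    by simp
  moreover have "\<forall>\<^sub>F e in at_right 0. (\<integral>\<^sup>+x. ennreal \<bar>F x * G x\<bar> \<partial>M) \<le> ennreal (sqrt ((a + e) * (b + e)))"
    using eps by (intro eventually_mono[OF eventually_at_right_less])
  ultimately show ?thesis
    by (rule tendsto_lowerbound) auto
qed

definition norm_sq :: "(real \<Rightarrow> real) \<Rightarrow> real" where
  "norm_sq f = (\<integral>x. (f x)\<^sup>2 \<partial>expm)"

lemma measurable_expm [simp]: "measurable expm M = measurable borel M"
  by (rule measurable_cong_sets) auto

lemma norm_sq_nonneg [simp]: "0 \<le> norm_sq f"
  by (simp add: norm_sq_def)

lemma L2_measurable [measurable_dest]: "f \<in> L2 expm \<Longrightarrow> f \<in> borel_measurable borel"
  by (simp add: L2_def)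

lemma L2_integrable: "f \<in> L2 expm \<Longrightarrow> integrable expm (\<lambda>x. (f x)\<^sup>2)"
  by (simp add: L2_def)

lemma nn_integral_norm_sq: "f \<in> L2 expm \<Longrightarrow> (\<integral>\<^sup>+x. ennreal ((f x)\<^sup>2) \<partial>expm) = ennreal (norm_sq f)"
  unfolding norm_sq_def by (rule nn_integral_eq_integral) (auto simp: L2_integrable)

lemma L2_boundI:
  assumes [measurable]: "f \<in> borel_measurable borel"
    and le: "(\<integral>\<^sup>+x. ennreal ((f x)\<^sup>2) \<partial>expm) \<le> ennreal c" "0 \<le> c"
  shows "f \<in> L2 expm" "norm_sq f \<le> c"
proof -
  have "(\<integral>\<^sup>+x. ennreal ((f x)\<^sup>2) \<partial>expm) < \<infinity>"
    using le(1) by (rule order.strict_trans1) simp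
  then show L2: "f \<in> L2 expm"
    by (auto simp: L2_def intro!: integrableI_bounded)
  show "norm_sq f \<le> c"
    using nn_integral_norm_sq[OF L2] le by simp
qed

lemma L2_scale:
  assumes "f \<in> L2 expm" shows "(\<lambda>x. c * f x) \<in> L2 expm" "norm_sq (\<lambda>x. c * f x) = c\<^sup>2 * norm_sq f"
  using assms by (auto simp: L2_def norm_sq_def power_mult_distrib)

lemma L2_add:
  assumes "f \<in> L2 expm" "g \<in> L2 expm"
  shows "(\<lambda>x. f x + g x) \<in> L2 expm" "norm_sq (\<lambda>x. f x + g x) \<le> 2 * norm_sq f + 2 * norm_sq g"
proof -
  note [measurable] = assms[THEN L2_measurable]
  have le: "(f x + g x)\<^sup>2 \<le> 2 * (f x)\<^sup>2 + 2 * (g x)\<^sup>2" for x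
    using sum_squares_bound[of "f x" "g x"] by (simp add: power2_sum)
  have int: "integrable expm (\<lambda>x. 2 * (f x)\<^sup>2 + 2 * (g x)\<^sup>2)"
    using assms by (auto simp: L2_def)
  show L2: "(\<lambda>x. f x + g x) \<in> L2 expm"
    unfolding L2_def using le by (auto intro!: Bochner_Integration.integrable_bound[OF int])
  have "norm_sq (\<lambda>x. f x + g x) \<le> (\<integral>x. 2 * (f x)\<^sup>2 + 2 * (g x)\<^sup>2 \<partial>expm)"
    unfolding norm_sq_def using le int L2 by (intro integral_mono) (auto simp: L2_def)
  also have "\<dots> = 2 * norm_sq f + 2 * norm_sq g"
    using assms by (simp add: norm_sq_def L2_def)
  finally show "norm_sq (\<lambda>x. f x + g x) \<le> 2 * norm_sq f + 2 * norm_sq g" .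
qed

lemma L2_diff:
  assumes "f \<in> L2 expm" "g \<in> L2 expm"
  shows "(\<lambda>x. f x - g x) \<in> L2 expm" "norm_sq (\<lambda>x. f x - g x) \<le> 2 * norm_sq f + 2 * norm_sq g"
  using L2_add[OF assms(1) L2_scale(1)[OF assms(2), of "-1"]] L2_scale(2)[OF assms(2), of "-1"] by auto

lemma L2_mult_integrable:
  assumes "f \<in> L2 expm" "g \<in> L2 expm"
  shows "integrable expm (\<lambda>x. f x * g x)"
proof (rule Bochner_Integration.integrable_bound)
  note [measurable] = assms[THEN L2_measurable]
  show "integrable expm (\<lambda>x. (f x)\<^sup>2 + (g x)\<^sup>2)"
    using assms by (auto simp: L2_def)
  show "(\<lambda>x. f x * g x) \<in> borel_measurable expm"
    by measurable
  have "\<bar>f x * g x\<bar> \<le> (f x)\<^sup>2 + (g x)\<^sup>2" for x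
    using sum_squares_bound[of "\<bar>f x\<bar>" "\<bar>g x\<bar>"] mult_nonneg_nonneg[OF abs_ge_zero abs_ge_zero, of "f x" "g x"]
    unfolding abs_mult power2_abs by linarith
  then show "AE x in expm. norm (f x * g x) \<le> norm ((f x)\<^sup>2 + (g x)\<^sup>2)"
    by simp
qed

lemma L2_const: "(\<lambda>_. c) \<in> L2 expm" "norm_sq (\<lambda>_. c) = c\<^sup>2"
  using expm.prob_space by (auto simp: L2_def norm_sq_def)

lemma L2_cong_AE:
  assumes "f \<in> L2 expm" "g \<in> borel_measurable borel" "AE x in expm. f x = g x"
  shows "g \<in> L2 expm" "norm_sq g = norm_sq f"
proof -
  note [measurable] = L2_measurable[OF assms(1)] assms(2)
  have AE: "AE x in expm. (f x)\<^sup>2 = (g x)\<^sup>2"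
    using assms(3) by eventually_elim simp
  have "integrable expm (\<lambda>x. (f x)\<^sup>2) \<longleftrightarrow> integrable expm (\<lambda>x. (g x)\<^sup>2)"
    using AE by (intro integrable_cong_AE) auto
  then show "g \<in> L2 expm"
    using assms by (simp add: L2_def)
  show "norm_sq g = norm_sq f"
    unfolding norm_sq_def by (rule integral_cong_AE[symmetric]) (use AE in auto)
qed

lemma norm_sq_eq_0_iff: "f \<in> L2 expm \<Longrightarrow> norm_sq f = 0 \<longleftrightarrow> (AE x in expm. f x = 0)"
  unfolding norm_sq_def by (subst integral_nonneg_eq_0_iff_AE) (auto simp: L2_integrable)

lemma L2_abs: "f \<in> L2 expm \<Longrightarrow> (\<lambda>x. \<bar>f x\<bar>) \<in> L2 expm" "norm_sq (\<lambda>x. \<bar>f x\<bar>) = norm_sq f"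
  by (auto simp: L2_def norm_sq_def)


section \<open>Operators with a weakly singular difference kernel\<close>

text \<open>The upper bound is uniform over all kernels considered, which makes the constants below
independent of the kernel; \<open>t powr (- \<alpha>)\<close> satisfies it for \<open>0 \<le> \<alpha> \<le> 1 / 2\<close>. Continuity is needed for
compactness, positivity for a positive top eigenvalue.\<close>

definition admissible :: "(real \<Rightarrow> real) \<Rightarrow> bool" where
  "admissible k \<longleftrightarrow> k \<in> borel_measurable borel \<and> continuous_on {0<..} k \<and> (\<forall>t. 0 \<le> k t) \<and>
     (\<forall>t>0. 0 < k t) \<and> (\<forall>t\<ge>0. k t \<le> 1 + t powr (- 1 / 2))"

definition kernel_op :: "(real \<Rightarrow> real) \<Rightarrow> (real \<Rightarrow> real) \<Rightarrow> real \<Rightarrow> real" where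
  "kernel_op k f u = (\<integral>v. k \<bar>u - v\<bar> * f v \<partial>expm)"

text \<open>The form is an integral over the product space, where everything is absolutely convergent;
the integral defining \<open>kernel_op\<close> converges only for almost every \<open>u\<close>.\<close>

definition qform :: "(real \<Rightarrow> real) \<Rightarrow> (real \<Rightarrow> real) \<Rightarrow> (real \<Rightarrow> real) \<Rightarrow> real" where
  "qform k f g = (\<integral>p. k \<bar>fst p - snd p\<bar> * f (fst p) * g (snd p) \<partial>expm_sq)"

lemma admissibleD:
  assumes "admissible k"
  shows "k \<in> borel_measurable borel" "continuous_on {0<..} k" "0 \<le> k t" "0 < t \<Longrightarrow> 0 < k t"
    "0 \<le> t \<Longrightarrow> k t \<le> 1 + t powr (- 1 / 2)"
  using assms by (auto simp: admissible_def)

lemma admissible_measurable [measurable_dest]: "admissible k \<Longrightarrow> k \<in> borel_measurable borel"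
  by (rule admissibleD)

lemma kernel_op_measurable [measurable]:
  assumes [measurable]: "k \<in> borel_measurable borel" "f \<in> borel_measurable borel"
  shows "kernel_op k f \<in> borel_measurable borel"
  unfolding kernel_op_def by measurable

text \<open>By \<open>2 \<bar>f u g v\<bar> \<le> (f u)\<^sup>2 + (g v)\<^sup>2\<close>, after which one of the two variables can be integrated
out using the bound on the row integrals.\<close>

lemma Schur_test:
  fixes w :: "real \<Rightarrow> real"
  assumes [measurable]: "w \<in> borel_measurable borel" and w0: "\<And>t. 0 \<le> w t" and E: "0 \<le> E"
    and w: "\<And>u. (\<integral>\<^sup>+v. ennreal (w \<bar>u - v\<bar>) \<partial>expm) \<le> ennreal E"
    and f: "f \<in> L2 expm" and g: "g \<in> L2 expm"
  shows "(\<integral>\<^sup>+p. ennreal (w \<bar>fst p - snd p\<bar> * \<bar>f (fst p)\<bar> * \<bar>g (snd p)\<bar>) \<partial>expm_sq)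
     \<le> ennreal (E * ((norm_sq f + norm_sq g) / 2))"
proof -
  note [measurable] = f[THEN L2_measurable] g[THEN L2_measurable]
  have one: "(\<integral>\<^sup>+u. (\<integral>\<^sup>+v. ennreal (w \<bar>u - v\<bar>) * ennreal ((h u)\<^sup>2) \<partial>expm) \<partial>expm) \<le> ennreal (E * norm_sq h)"
    if h: "h \<in> L2 expm" for h
  proof -
    note [measurable] = h[THEN L2_measurable]
    have "(\<integral>\<^sup>+u. (\<integral>\<^sup>+v. ennreal (w \<bar>u - v\<bar>) * ennreal ((h u)\<^sup>2) \<partial>expm) \<partial>expm)
        \<le> (\<integral>\<^sup>+u. ennreal E * ennreal ((h u)\<^sup>2) \<partial>expm)"
      by (intro nn_integral_mono) (auto simp: nn_integral_multc intro!: mult_right_mono w)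
    also have "\<dots> = ennreal (E * norm_sq h)"
      using E by (simp add: nn_integral_cmult nn_integral_norm_sq[OF h] ennreal_mult)
    finally show ?thesis .
  qed
  have two: "(\<integral>\<^sup>+u. (\<integral>\<^sup>+v. ennreal (w \<bar>u - v\<bar>) * ennreal ((g v)\<^sup>2) \<partial>expm) \<partial>expm) \<le> ennreal (E * norm_sq g)"
  proof -
    have "(\<integral>\<^sup>+u. (\<integral>\<^sup>+v. ennreal (w \<bar>u - v\<bar>) * ennreal ((g v)\<^sup>2) \<partial>expm) \<partial>expm)
        = (\<integral>\<^sup>+v. (\<integral>\<^sup>+u. ennreal (w \<bar>u - v\<bar>) * ennreal ((g v)\<^sup>2) \<partial>expm) \<partial>expm)"
      by (rule expm2.Fubini'[symmetric]) measurable
    also have "\<dots> \<le> ennreal (E * norm_sq g)"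
      using one[OF g] by (simp add: abs_minus_commute)
    finally show ?thesis .
  qed
  have amgm: "ennreal (w \<bar>u - v\<bar> * \<bar>f u\<bar> * \<bar>g v\<bar>)
      \<le> ennreal (1 / 2) * (ennreal (w \<bar>u - v\<bar>) * ennreal ((f u)\<^sup>2) + ennreal (w \<bar>u - v\<bar>) * ennreal ((g v)\<^sup>2))" for u v
  proof -
    have "\<bar>f u\<bar> * \<bar>g v\<bar> \<le> ((f u)\<^sup>2 + (g v)\<^sup>2) / 2"
      using sum_squares_bound[of "\<bar>f u\<bar>" "\<bar>g v\<bar>"] by simp
    then have "w \<bar>u - v\<bar> * (\<bar>f u\<bar> * \<bar>g v\<bar>) \<le> w \<bar>u - v\<bar> * (((f u)\<^sup>2 + (g v)\<^sup>2) / 2)"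
      using w0 by (rule mult_left_mono)
    then have "ennreal (w \<bar>u - v\<bar> * \<bar>f u\<bar> * \<bar>g v\<bar>)
        \<le> ennreal (1 / 2 * (w \<bar>u - v\<bar> * (f u)\<^sup>2 + w \<bar>u - v\<bar> * (g v)\<^sup>2))"
      by (intro ennreal_leI) (simp add: algebra_simps)
    also have "\<dots> = ennreal (1 / 2) * (ennreal (w \<bar>u - v\<bar>) * ennreal ((f u)\<^sup>2) + ennreal (w \<bar>u - v\<bar>) * ennreal ((g v)\<^sup>2))"
      using w0 by (subst ennreal_mult) (auto simp: ennreal_mult)
    finally show ?thesis .
  qed
  have "(\<integral>\<^sup>+p. ennreal (w \<bar>fst p - snd p\<bar> * \<bar>f (fst p)\<bar> * \<bar>g (snd p)\<bar>) \<partial>expm_sq)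
     = (\<integral>\<^sup>+u. (\<integral>\<^sup>+v. ennreal (w \<bar>u - v\<bar> * \<bar>f u\<bar> * \<bar>g v\<bar>) \<partial>expm) \<partial>expm)"
    by (subst expm.nn_integral_fst[symmetric]) auto
  also have "\<dots> \<le> (\<integral>\<^sup>+u. (\<integral>\<^sup>+v. ennreal (1 / 2) * (ennreal (w \<bar>u - v\<bar>) * ennreal ((f u)\<^sup>2)
        + ennreal (w \<bar>u - v\<bar>) * ennreal ((g v)\<^sup>2)) \<partial>expm) \<partial>expm)"
    by (intro nn_integral_mono amgm)
  also have "\<dots> = ennreal (1 / 2) * ((\<integral>\<^sup>+u. (\<integral>\<^sup>+v. ennreal (w \<bar>u - v\<bar>) * ennreal ((f u)\<^sup>2) \<partial>expm) \<partial>expm)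
        + (\<integral>\<^sup>+u. (\<integral>\<^sup>+v. ennreal (w \<bar>u - v\<bar>) * ennreal ((g v)\<^sup>2) \<partial>expm) \<partial>expm))"
    by (simp add: nn_integral_cmult nn_integral_add)
  also have "\<dots> \<le> ennreal (1 / 2) * (ennreal (E * norm_sq f) + ennreal (E * norm_sq g))"
    by (intro mult_left_mono add_mono one two f) auto
  also have "\<dots> = ennreal (1 / 2) * ennreal (E * norm_sq f + E * norm_sq g)"
    using E by (subst ennreal_plus) auto
  also have "\<dots> = ennreal (1 / 2 * (E * norm_sq f + E * norm_sq g))"
    using E by (intro ennreal_mult[symmetric]) auto
  also have "1 / 2 * (E * norm_sq f + E * norm_sq g) = E * ((norm_sq f + norm_sq g) / 2)"
    by (simp add: algebra_simps)
  finally show ?thesis .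
qed

lemma nn_integral_weight_le:
  assumes p: "0 < p" "p < 1"
  shows "(\<integral>\<^sup>+v. ennreal (1 + \<bar>u - v\<bar> powr (- p)) \<partial>expm) \<le> ennreal (2 + 2 / (1 - p))"
proof -
  have "(\<integral>\<^sup>+v. ennreal (1 + \<bar>u - v\<bar> powr (- p)) \<partial>expm)
      = (\<integral>\<^sup>+v. 1 + ennreal (\<bar>u - v\<bar> powr (- p)) \<partial>expm)"
    by (intro nn_integral_cong) simp
  also have "\<dots> = 1 + (\<integral>\<^sup>+v. ennreal (\<bar>u - v\<bar> powr (- p)) \<partial>expm)"
    by (subst nn_integral_add) (auto simp: emeasure_expm_UNIV)
  also have "\<dots> \<le> ennreal 1 + ennreal (1 + 2 / (1 - p))"
    using nn_integral_powr_shift_le[OF p] by (simp add: add_left_mono)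
  also have "\<dots> = ennreal (2 + 2 / (1 - p))"
    using p by (subst ennreal_plus[symmetric]) auto
  finally show ?thesis .
qed

lemma nn_integral_cmult_weight_le:
  assumes p: "0 < p" "p < 1" and c: "0 \<le> c"
  shows "(\<integral>\<^sup>+v. ennreal (c * (1 + \<bar>u - v\<bar> powr (- p))) \<partial>expm) \<le> ennreal (c * (2 + 2 / (1 - p)))"
proof -
  have "(\<integral>\<^sup>+v. ennreal (c * (1 + \<bar>u - v\<bar> powr (- p))) \<partial>expm)
      = (\<integral>\<^sup>+v. ennreal c * ennreal (1 + \<bar>u - v\<bar> powr (- p)) \<partial>expm)"
    by (intro nn_integral_cong ennreal_mult) (use c in auto)
  also have "\<dots> = ennreal c * (\<integral>\<^sup>+v. ennreal (1 + \<bar>u - v\<bar> powr (- p)) \<partial>expm)"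
    by (rule nn_integral_cmult) measurable
  also have "\<dots> \<le> ennreal c * ennreal (2 + 2 / (1 - p))"
    by (intro mult_left_mono nn_integral_weight_le p) auto
  also have "\<dots> = ennreal (c * (2 + 2 / (1 - p)))"
    using c p by (intro ennreal_mult[symmetric]) auto
  finally show ?thesis .
qed

lemma admissible_nn_integral_le:
  assumes "admissible k"
  shows "(\<integral>\<^sup>+v. ennreal (k \<bar>u - v\<bar>) \<partial>expm) \<le> ennreal 6"
proof -
  have "(\<integral>\<^sup>+v. ennreal (k \<bar>u - v\<bar>) \<partial>expm) \<le> (\<integral>\<^sup>+v. ennreal (1 + \<bar>u - v\<bar> powr (- (1 / 2))) \<partial>expm)"
    using admissibleD(5)[OF assms] by (intro nn_integral_mono ennreal_leI) auto
  also have "\<dots> \<le> ennreal 6"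
    using nn_integral_weight_le[of "1 / 2" u] by simp
  finally show ?thesis .
qed

lemma qform_integrable:
  assumes k: "admissible k" and f: "f \<in> L2 expm" and g: "g \<in> L2 expm"
  shows "integrable expm_sq (\<lambda>p. k \<bar>fst p - snd p\<bar> * f (fst p) * g (snd p))"
proof (rule integrableI_bounded)
  note [measurable] = f[THEN L2_measurable] g[THEN L2_measurable] k[THEN admissible_measurable]
  show "(\<lambda>p. k \<bar>fst p - snd p\<bar> * f (fst p) * g (snd p)) \<in> borel_measurable expm_sq"
    by measurable
  have "(\<integral>\<^sup>+p. ennreal (norm (k \<bar>fst p - snd p\<bar> * f (fst p) * g (snd p))) \<partial>expm_sq)
     \<le> ennreal (6 * ((norm_sq f + norm_sq g) / 2))"
    using Schur_test[OF _ _ _ admissible_nn_integral_le[OF k] f g] admissibleD(3)[OF k]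
    by (simp add: abs_mult)
  also have "\<dots> < \<infinity>" by simp
  finally show "(\<integral>\<^sup>+p. ennreal (norm (k \<bar>fst p - snd p\<bar> * f (fst p) * g (snd p))) \<partial>expm_sq) < \<infinity>" .
qed

lemma kernel_op_AE_integrable:
  assumes k: "admissible k" and g: "g \<in> L2 expm"
  shows "AE u in expm. integrable expm (\<lambda>v. k \<bar>u - v\<bar> * g v)"
  using expm2.AE_integrable_fst'[OF qform_integrable[OF k L2_const(1)[of 1] g]] by simp

lemma kernel_op_add_scale:
  assumes k: "admissible k" and f: "f \<in> L2 expm" and g: "g \<in> L2 expm"
  shows "AE u in expm. kernel_op k (\<lambda>x. f x + c * g x) u = kernel_op k f u + c * kernel_op k g u"
  using kernel_op_AE_integrable[OF k f] kernel_op_AE_integrable[OF k g]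
proof eventually_elim
  case (elim u)
  have "kernel_op k (\<lambda>x. f x + c * g x) u = (\<integral>v. k \<bar>u - v\<bar> * f v + c * (k \<bar>u - v\<bar> * g v) \<partial>expm)"
    unfolding kernel_op_def by (intro Bochner_Integration.integral_cong) (auto simp: algebra_simps)
  also have "\<dots> = kernel_op k f u + c * kernel_op k g u"
    using elim by (simp add: kernel_op_def)
  finally show ?case .
qed

lemma kernel_op_cong_AE:
  assumes "k \<in> borel_measurable borel" "f \<in> borel_measurable borel" "g \<in> borel_measurable borel"
    and "AE x in expm. f x = g x"
  shows "kernel_op k f u = kernel_op k g u"
proof -
  note [measurable] = assms(1-3)
  show ?thesis unfolding kernel_op_def using assms(4) by (intro integral_cong_AE) auto
qed

lemma qform_eq_inner:
  assumes k: "admissible k" and f: "f \<in> L2 expm" and g: "g \<in> L2 expm"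
  shows "qform k f g = (\<integral>u. f u * kernel_op k g u \<partial>expm)"
proof -
  have "qform k f g = (\<integral>u. (\<integral>v. k \<bar>u - v\<bar> * f u * g v \<partial>expm) \<partial>expm)"
    unfolding qform_def using expm2.integral_fst'[OF qform_integrable[OF k f g]] by simp
  also have "\<dots> = (\<integral>u. (\<integral>v. f u * (k \<bar>u - v\<bar> * g v) \<partial>expm) \<partial>expm)"
    by (simp add: mult_ac)
  finally show ?thesis by (simp add: kernel_op_def)
qed

lemma qform_commute:
  assumes k: "admissible k" and f: "f \<in> L2 expm" and g: "g \<in> L2 expm"
  shows "qform k f g = qform k g f"
proof -
  note [measurable] = f[THEN L2_measurable] g[THEN L2_measurable] k[THEN admissible_measurable]
  have "qform k f g = (\<integral>(x, y). k \<bar>snd (x, y) - fst (x, y)\<bar> * f (snd (x, y)) * g (fst (x, y)) \<partial>expm_sq)"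
    unfolding qform_def
    using expm2.integral_product_swap[of "\<lambda>p. k \<bar>fst p - snd p\<bar> * f (fst p) * g (snd p)"]
    by (simp add: split_beta')
  also have "\<dots> = qform k g f"
    unfolding qform_def by (intro Bochner_Integration.integral_cong) (auto simp: abs_minus_commute mult_ac)
  finally show ?thesis .
qed

lemma qform_add_scale_left:
  assumes k: "admissible k" and f: "f \<in> L2 expm" and g: "g \<in> L2 expm" and h: "h \<in> L2 expm"
  shows "qform k (\<lambda>x. f x + c * g x) h = qform k f h + c * qform k g h"
proof -
  have "qform k (\<lambda>x. f x + c * g x) h = (\<integral>p. k \<bar>fst p - snd p\<bar> * f (fst p) * h (snd p)
      + c * (k \<bar>fst p - snd p\<bar> * g (fst p) * h (snd p)) \<partial>expm_sq)"
    unfolding qform_def by (intro Bochner_Integration.integral_cong) (auto simp: algebra_simps)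
  also have "\<dots> = qform k f h + c * qform k g h"
    unfolding qform_def using qform_integrable[OF k f h] qform_integrable[OF k g h] by simp
  finally show ?thesis .
qed

lemma qform_square_expand:
  assumes k: "admissible k" and f: "f \<in> L2 expm" and g: "g \<in> L2 expm"
  shows "qform k (\<lambda>x. f x + c * g x) (\<lambda>x. f x + c * g x)
    = qform k f f + 2 * c * qform k f g + c\<^sup>2 * qform k g g"
proof -
  let ?h = "\<lambda>x. f x + c * g x"
  have h: "?h \<in> L2 expm" using L2_add(1)[OF f L2_scale(1)[OF g]] .
  have "qform k ?h ?h = qform k f ?h + c * qform k g ?h"
    by (rule qform_add_scale_left[OF k f g h])
  also have "qform k f ?h = qform k f f + c * qform k g f"
    by (subst qform_commute[OF k f h]) (rule qform_add_scale_left[OF k f g f])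
  also have "qform k g ?h = qform k f g + c * qform k g g"
    by (subst qform_commute[OF k g h]) (rule qform_add_scale_left[OF k f g g])
  finally show ?thesis
    by (simp add: qform_commute[OF k g f] algebra_simps power2_eq_square)
qed

lemma norm_sq_square_expand:
  assumes f: "f \<in> L2 expm" and g: "g \<in> L2 expm"
  shows "norm_sq (\<lambda>x. f x + c * g x) = norm_sq f + 2 * c * (\<integral>x. f x * g x \<partial>expm) + c\<^sup>2 * norm_sq g"
proof -
  have "norm_sq (\<lambda>x. f x + c * g x) = (\<integral>x. (f x)\<^sup>2 + 2 * c * (f x * g x) + c\<^sup>2 * (g x)\<^sup>2 \<partial>expm)"
    unfolding norm_sq_def by (intro Bochner_Integration.integral_cong) (auto simp: power2_eq_square algebra_simps)
  then show ?thesis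
    using L2_integrable[OF f] L2_integrable[OF g] L2_mult_integrable[OF f g] by (simp add: norm_sq_def)
qed

lemma abs_qform_le:
  assumes k: "admissible k" and f: "f \<in> L2 expm"
  shows "\<bar>qform k f f\<bar> \<le> 6 * norm_sq f"
proof -
  note [measurable] = f[THEN L2_measurable] k[THEN admissible_measurable]
  have "ennreal \<bar>qform k f f\<bar> \<le> (\<integral>\<^sup>+p. ennreal (norm (k \<bar>fst p - snd p\<bar> * f (fst p) * f (snd p))) \<partial>expm_sq)"
    unfolding qform_def using integral_norm_bound_ennreal[OF qform_integrable[OF k f f]] by simp
  also have "\<dots> \<le> ennreal (6 * ((norm_sq f + norm_sq f) / 2))"
    using Schur_test[OF _ _ _ admissible_nn_integral_le[OF k] f f] admissibleD(3)[OF k]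
    by (simp add: abs_mult)
  finally show ?thesis by (simp add: ennreal_le_iff)
qed


section \<open>Smoothing\<close>

text \<open>An admissible kernel is at most \<open>weight\<^sup>2\<close>, and the exponent \<open>1 / 4\<close> is chosen so that in the
splitting \<open>weight\<^sup>2 = weight\<^sup>3\<^sup>/\<^sup>2 weight\<^sup>1\<^sup>/\<^sup>2\<close> the square of the first factor is integrable, while the
square of the second one is so mild that even the product of two shifted copies is.\<close>

definition weight :: "real \<Rightarrow> real" where
  "weight t = 1 + \<bar>t\<bar> powr (- 1 / 4)"

lemma weight_measurable [measurable]: "weight \<in> borel_measurable borel"
  unfolding weight_def by measurable

lemma weight_pos: "0 < weight t" "0 \<le> weight t"
  by (simp_all add: weight_def add_pos_nonneg)

lemma admissible_le_weight:
  assumes "admissible k" "0 \<le> t" shows "k t \<le> (weight t)\<^sup>2"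
proof -
  have "k t \<le> 1 + t powr (- 1 / 2)" by (rule admissibleD(5)[OF assms])
  also have "t powr (- 1 / 2) = (t powr (- 1 / 4))\<^sup>2"
    by (simp add: power2_eq_square powr_add[symmetric])
  also have "1 + (t powr (- 1 / 4))\<^sup>2 \<le> (weight t)\<^sup>2"
    using assms by (simp add: weight_def power2_sum)
  finally show ?thesis by simp
qed

lemma nn_integral_weight: "(\<integral>\<^sup>+v. ennreal (weight (u - v)) \<partial>expm) \<le> ennreal 5"
proof -
  have "(\<integral>\<^sup>+v. ennreal (weight (u - v)) \<partial>expm) \<le> ennreal (2 + 2 / (1 - 1 / 4))"
    using nn_integral_weight_le[of "1 / 4" u] by (simp add: weight_def)
  also have "\<dots> \<le> ennreal 5" by (rule ennreal_leI) simp
  finally show ?thesis .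
qed

lemma nn_integral_weight_square: "(\<integral>\<^sup>+v. ennreal ((weight (u - v))\<^sup>2) \<partial>expm) \<le> ennreal 12"
proof -
  have le: "(weight t)\<^sup>2 \<le> 2 * (1 + \<bar>t\<bar> powr (- (1 / 2)))" for t
  proof -
    have "\<bar>t\<bar> powr (- (1 / 2)) = (\<bar>t\<bar> powr (- 1 / 4))\<^sup>2"
      by (simp add: power2_eq_square powr_add[symmetric])
    then show ?thesis
      using sum_squares_bound[of 1 "\<bar>t\<bar> powr (- 1 / 4)"] by (simp add: weight_def power2_sum)
  qed
  have "(\<integral>\<^sup>+v. ennreal ((weight (u - v))\<^sup>2) \<partial>expm) \<le> (\<integral>\<^sup>+v. ennreal (2 * (1 + \<bar>u - v\<bar> powr (- (1 / 2)))) \<partial>expm)"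
    by (intro nn_integral_mono ennreal_leI le)
  also have "\<dots> \<le> ennreal 12"
    using nn_integral_cmult_weight_le[of "1 / 2" "2" u] by simp
  finally show ?thesis .
qed

lemma nn_integral_weight_cube: "(\<integral>\<^sup>+v. ennreal ((weight (u - v)) ^ 3) \<partial>expm) \<le> ennreal 40"
proof -
  have cube: "(1 + x) ^ 3 \<le> 4 * (1 + x ^ 3)" if "0 \<le> x" for x :: real
  proof -
    have "4 * (1 + x ^ 3) - (1 + x) ^ 3 = 3 * (1 + x) * (1 - x)\<^sup>2"
      by (simp add: power2_eq_square power3_eq_cube algebra_simps)
    moreover have "0 \<le> 3 * (1 + x) * (1 - x)\<^sup>2" using that by simp
    ultimately show ?thesis by linarith
  qed
  have le: "(weight t) ^ 3 \<le> 4 * (1 + \<bar>t\<bar> powr (- (3 / 4)))" for t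
  proof -
    have "\<bar>t\<bar> powr (- (3 / 4)) = (\<bar>t\<bar> powr (- 1 / 4)) ^ 3"
      by (simp add: power3_eq_cube powr_add[symmetric])
    then show ?thesis
      using cube[of "\<bar>t\<bar> powr (- 1 / 4)"] by (simp add: weight_def)
  qed
  have "(\<integral>\<^sup>+v. ennreal ((weight (u - v)) ^ 3) \<partial>expm) \<le> (\<integral>\<^sup>+v. ennreal (4 * (1 + \<bar>u - v\<bar> powr (- (3 / 4)))) \<partial>expm)"
    by (intro nn_integral_mono ennreal_leI le)
  also have "\<dots> \<le> ennreal 40"
    using nn_integral_cmult_weight_le[of "3 / 4" "4" u] by simp
  finally show ?thesis .
qed

text \<open>Cauchy--Schwarz for the splitting \<open>weight\<^sup>3\<^sup>/\<^sup>2 \<cdot> (weight\<^sup>1\<^sup>/\<^sup>2 f)\<close>. The right-hand side may be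
infinite, and where the integral on the left diverges it is \<open>0\<close>, so that the bound holds for every
\<open>u\<close>.\<close>

lemma kernel_op_pointwise:
  assumes k: "admissible k" and [measurable]: "f \<in> borel_measurable borel"
  shows "ennreal ((kernel_op k f u)\<^sup>2) \<le> 40 * (\<integral>\<^sup>+v. ennreal (weight (u - v) * (f v)\<^sup>2) \<partial>expm)"
proof -
  note [measurable] = k[THEN admissible_measurable]
  define J where "J = (\<integral>\<^sup>+v. ennreal (weight (u - v) * (f v)\<^sup>2) \<partial>expm)"
  show ?thesis
  proof (cases "J = \<infinity>")
    case True
    then show ?thesis by (simp add: J_def ennreal_mult_top)
  next
    case False
    then obtain j where j: "J = ennreal j" "0 \<le> j" by (cases J) auto
    let ?F = "\<lambda>v. weight (u - v) * sqrt (weight (u - v))" and ?G = "\<lambda>v. sqrt (weight (u - v)) * f v"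
    have F2: "(?F v)\<^sup>2 = weight (u - v) ^ 3" for v
      using weight_pos[of "u - v"] by (simp add: power_mult_distrib power2_eq_square power3_eq_cube)
    have G2: "(?G v)\<^sup>2 = weight (u - v) * (f v)\<^sup>2" for v
      using weight_pos[of "u - v"] by (simp add: power_mult_distrib)
    have FG: "k \<bar>u - v\<bar> * \<bar>f v\<bar> \<le> \<bar>?F v * ?G v\<bar>" for v
    proof -
      have "k \<bar>u - v\<bar> * \<bar>f v\<bar> \<le> (weight (u - v))\<^sup>2 * \<bar>f v\<bar>"
        using admissible_le_weight[OF k, of "\<bar>u - v\<bar>"] by (intro mult_right_mono) (auto simp: weight_def)
      also have "\<dots> = \<bar>?F v * ?G v\<bar>"
        using weight_pos[of "u - v"] by (simp add: abs_mult power2_eq_square)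
      finally show ?thesis .
    qed
    have "\<bar>kernel_op k f u\<bar> \<le> sqrt (40 * j)"
    proof (cases "integrable expm (\<lambda>v. k \<bar>u - v\<bar> * f v)")
      case True
      have "ennreal \<bar>kernel_op k f u\<bar> \<le> (\<integral>\<^sup>+v. ennreal (norm (k \<bar>u - v\<bar> * f v)) \<partial>expm)"
        unfolding kernel_op_def using integral_norm_bound_ennreal[OF True] by simp
      also have "\<dots> \<le> (\<integral>\<^sup>+v. ennreal \<bar>?F v * ?G v\<bar> \<partial>expm)"
        using FG admissibleD(3)[OF k] by (intro nn_integral_mono ennreal_leI) (simp add: abs_mult)
      also have "\<dots> \<le> ennreal (sqrt (40 * j))"
        using nn_integral_weight_cube[of u] j unfolding J_def
        by (intro nn_integral_Cauchy_Schwarz) (auto simp only: F2 G2, measurable)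
      finally show ?thesis using j by (simp add: ennreal_le_iff)
    next
      case False
      then show ?thesis using j by (simp add: kernel_op_def not_integrable_integral_eq)
    qed
    then have "(kernel_op k f u)\<^sup>2 \<le> 40 * j"
      using j by (metis abs_le_square_iff abs_of_nonneg real_sqrt_ge_0_iff real_sqrt_pow2 mult_nonneg_nonneg zero_le_numeral)
    then show ?thesis
      using j by (simp add: J_def[symmetric] ennreal_leI flip: ennreal_mult ennreal_numeral)
  qed
qed

lemma kernel_op_L2:
  assumes k: "admissible k" and f: "f \<in> L2 expm"
  shows "kernel_op k f \<in> L2 expm" "norm_sq (kernel_op k f) \<le> 200 * norm_sq f"
proof -
  note [measurable] = f[THEN L2_measurable] k[THEN admissible_measurable]
  have "(\<integral>\<^sup>+u. ennreal ((kernel_op k f u)\<^sup>2) \<partial>expm)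
      \<le> (\<integral>\<^sup>+u. 40 * (\<integral>\<^sup>+v. ennreal (weight (u - v) * (f v)\<^sup>2) \<partial>expm) \<partial>expm)"
    by (intro nn_integral_mono kernel_op_pointwise[OF k]) measurable
  also have "\<dots> = 40 * (\<integral>\<^sup>+u. (\<integral>\<^sup>+v. ennreal (weight (u - v) * (f v)\<^sup>2) \<partial>expm) \<partial>expm)"
    by (rule nn_integral_cmult) measurable
  also have "(\<integral>\<^sup>+u. (\<integral>\<^sup>+v. ennreal (weight (u - v) * (f v)\<^sup>2) \<partial>expm) \<partial>expm)
      = (\<integral>\<^sup>+v. (\<integral>\<^sup>+u. ennreal (weight (u - v) * (f v)\<^sup>2) \<partial>expm) \<partial>expm)"
    by (rule expm2.Fubini'[symmetric]) measurable
  also have "\<dots> = (\<integral>\<^sup>+v. (\<integral>\<^sup>+u. ennreal (weight (v - u)) \<partial>expm) * ennreal ((f v)\<^sup>2) \<partial>expm)"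
    using weight_pos
    by (subst nn_integral_multc[symmetric]) (auto simp: ennreal_mult weight_def abs_minus_commute)
  also have "\<dots> \<le> (\<integral>\<^sup>+v. ennreal 5 * ennreal ((f v)\<^sup>2) \<partial>expm)"
    by (intro nn_integral_mono mult_right_mono nn_integral_weight) auto
  also have "\<dots> = ennreal (5 * norm_sq f)"
    by (simp add: nn_integral_cmult nn_integral_norm_sq[OF f] ennreal_mult)
  also have "40 * ennreal (5 * norm_sq f) = ennreal (200 * norm_sq f)"
    by (simp flip: ennreal_mult ennreal_numeral)
  finally have "(\<integral>\<^sup>+u. ennreal ((kernel_op k f u)\<^sup>2) \<partial>expm) \<le> ennreal (200 * norm_sq f)"
    by (simp add: mult_left_mono)
  then show "kernel_op k f \<in> L2 expm" "norm_sq (kernel_op k f) \<le> 200 * norm_sq f"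
    by (auto intro!: L2_boundI)
qed

text \<open>Iterating \<open>kernel_op_pointwise\<close> leaves the kernel \<open>\<integral> weight (u - v) weight (v - w)\<close>, which is
bounded because \<open>weight\<close> has uniformly bounded \<open>L\<^sup>2\<close> norms.\<close>

lemma kernel_op_twice_bounded:
  assumes k: "admissible k" and f: "f \<in> L2 expm"
  shows "\<bar>kernel_op k (kernel_op k f) u\<bar> \<le> sqrt (19200 * norm_sq f)"
proof -
  note [measurable] = f[THEN L2_measurable] k[THEN admissible_measurable]
  have two: "(\<integral>\<^sup>+v. ennreal (weight (u - v) * weight (v - w)) \<partial>expm) \<le> ennreal 12" for w
  proof -
    have "(\<integral>\<^sup>+v. ennreal \<bar>weight (u - v) * weight (v - w)\<bar> \<partial>expm) \<le> ennreal (sqrt (12 * 12))"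
      using nn_integral_weight_square[of u] nn_integral_weight_square[of w]
      by (intro nn_integral_Cauchy_Schwarz) (auto simp: weight_def abs_minus_commute)
    then show ?thesis using weight_pos by (simp add: abs_mult)
  qed
  have "ennreal ((kernel_op k (kernel_op k f) u)\<^sup>2)
      \<le> 40 * (\<integral>\<^sup>+v. ennreal (weight (u - v) * (kernel_op k f v)\<^sup>2) \<partial>expm)"
    by (intro kernel_op_pointwise[OF k]) measurable
  also have "\<dots> \<le> 40 * (\<integral>\<^sup>+v. 40 * (\<integral>\<^sup>+w. ennreal (weight (u - v)) * ennreal (weight (v - w) * (f w)\<^sup>2) \<partial>expm) \<partial>expm)"
  proof (intro mult_left_mono nn_integral_mono)
    fix v
    have "ennreal (weight (u - v) * (kernel_op k f v)\<^sup>2) = ennreal (weight (u - v)) * ennreal ((kernel_op k f v)\<^sup>2)"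
      using weight_pos by (simp add: ennreal_mult)
    also have "\<dots> \<le> ennreal (weight (u - v)) * (40 * (\<integral>\<^sup>+w. ennreal (weight (v - w) * (f w)\<^sup>2) \<partial>expm))"
      by (intro mult_left_mono kernel_op_pointwise[OF k]) auto
    also have "\<dots> = 40 * (\<integral>\<^sup>+w. ennreal (weight (u - v)) * ennreal (weight (v - w) * (f w)\<^sup>2) \<partial>expm)"
      by (subst nn_integral_cmult) (auto simp: mult_ac)
    finally show "ennreal (weight (u - v) * (kernel_op k f v)\<^sup>2) \<le> \<dots>" .
  qed auto
  also have "\<dots> = 40 * (40 * (\<integral>\<^sup>+v. (\<integral>\<^sup>+w. ennreal (weight (u - v)) * ennreal (weight (v - w) * (f w)\<^sup>2) \<partial>expm) \<partial>expm))"
    by (subst nn_integral_cmult) auto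
  also have "(\<integral>\<^sup>+v. (\<integral>\<^sup>+w. ennreal (weight (u - v)) * ennreal (weight (v - w) * (f w)\<^sup>2) \<partial>expm) \<partial>expm)
      = (\<integral>\<^sup>+w. (\<integral>\<^sup>+v. ennreal (weight (u - v)) * ennreal (weight (v - w) * (f w)\<^sup>2) \<partial>expm) \<partial>expm)"
    by (rule expm2.Fubini'[symmetric]) measurable
  also have "\<dots> = (\<integral>\<^sup>+w. (\<integral>\<^sup>+v. ennreal (weight (u - v) * weight (v - w)) \<partial>expm) * ennreal ((f w)\<^sup>2) \<partial>expm)"
    using weight_pos by (subst nn_integral_multc[symmetric]) (auto simp: ennreal_mult mult_ac)
  also have "40 * (40 * \<dots>) \<le> 40 * (40 * (\<integral>\<^sup>+w. ennreal 12 * ennreal ((f w)\<^sup>2) \<partial>expm))"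
    by (intro nn_integral_mono mult_right_mono mult_left_mono two) auto
  also have "(\<integral>\<^sup>+w. ennreal 12 * ennreal ((f w)\<^sup>2) \<partial>expm) = ennreal (12 * norm_sq f)"
    by (simp add: nn_integral_cmult nn_integral_norm_sq[OF f] ennreal_mult)
  also have "40 * (40 * ennreal (12 * norm_sq f)) = ennreal (19200 * norm_sq f)"
    by (simp flip: ennreal_mult ennreal_numeral)
  finally have "(kernel_op k (kernel_op k f) u)\<^sup>2 \<le> 19200 * norm_sq f"
    by simp
  then show ?thesis
    by (metis real_sqrt_abs real_sqrt_le_iff)
qed


section \<open>The Rayleigh quotient and its supremum\<close>

definition top_value :: "(real \<Rightarrow> real) \<Rightarrow> real" where
  "top_value k = (SUP f\<in>{f \<in> L2 expm. norm_sq f = 1}. qform k f f)"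

lemma unit_vectors_nonempty: "{f \<in> L2 expm. norm_sq f = 1} \<noteq> {}"
  using L2_const[of 1] by auto

lemma bdd_above_qform:
  assumes "admissible k"
  shows "bdd_above ((\<lambda>f. qform k f f) ` {f \<in> L2 expm. norm_sq f = 1})"
proof (rule bdd_aboveI2)
  fix f assume "f \<in> {f \<in> L2 expm. norm_sq f = 1}"
  then show "qform k f f \<le> 6" using abs_qform_le[OF assms, of f] by auto
qed

lemma qform_scale:
  "qform k (\<lambda>x. c * f x) (\<lambda>x. c * f x) = c\<^sup>2 * qform k f f"
proof -
  have "qform k (\<lambda>x. c * f x) (\<lambda>x. c * f x)
      = (\<integral>p. c\<^sup>2 * (k \<bar>fst p - snd p\<bar> * f (fst p) * f (snd p)) \<partial>expm_sq)"
    unfolding qform_def by (intro Bochner_Integration.integral_cong) (auto simp: power2_eq_square)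
  then show ?thesis by (simp add: qform_def)
qed

lemma qform_le_top_value:
  assumes k: "admissible k" and f: "f \<in> L2 expm"
  shows "qform k f f \<le> top_value k * norm_sq f"
proof (cases "norm_sq f = 0")
  case True
  then show ?thesis using abs_qform_le[OF k f] by simp
next
  case False
  then have pos: "norm_sq f > 0" using norm_sq_nonneg[of f] by linarith
  define c where "c = 1 / sqrt (norm_sq f)"
  have c2: "c\<^sup>2 = 1 / norm_sq f" using pos by (simp add: c_def power_divide)
  have "(\<lambda>x. c * f x) \<in> {f \<in> L2 expm. norm_sq f = 1}"
    using L2_scale[OF f, of c] c2 pos by simp
  then have "qform k (\<lambda>x. c * f x) (\<lambda>x. c * f x) \<le> top_value k"
    unfolding top_value_def by (rule cSUP_upper[OF _ bdd_above_qform[OF k]])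
  then show ?thesis
    using pos by (simp add: qform_scale c2 field_simps)
qed

lemma top_value_le:
  assumes "\<And>f. f \<in> L2 expm \<Longrightarrow> norm_sq f = 1 \<Longrightarrow> qform k f f \<le> c"
  shows "top_value k \<le> c"
  unfolding top_value_def using unit_vectors_nonempty by (rule cSUP_least) (use assms in auto)

lemma top_value_le_6: "admissible k \<Longrightarrow> top_value k \<le> 6"
  using abs_qform_le by (intro top_value_le) fastforce

text \<open>A vanishing integral would force \<open>h u h v = 0\<close> for almost all pairs, the diagonal being a null
set, and hence \<open>h = 0\<close>.\<close>

lemma strictly_positive_kernel:
  fixes w h :: "real \<Rightarrow> real"
  assumes [measurable]: "w \<in> borel_measurable borel" "h \<in> borel_measurable borel"
    and w: "\<And>t. 0 \<le> t \<Longrightarrow> 0 \<le> w t" "\<And>t. 0 < t \<Longrightarrow> 0 < w t" and h: "\<And>x. 0 \<le> h x"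
    and int: "integrable expm_sq (\<lambda>p. w \<bar>fst p - snd p\<bar> * h (fst p) * h (snd p))"
    and not0: "\<not> (AE x in expm. h x = 0)"
  shows "0 < (\<integral>p. w \<bar>fst p - snd p\<bar> * h (fst p) * h (snd p) \<partial>expm_sq)"
proof -
  have nonneg: "0 \<le> w \<bar>fst p - snd p\<bar> * h (fst p) * h (snd p)" for p
    using w h by (intro mult_nonneg_nonneg) auto
  have "(\<integral>p. w \<bar>fst p - snd p\<bar> * h (fst p) * h (snd p) \<partial>expm_sq) \<noteq> 0"
  proof
    assume "(\<integral>p. w \<bar>fst p - snd p\<bar> * h (fst p) * h (snd p) \<partial>expm_sq) = 0"
    then have "AE p in expm_sq. w \<bar>fst p - snd p\<bar> * h (fst p) * h (snd p) = 0"
      using int nonneg by (subst (asm) integral_nonneg_eq_0_iff_AE) auto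
    then have "AE u in expm. AE v in expm. w \<bar>u - v\<bar> * h u * h v = 0"
      using expm2.AE_pair by fastforce
    then have "AE u in expm. h u = 0"
    proof eventually_elim
      case (elim u)
      show ?case
      proof (rule ccontr)
        assume "h u \<noteq> 0"
        have "AE v in expm. h v = 0"
          using elim AE_expm_neq[of u]
        proof eventually_elim
          case (elim v)
          then show ?case using \<open>h u \<noteq> 0\<close> w(2)[of "\<bar>u - v\<bar>"] by auto
        qed
        with not0 show False by simp
      qed
    qed
    with not0 show False by simp
  qed
  moreover have "0 \<le> (\<integral>p. w \<bar>fst p - snd p\<bar> * h (fst p) * h (snd p) \<partial>expm_sq)"
    using nonneg by (rule Bochner_Integration.integral_nonneg)
  ultimately show ?thesis by simp
qed

lemma top_value_pos:
  assumes k: "admissible k"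
  shows "0 < top_value k"
proof -
  have "0 < qform k (\<lambda>_. 1) (\<lambda>_. 1)"
    unfolding qform_def
    using k qform_integrable[OF k L2_const(1)[of 1] L2_const(1)[of 1]] expm.prob_space
    by (intro strictly_positive_kernel) (auto simp: admissible_def)
  also have "\<dots> \<le> top_value k"
    using qform_le_top_value[OF k L2_const(1)[of 1]] by (simp add: L2_const)
  finally show ?thesis .
qed

lemma qform_eigenfunction:
  assumes k: "admissible k" and f: "f \<in> L2 expm" and ev: "AE x in expm. kernel_op k f x = l * f x"
  shows "qform k f f = l * norm_sq f"
proof -
  note [measurable] = f[THEN L2_measurable] k[THEN admissible_measurable]
  have "qform k f f = (\<integral>u. l * (f u)\<^sup>2 \<partial>expm)"
    unfolding qform_eq_inner[OF k f f]
  proof (rule integral_cong_AE)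
    show "AE x in expm. f x * kernel_op k f x = l * (f x)\<^sup>2"
      using ev by eventually_elim (simp add: power2_eq_square)
  qed (auto intro!: borel_measurable_times)
  then show ?thesis by (simp add: norm_sq_def)
qed

lemma eigenvalue_le_top_value:
  assumes k: "admissible k" and "is_eigenvalue expm (kernel_op k) l"
  shows "l \<le> top_value k"
proof -
  obtain f where f: "f \<in> L2 expm" "\<not> (AE x in expm. f x = 0)"
    and ev: "AE x in expm. kernel_op k f x = l * f x"
    using assms by (auto simp: is_eigenvalue_def)
  have pos: "norm_sq f > 0"
    using f norm_sq_eq_0_iff[OF f(1)] norm_sq_nonneg[of f] by linarith
  have "l * norm_sq f \<le> top_value k * norm_sq f"
    using qform_le_top_value[OF k f(1)] by (simp add: qform_eigenfunction[OF k f(1) ev])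
  then show ?thesis using pos by simp
qed

text \<open>With \<open>M\<close> the supremum, the form \<open>b f = M \<parallel>f\<parallel>\<^sup>2 - qform f f\<close> is nonnegative. Evaluating it at
\<open>f + t g\<close> with the residual \<open>g = A f - M f\<close>, whose inner product with \<open>f\<close> in the polarised form is
\<open>- \<parallel>g\<parallel>\<^sup>2\<close>, and choosing \<open>t\<close> well bounds \<open>\<parallel>g\<parallel>\<^sup>2\<close> by \<open>b f\<close>. So the residuals of a maximising sequence tend to
\<open>0\<close>.\<close>

lemma residual_le:
  assumes k: "admissible k" and f: "f \<in> L2 expm"
  shows "norm_sq (\<lambda>x. kernel_op k f x - top_value k * f x)
    \<le> (top_value k + 6) * (top_value k * norm_sq f - qform k f f)"
proof -
  define M where "M = top_value k"
  define g where "g = (\<lambda>x. kernel_op k f x - M * f x)"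
  have M: "0 < M" using top_value_pos[OF k] by (simp add: M_def)
  note A = kernel_op_L2(1)[OF k f]
  have g: "g \<in> L2 expm"
    unfolding g_def by (intro L2_diff A L2_scale f)
  \<comment> \<open>\<open>M + 6\<close> bounds the form \<open>b\<close>, so this nearly minimises the quadratic polynomial in \<open>t\<close>.\<close>
  define t where "t = 1 / (M + 6)"
  define s where "s = norm_sq g"
  have inner: "qform k f g - M * (\<integral>x. f x * g x \<partial>expm) = s"
  proof -
    have "qform k f g = (\<integral>x. g x * kernel_op k f x \<partial>expm)"
      using qform_commute[OF k f g] qform_eq_inner[OF k g f] by simp
    then have "qform k f g - M * (\<integral>x. f x * g x \<partial>expm) = (\<integral>x. g x * kernel_op k f x - M * (f x * g x) \<partial>expm)"
      using L2_mult_integrable[OF g A] L2_mult_integrable[OF f g] by simp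
    also have "\<dots> = s"
      unfolding s_def norm_sq_def by (intro Bochner_Integration.integral_cong) (auto simp: g_def power2_eq_square algebra_simps)
    finally show ?thesis .
  qed
  have h: "(\<lambda>x. f x + t * g x) \<in> L2 expm"
    by (intro L2_add L2_scale f g)
  have "0 \<le> M * norm_sq (\<lambda>x. f x + t * g x) - qform k (\<lambda>x. f x + t * g x) (\<lambda>x. f x + t * g x)"
    using qform_le_top_value[OF k h] by (simp add: M_def)
  also have "\<dots> = (M * norm_sq f - qform k f f) - 2 * t * (qform k f g - M * (\<integral>x. f x * g x \<partial>expm)) + t\<^sup>2 * (M * s - qform k g g)"
    by (simp add: norm_sq_square_expand[OF f g] qform_square_expand[OF k f g] s_def algebra_simps)
  also have "\<dots> \<le> (M * norm_sq f - qform k f f) - 2 * t * s + t\<^sup>2 * ((M + 6) * s)"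
    unfolding inner using abs_qform_le[OF k g] by (intro add_left_mono mult_left_mono) (auto simp: s_def algebra_simps)
  also have "t\<^sup>2 * ((M + 6) * s) = t * s"
    using M by (simp add: t_def power2_eq_square)
  finally have "t * s \<le> M * norm_sq f - qform k f f" by (simp add: mult_ac)
  then have "s \<le> (M + 6) * (M * norm_sq f - qform k f f)"
    using M by (simp add: t_def field_simps)
  then show ?thesis by (simp add: s_def g_def M_def)
qed

text \<open>Factor \<open>A\<^sup>3 - m\<^sup>3 = (A\<^sup>2 + m A + m\<^sup>2) (A - m)\<close>; the first factor on the right is a bounded operator.\<close>

lemma cube_residual_le:
  assumes k: "admissible k" and f: "f \<in> L2 expm"
  shows "norm_sq (\<lambda>x. kernel_op k (kernel_op k (kernel_op k f)) x - m ^ 3 * f x)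
    \<le> (80000 + 800 * m\<^sup>2 + 4 * m ^ 4) * norm_sq (\<lambda>x. kernel_op k f x - m * f x)"
proof -
  let ?A = "kernel_op k"
  define d where "d = (\<lambda>x. ?A f x - m * f x)"
  note A = kernel_op_L2(1)[OF k]
  have d: "d \<in> L2 expm" unfolding d_def by (intro L2_diff A L2_scale f)
  note [measurable] = k[THEN admissible_measurable] f[THEN L2_measurable] d[THEN L2_measurable]
  have Af: "(\<lambda>x. d x + m * f x) = ?A f" by (auto simp: d_def)
  have AE2: "AE x in expm. ?A (?A f) x = ?A d x + m * ?A f x"
    using kernel_op_add_scale[OF k d f, of m] by (simp only: Af)
  have "AE x in expm. ?A (?A (?A f)) x = ?A (\<lambda>x. ?A d x + m * ?A f x) x"
  proof (rule AE_I2)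
    fix x
    show "?A (?A (?A f)) x = ?A (\<lambda>x. ?A d x + m * ?A f x) x"
      by (rule kernel_op_cong_AE[OF _ _ _ AE2]) measurable
  qed
  with kernel_op_add_scale[OF k A[OF d] A[OF f], of m] AE2
  have AE3: "AE x in expm. ?A (?A d) x + (m * ?A d x + m\<^sup>2 * d x) = ?A (?A (?A f)) x - m ^ 3 * f x"
    by eventually_elim (simp add: d_def algebra_simps power2_eq_square power3_eq_cube)
  have L: "(\<lambda>x. m * ?A d x + m\<^sup>2 * d x) \<in> L2 expm"
    by (intro L2_add L2_scale A d)
  have "norm_sq (\<lambda>x. ?A (?A (?A f)) x - m ^ 3 * f x) = norm_sq (\<lambda>x. ?A (?A d) x + (m * ?A d x + m\<^sup>2 * d x))"
    using AE3 by (intro L2_cong_AE(2) L2_add A L d) measurable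
  also have "\<dots> \<le> 2 * norm_sq (?A (?A d)) + 2 * norm_sq (\<lambda>x. m * ?A d x + m\<^sup>2 * d x)"
    by (intro L2_add A L d)
  also have "norm_sq (\<lambda>x. m * ?A d x + m\<^sup>2 * d x) \<le> 2 * (m\<^sup>2 * norm_sq (?A d)) + 2 * (m ^ 4 * norm_sq d)"
    using L2_add(2)[OF L2_scale(1)[OF A[OF d], of m] L2_scale(1)[OF d, of "m\<^sup>2"]]
    by (simp add: L2_scale(2)[OF A[OF d]] L2_scale(2)[OF d])
  also have "2 * norm_sq (?A (?A d)) + 2 * (2 * (m\<^sup>2 * norm_sq (?A d)) + 2 * (m ^ 4 * norm_sq d))
     \<le> 2 * (200 * (200 * norm_sq d)) + 2 * (2 * (m\<^sup>2 * (200 * norm_sq d)) + 2 * (m ^ 4 * norm_sq d))"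
    using kernel_op_L2(2)[OF k A[OF d]] kernel_op_L2(2)[OF k d]
    by (intro add_mono mult_left_mono) auto
  also have "\<dots> = (80000 + 800 * m\<^sup>2 + 4 * m ^ 4) * norm_sq d"
    by (simp add: algebra_simps)
  finally show ?thesis by (simp add: d_def)
qed


section \<open>Equicontinuity of images of bounded functions\<close>

text \<open>Where the kernel exceeds \<open>R\<close> one has \<open>t\<^sup>-\<^sup>1\<^sup>/\<^sup>4 > sqrt (R - 1)\<close>, so \<open>t\<^sup>-\<^sup>1\<^sup>/\<^sup>2\<close> is at most
\<open>t\<^sup>-\<^sup>3\<^sup>/\<^sup>4 / sqrt (R - 1)\<close>. Truncation is thus uniformly small in the sense of row integrals.\<close>

lemma admissible_excess_le:
  assumes k: "admissible k" and R: "1 < R" and t: "0 \<le> t"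
  shows "\<bar>k t - min (k t) R\<bar> \<le> (1 / sqrt (R - 1)) * (1 + t powr (- (3 / 4)))"
proof (cases "k t \<le> R")
  case True
  then show ?thesis using R by simp
next
  case False
  define x where "x = t powr (- (1 / 4))"
  have x0: "0 \<le> x" by (simp add: x_def)
  have pow: "t powr (- 1 / 2) = x\<^sup>2" "t powr (- (3 / 4)) = x ^ 3"
    by (simp_all add: x_def power2_eq_square power3_eq_cube powr_add[symmetric])
  have kt: "k t \<le> 1 + x\<^sup>2" using admissibleD(5)[OF k t] pow by simp
  then have "R - 1 < x\<^sup>2" using False by linarith
  then have "sqrt (R - 1) < x"
    using x0 real_sqrt_less_mono by fastforce
  then have "x\<^sup>2 * sqrt (R - 1) \<le> x\<^sup>2 * x"
    by (intro mult_left_mono) auto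
  then have "x\<^sup>2 \<le> (1 / sqrt (R - 1)) * x ^ 3"
    using R by (simp add: field_simps power2_eq_square power3_eq_cube)
  moreover have "(1 / sqrt (R - 1)) * x ^ 3 \<le> (1 / sqrt (R - 1)) * (1 + x ^ 3)"
    using R by (intro mult_left_mono) auto
  moreover have "\<bar>k t - min (k t) R\<bar> \<le> x\<^sup>2" using False kt R by simp
  ultimately show ?thesis by (simp only: pow)
qed

text \<open>Dominated convergence does not apply directly, since the singularity moves with \<open>u'\<close>. It
applies to the kernel truncated at height \<open>R\<close>, and the error of truncation is uniform.\<close>

lemma translation_L1_continuous:
  assumes k: "admissible k" and e: "0 < e"
  shows "\<exists>d>0. \<forall>u'. \<bar>u' - u\<bar> < d \<longrightarrow>
    (\<integral>\<^sup>+v. ennreal \<bar>k \<bar>u' - v\<bar> - k \<bar>u - v\<bar>\<bar> \<partial>expm) < ennreal e"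
proof -
  note [measurable] = k[THEN admissible_measurable]
  \<comment> \<open>Chosen so that the row integrals of the truncation error, at most \<open>10 / sqrt (R - 1)\<close>, are at most \<open>e / 6\<close>.\<close>
  define R where "R = 1 + (60 / e)\<^sup>2"
  have R: "1 < R" using e by (simp add: R_def)
  have sq: "1 / sqrt (R - 1) = e / 60" using e by (simp add: R_def)
  define kR where "kR = (\<lambda>t. min (k t) R)"
  have [measurable]: "kR \<in> borel_measurable borel" unfolding kR_def by measurable
  have tail: "(\<integral>\<^sup>+v. ennreal \<bar>k \<bar>x - v\<bar> - kR \<bar>x - v\<bar>\<bar> \<partial>expm) \<le> ennreal (e / 6)" for x
  proof -
    have "(\<integral>\<^sup>+v. ennreal \<bar>k \<bar>x - v\<bar> - kR \<bar>x - v\<bar>\<bar> \<partial>expm)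
        \<le> (\<integral>\<^sup>+v. ennreal ((e / 60) * (1 + \<bar>x - v\<bar> powr (- (3 / 4)))) \<partial>expm)"
      unfolding kR_def using admissible_excess_le[OF k R] sq
      by (intro nn_integral_mono ennreal_leI) simp
    also have "\<dots> \<le> ennreal (e / 6)"
      using nn_integral_cmult_weight_le[of "3 / 4" "e / 60" x] e by simp
    finally show ?thesis .
  qed
  have "((\<lambda>u'. \<integral>\<^sup>+v. ennreal \<bar>kR \<bar>u' - v\<bar> - kR \<bar>u - v\<bar>\<bar> \<partial>expm) \<longlongrightarrow> 0) (at u)"
  proof (rule tendsto_at_iff_sequentially[THEN iffD2], intro allI impI)
    fix X :: "nat \<Rightarrow> real"
    assume X: "X \<longlonglongrightarrow> u"
    have "(\<lambda>i. \<integral>\<^sup>+v. ennreal \<bar>kR \<bar>X i - v\<bar> - kR \<bar>u - v\<bar>\<bar> \<partial>expm) \<longlonglongrightarrow> (\<integral>\<^sup>+v. 0 \<partial>expm)"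
    proof (rule nn_integral_dominated_convergence[where w = "\<lambda>_. ennreal (2 * R)"])
      show "(\<integral>\<^sup>+ x. ennreal (2 * R) \<partial>expm) < \<infinity>"
        by (simp add: emeasure_expm_UNIV)
      show "AE v in expm. ennreal \<bar>kR \<bar>X i - v\<bar> - kR \<bar>u - v\<bar>\<bar> \<le> ennreal (2 * R)" for i
      proof (rule AE_I2, rule ennreal_leI)
        fix v
        have "0 \<le> kR t" "kR t \<le> R" for t
          using admissibleD(3)[OF k] R by (auto simp: kR_def)
        then have "kR \<bar>X i - v\<bar> \<le> R" "kR \<bar>u - v\<bar> \<le> R" "0 \<le> kR \<bar>X i - v\<bar>" "0 \<le> kR \<bar>u - v\<bar>"
          by blast+
        then show "\<bar>kR \<bar>X i - v\<bar> - kR \<bar>u - v\<bar>\<bar> \<le> 2 * R" by linarith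
      qed
      show "AE v in expm. (\<lambda>i. ennreal \<bar>kR \<bar>X i - v\<bar> - kR \<bar>u - v\<bar>\<bar>) \<longlonglongrightarrow> 0"
        using AE_expm_neq[of u]
      proof eventually_elim
        case (elim v)
        have "isCont k \<bar>u - v\<bar>"
          using admissibleD(2)[OF k] elim by (subst (asm) continuous_on_eq_continuous_at) auto
        then have "isCont kR \<bar>u - v\<bar>" unfolding kR_def by (intro continuous_intros)
        moreover have "(\<lambda>i. \<bar>X i - v\<bar>) \<longlonglongrightarrow> \<bar>u - v\<bar>"
          by (intro tendsto_intros X)
        ultimately have "(\<lambda>i. kR \<bar>X i - v\<bar>) \<longlonglongrightarrow> kR \<bar>u - v\<bar>"
          by (rule isCont_tendsto_compose)
        then have "(\<lambda>i. ennreal \<bar>kR \<bar>X i - v\<bar> - kR \<bar>u - v\<bar>\<bar>) \<longlonglongrightarrow> ennreal \<bar>kR \<bar>u - v\<bar> - kR \<bar>u - v\<bar>\<bar>"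
          by (intro tendsto_intros)
        then show ?case by simp
      qed
    qed auto
    then show "((\<lambda>u'. \<integral>\<^sup>+v. ennreal \<bar>kR \<bar>u' - v\<bar> - kR \<bar>u - v\<bar>\<bar> \<partial>expm) \<circ> X) \<longlonglongrightarrow> 0"
      by (simp add: o_def)
  qed
  then have "\<forall>\<^sub>F u' in at u. (\<integral>\<^sup>+v. ennreal \<bar>kR \<bar>u' - v\<bar> - kR \<bar>u - v\<bar>\<bar> \<partial>expm) < ennreal (e / 6)"
    by (rule order_tendstoD) (use e in simp)
  then obtain d where d: "0 < d" and dd: "\<And>u'. u' \<noteq> u \<Longrightarrow> dist u' u < d \<Longrightarrow>
      (\<integral>\<^sup>+v. ennreal \<bar>kR \<bar>u' - v\<bar> - kR \<bar>u - v\<bar>\<bar> \<partial>expm) < ennreal (e / 6)"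
    by (auto simp: eventually_at)
  show ?thesis
  proof (intro exI[of _ d] conjI d allI impI)
    fix u' assume u': "\<bar>u' - u\<bar> < d"
    have mid: "(\<integral>\<^sup>+v. ennreal \<bar>kR \<bar>u' - v\<bar> - kR \<bar>u - v\<bar>\<bar> \<partial>expm) \<le> ennreal (e / 6)"
    proof (cases "u' = u")
      case False
      then show ?thesis using dd[of u'] u' by (simp add: dist_real_def less_imp_le)
    qed simp
    have "(\<integral>\<^sup>+v. ennreal \<bar>k \<bar>u' - v\<bar> - k \<bar>u - v\<bar>\<bar> \<partial>expm)
       \<le> (\<integral>\<^sup>+v. ennreal \<bar>k \<bar>u' - v\<bar> - kR \<bar>u' - v\<bar>\<bar> + (ennreal \<bar>kR \<bar>u' - v\<bar> - kR \<bar>u - v\<bar>\<bar>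
            + ennreal \<bar>k \<bar>u - v\<bar> - kR \<bar>u - v\<bar>\<bar>) \<partial>expm)"
    proof (rule nn_integral_mono)
      fix v
      have "\<bar>k \<bar>u' - v\<bar> - k \<bar>u - v\<bar>\<bar> \<le> \<bar>k \<bar>u' - v\<bar> - kR \<bar>u' - v\<bar>\<bar> + (\<bar>kR \<bar>u' - v\<bar> - kR \<bar>u - v\<bar>\<bar>
          + \<bar>k \<bar>u - v\<bar> - kR \<bar>u - v\<bar>\<bar>)"
        by (smt (verit))
      then show "ennreal \<bar>k \<bar>u' - v\<bar> - k \<bar>u - v\<bar>\<bar> \<le> ennreal \<bar>k \<bar>u' - v\<bar> - kR \<bar>u' - v\<bar>\<bar>
          + (ennreal \<bar>kR \<bar>u' - v\<bar> - kR \<bar>u - v\<bar>\<bar> + ennreal \<bar>k \<bar>u - v\<bar> - kR \<bar>u - v\<bar>\<bar>)"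
        by (simp flip: ennreal_plus)
    qed
    also have "\<dots> = (\<integral>\<^sup>+v. ennreal \<bar>k \<bar>u' - v\<bar> - kR \<bar>u' - v\<bar>\<bar> \<partial>expm)
       + ((\<integral>\<^sup>+v. ennreal \<bar>kR \<bar>u' - v\<bar> - kR \<bar>u - v\<bar>\<bar> \<partial>expm)
         + (\<integral>\<^sup>+v. ennreal \<bar>k \<bar>u - v\<bar> - kR \<bar>u - v\<bar>\<bar> \<partial>expm))"
      by (simp add: nn_integral_add)
    also have "\<dots> \<le> ennreal (e / 6) + (ennreal (e / 6) + ennreal (e / 6))"
      by (intro add_mono tail mid)
    also have "\<dots> = ennreal (e / 2)"
      using e by (simp flip: ennreal_plus)
    also have "\<dots> < ennreal e"
      using e by (simp add: ennreal_lessI)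
    finally show "(\<integral>\<^sup>+v. ennreal \<bar>k \<bar>u' - v\<bar> - k \<bar>u - v\<bar>\<bar> \<partial>expm) < ennreal e" .
  qed
qed

lemma nn_integral_kernel_bounded_le:
  assumes k: "admissible k" and g: "\<And>v. \<bar>g v\<bar> \<le> G"
  shows "(\<integral>\<^sup>+v. ennreal (norm (k \<bar>u - v\<bar> * g v)) \<partial>expm) \<le> ennreal (6 * G)"
proof -
  note [measurable] = k[THEN admissible_measurable]
  have G: "0 \<le> G" using g[of 0] by linarith
  have "(\<integral>\<^sup>+v. ennreal (norm (k \<bar>u - v\<bar> * g v)) \<partial>expm) \<le> (\<integral>\<^sup>+v. ennreal (k \<bar>u - v\<bar>) * ennreal G \<partial>expm)"
    using g G admissibleD(3)[OF k]
    by (intro nn_integral_mono, subst ennreal_mult'[symmetric])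
       (auto intro!: ennreal_leI mult_left_mono simp: abs_mult)
  also have "\<dots> \<le> ennreal 6 * ennreal G"
    using admissible_nn_integral_le[OF k, of u] by (subst nn_integral_multc) (auto intro!: mult_right_mono)
  also have "\<dots> = ennreal (6 * G)"
    using G by (intro ennreal_mult[symmetric]) auto
  finally show ?thesis .
qed

lemma kernel_integrable:
  assumes k: "admissible k" and [measurable]: "g \<in> borel_measurable borel" and g: "\<And>v. \<bar>g v\<bar> \<le> G"
  shows "integrable expm (\<lambda>v. k \<bar>u - v\<bar> * g v)"
proof (rule integrableI_bounded)
  note [measurable] = k[THEN admissible_measurable]
  show "(\<lambda>v. k \<bar>u - v\<bar> * g v) \<in> borel_measurable expm" by measurable
  show "(\<integral>\<^sup>+v. ennreal (norm (k \<bar>u - v\<bar> * g v)) \<partial>expm) < \<infinity>"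
    using nn_integral_kernel_bounded_le[OF k g] by (rule order.strict_trans1) simp
qed

lemma kernel_op_equicontinuous:
  assumes k: "admissible k" and e: "0 < e" and G: "0 \<le> G"
  shows "\<exists>d>0. \<forall>u' g. \<bar>u' - u\<bar> < d \<longrightarrow> g \<in> borel_measurable borel \<longrightarrow> (\<forall>v. \<bar>g v\<bar> \<le> G) \<longrightarrow>
    \<bar>kernel_op k g u' - kernel_op k g u\<bar> < e"
proof -
  note [measurable] = k[THEN admissible_measurable]
  have e': "0 < e / (G + 1)" using e G by simp
  obtain d where d: "0 < d" and dd: "\<And>u'. \<bar>u' - u\<bar> < d \<Longrightarrow>
    (\<integral>\<^sup>+v. ennreal \<bar>k \<bar>u' - v\<bar> - k \<bar>u - v\<bar>\<bar> \<partial>expm) < ennreal (e / (G + 1))"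
    using translation_L1_continuous[OF k e', of u] by auto
  show ?thesis
  proof (intro exI[of _ d] conjI d allI impI)
    fix u' :: real and g :: "real \<Rightarrow> real"
    assume u': "\<bar>u' - u\<bar> < d" and [measurable]: "g \<in> borel_measurable borel" and g: "\<forall>v. \<bar>g v\<bar> \<le> G"
    have int: "integrable expm (\<lambda>v. k \<bar>x - v\<bar> * g v)" for x
      using g by (intro kernel_integrable[OF k, of _ G]) auto
    have diff: "kernel_op k g u' - kernel_op k g u = (\<integral>v. (k \<bar>u' - v\<bar> - k \<bar>u - v\<bar>) * g v \<partial>expm)"
      unfolding kernel_op_def using int[of u] int[of u'] by (simp add: left_diff_distrib)
    have int2: "integrable expm (\<lambda>v. (k \<bar>u' - v\<bar> - k \<bar>u - v\<bar>) * g v)"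
      using int[of u] int[of u'] by (simp add: left_diff_distrib)
    have "ennreal \<bar>kernel_op k g u' - kernel_op k g u\<bar>
        \<le> (\<integral>\<^sup>+v. ennreal (norm ((k \<bar>u' - v\<bar> - k \<bar>u - v\<bar>) * g v)) \<partial>expm)"
      unfolding diff using integral_norm_bound_ennreal[OF int2] by simp
    also have "\<dots> \<le> (\<integral>\<^sup>+v. ennreal \<bar>k \<bar>u' - v\<bar> - k \<bar>u - v\<bar>\<bar> * ennreal G \<partial>expm)"
      using g G by (intro nn_integral_mono, subst ennreal_mult'[symmetric])
        (auto intro!: ennreal_leI mult_left_mono simp: abs_mult)
    also have "\<dots> = (\<integral>\<^sup>+v. ennreal \<bar>k \<bar>u' - v\<bar> - k \<bar>u - v\<bar>\<bar> \<partial>expm) * ennreal G"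
      by (rule nn_integral_multc) measurable
    also have "\<dots> \<le> ennreal (e / (G + 1)) * ennreal G"
      using dd[OF u'] by (intro mult_right_mono) auto
    also have "\<dots> = ennreal (e / (G + 1) * G)"
      using e G by (intro ennreal_mult[symmetric]) auto
    also have "\<dots> < ennreal e"
      using e G by (intro ennreal_lessI) (auto simp: field_simps)
    finally show "\<bar>kernel_op k g u' - kernel_op k g u\<bar> < e"
      by (simp add: ennreal_less_iff)
  qed
qed

lemma kernel_op_sup_le:
  assumes k: "admissible k" and [measurable]: "g \<in> borel_measurable borel" and g: "\<And>v. \<bar>g v\<bar> \<le> G"
  shows "\<bar>kernel_op k g u\<bar> \<le> 6 * G"
proof -
  have G: "0 \<le> G" using g[of 0] by linarith
  have "ennreal \<bar>kernel_op k g u\<bar> \<le> (\<integral>\<^sup>+v. ennreal (norm (k \<bar>u - v\<bar> * g v)) \<partial>expm)"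
    unfolding kernel_op_def using integral_norm_bound_ennreal[OF kernel_integrable[OF k _ g]] by simp
  also have "\<dots> \<le> ennreal (6 * G)" by (rule nn_integral_kernel_bounded_le[OF k g])
  finally show ?thesis using G by (simp add: ennreal_le_iff)
qed

text \<open>A diagonal argument gives convergence at rational points, which equicontinuity extends to
every point. Pointwise convergence of bounded functions is enough here, since the measure is finite.\<close>

lemma bounded_images_pointwise_convergent:
  assumes k: "admissible k" and meas: "\<And>n. g n \<in> borel_measurable borel" and g: "\<And>n v. \<bar>g n v\<bar> \<le> G"
  obtains r :: "nat \<Rightarrow> nat" where "strict_mono r" "\<And>u. convergent (\<lambda>n. kernel_op k (g (r n)) u)"
proof -
  have G: "0 \<le> G" using g[of 0 0] by linarith
  have "norm (kernel_op k (g n) u) \<le> 6 * G" for n u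
    using kernel_op_sup_le[OF k meas g] by simp
  then obtain r where r: "strict_mono (r :: nat \<Rightarrow> nat)"
    and rat: "\<And>q. q \<in> \<rat> \<Longrightarrow> \<exists>l. (\<lambda>n. kernel_op k (g (r n)) q) \<longlonglongrightarrow> l"
    using function_convergent_subsequence[OF countable_rat, of "\<lambda>n. kernel_op k (g n)" "6 * G" thesis] by blast
  have "convergent (\<lambda>n. kernel_op k (g (r n)) u)" for u
  proof (rule Cauchy_convergent, rule metric_CauchyI)
    fix e :: real assume "0 < e"
    then have e3: "0 < e / 3" by simp
    obtain d where d: "0 < d" and dd: "\<And>u' n. \<bar>u' - u\<bar> < d \<Longrightarrow> \<bar>kernel_op k (g n) u' - kernel_op k (g n) u\<bar> < e / 3"
      using kernel_op_equicontinuous[OF k e3 G, of u] meas g by meson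
    obtain q where q: "q \<in> \<rat>" "u < q" "q < u + d"
      using Rats_dense_in_real[of u "u + d"] d by auto
    have "Cauchy (\<lambda>n. kernel_op k (g (r n)) q)"
      using rat[OF q(1)] by (auto intro: LIMSEQ_imp_Cauchy)
    then obtain N where N: "\<And>m n. N \<le> m \<Longrightarrow> N \<le> n \<Longrightarrow> dist (kernel_op k (g (r m)) q) (kernel_op k (g (r n)) q) < e / 3"
      using metric_CauchyD[OF _ e3] by blast
    have qd: "\<bar>q - u\<bar> < d" using q by simp
    show "\<exists>N. \<forall>m\<ge>N. \<forall>n\<ge>N. dist (kernel_op k (g (r m)) u) (kernel_op k (g (r n)) u) < e"
    proof (intro exI allI impI)
      fix m n assume "N \<le> m" "N \<le> n"
      then show "dist (kernel_op k (g (r m)) u) (kernel_op k (g (r n)) u) < e"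
        using N[of m n] dd[OF qd, of "r m"] dd[OF qd, of "r n"] unfolding dist_real_def by linarith
    qed
  qed
  with r that show ?thesis by blast
qed


section \<open>Existence of a top eigenfunction\<close>

text \<open>A maximising sequence \<open>F\<close> has residuals tending to \<open>0\<close>, so it is close to
\<open>A\<^sup>3 F / M\<^sup>3\<close>, and a subsequence of \<open>A\<^sup>3 F\<close> converges in \<open>L\<^sup>2\<close> to some \<open>h\<close>. Then \<open>h / M\<^sup>3\<close> is the
eigenfunction. Its norm is only bounded below by \<open>1 / 2\<close>, which suffices for it to be nonzero.\<close>

lemma top_eigenfunction_exists:
  assumes k: "admissible k"
  obtains f where "f \<in> L2 expm" "\<not> (AE x in expm. f x = 0)"
    "AE x in expm. kernel_op k f x = top_value k * f x"
proof -
  note [measurable] = k[THEN admissible_measurable]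
  let ?A = "kernel_op k"
  note A = kernel_op_L2(1)[OF k]
  define M where "M = top_value k"
  have M: "0 < M" using top_value_pos[OF k] by (simp add: M_def)
  have "\<exists>f. f \<in> L2 expm \<and> norm_sq f = 1 \<and> M - 1 / real (Suc n) < qform k f f" for n
  proof -
    have "M - 1 / real (Suc n) < (SUP f\<in>{f \<in> L2 expm. norm_sq f = 1}. qform k f f)"
      by (simp add: M_def top_value_def)
    then show ?thesis
      using less_cSUP_iff[OF unit_vectors_nonempty bdd_above_qform[OF k]] by auto
  qed
  then obtain F where F: "\<And>n. F n \<in> L2 expm" "\<And>n. norm_sq (F n) = 1"
    and Fq: "\<And>n. M - 1 / real (Suc n) < qform k (F n) (F n)"
    by metis
  note [measurable] = F(1)[THEN L2_measurable]
  define d where "d = (\<lambda>n. norm_sq (\<lambda>x. ?A (F n) x - M * F n x))"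
  have d: "d \<longlonglongrightarrow> 0"
  proof (rule tendsto_sandwich)
    show "\<forall>\<^sub>F n in sequentially. 0 \<le> d n" by (simp add: d_def)
    show "\<forall>\<^sub>F n in sequentially. d n \<le> (M + 6) * (1 / real (Suc n))"
    proof (rule always_eventually, rule allI)
      fix n
      have "d n \<le> (M + 6) * (M * norm_sq (F n) - qform k (F n) (F n))"
        unfolding d_def M_def by (rule residual_le[OF k F(1)])
      also have "\<dots> \<le> (M + 6) * (1 / real (Suc n))"
        using Fq[of n] F(2)[of n] M by (intro mult_left_mono) auto
      finally show "d n \<le> (M + 6) * (1 / real (Suc n))" .
    qed
    show "(\<lambda>n. (M + 6) * (1 / real (Suc n))) \<longlonglongrightarrow> 0"
      by real_asymp
  qed simp
  define C where "C = 80000 + 800 * M\<^sup>2 + 4 * M ^ 4"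
  define e where "e = (\<lambda>n. norm_sq (\<lambda>x. ?A (?A (?A (F n))) x - M ^ 3 * F n x))"
  have e: "e \<longlonglongrightarrow> 0"
  proof (rule tendsto_sandwich)
    show "\<forall>\<^sub>F n in sequentially. 0 \<le> e n" by (simp add: e_def)
    show "\<forall>\<^sub>F n in sequentially. e n \<le> C * d n"
      unfolding e_def d_def C_def by (intro always_eventually allI cube_residual_le[OF k F(1)])
    show "(\<lambda>n. C * d n) \<longlonglongrightarrow> 0" using tendsto_mult_left[OF d, of C] by simp
  qed simp
  define G where "G = sqrt (19200::real)"
  have bound: "\<bar>?A (?A (F n)) v\<bar> \<le> G" for n v
    using kernel_op_twice_bounded[OF k F(1)[of n], of v] by (simp add: F(2) G_def)
  obtain r where r: "strict_mono r" and conv: "\<And>u. convergent (\<lambda>n. ?A (?A (?A (F (r n)))) u)"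
  proof (rule bounded_images_pointwise_convergent[OF k, of "\<lambda>n. ?A (?A (F n))" G])
    show "?A (?A (F n)) \<in> borel_measurable borel" for n by measurable
    show "\<bar>?A (?A (F n)) v\<bar> \<le> G" for n v by (rule bound)
  qed blast
  define h where "h = (\<lambda>u. lim (\<lambda>n. ?A (?A (?A (F (r n)))) u))"
  have lim: "(\<lambda>n. ?A (?A (?A (F (r n)))) u) \<longlonglongrightarrow> h u" for u
    using conv unfolding h_def by (simp add: convergent_LIMSEQ_iff)
  have h_meas [measurable]: "h \<in> borel_measurable borel"
    by (rule borel_measurable_LIMSEQ_real[OF lim]) measurable
  have bound3: "\<bar>?A (?A (?A (F n))) u\<bar> \<le> 6 * G" for n u
    by (rule kernel_op_sup_le[OF k _ bound]) measurable
  have hb: "\<bar>h u\<bar> \<le> 6 * G" for u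
    using bound3 by (intro tendsto_upperbound[OF tendsto_rabs[OF lim]]) auto
  have L2_bdd: "f \<in> L2 expm" if [measurable]: "f \<in> borel_measurable borel" and b: "\<And>u. \<bar>f u\<bar> \<le> c" for f c
  proof -
    have "(f u)\<^sup>2 \<le> c\<^sup>2" for u
      using power_mono[OF b abs_ge_zero, of u 2] by simp
    then show ?thesis
      unfolding L2_def by (auto intro!: expm.integrable_const_bound[where B = "c\<^sup>2"])
  qed
  have hL2: "h \<in> L2 expm" by (rule L2_bdd[OF h_meas hb])
  define y where "y = (\<lambda>n. norm_sq (\<lambda>x. ?A (?A (?A (F (r n)))) x - h x))"
  have y: "y \<longlonglongrightarrow> 0"
  proof -
    have "y \<longlonglongrightarrow> (\<integral>x. 0 \<partial>expm)"
      unfolding y_def norm_sq_def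
    proof (rule integral_dominated_convergence[where w = "\<lambda>_. (12 * G)\<^sup>2"])
      show "AE x in expm. (\<lambda>n. (?A (?A (?A (F (r n)))) x - h x)\<^sup>2) \<longlonglongrightarrow> 0"
      proof (rule AE_I2)
        fix x
        have "(\<lambda>n. (?A (?A (?A (F (r n)))) x - h x)\<^sup>2) \<longlonglongrightarrow> (h x - h x)\<^sup>2"
          by (intro tendsto_intros lim)
        then show "(\<lambda>n. (?A (?A (?A (F (r n)))) x - h x)\<^sup>2) \<longlonglongrightarrow> 0" by simp
      qed
      show "AE x in expm. norm ((?A (?A (?A (F (r n)))) x - h x)\<^sup>2) \<le> (12 * G)\<^sup>2" for n
      proof (rule AE_I2)
        fix x
        have "\<bar>?A (?A (?A (F (r n)))) x - h x\<bar> \<le> 12 * G"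
          using bound3[of "r n" x] hb[of x] by linarith
        then show "norm ((?A (?A (?A (F (r n)))) x - h x)\<^sup>2) \<le> (12 * G)\<^sup>2"
          using power_mono[of "\<bar>?A (?A (?A (F (r n)))) x - h x\<bar>" "12 * G" 2] by simp
      qed
    qed auto
    then show ?thesis by simp
  qed
  define f where "f = (\<lambda>x. (1 / M ^ 3) * h x)"
  have f: "f \<in> L2 expm" unfolding f_def by (rule L2_scale[OF hL2])
  note [measurable] = f[THEN L2_measurable]
  define z where "z = (\<lambda>n. norm_sq (\<lambda>x. f x - F (r n) x))"
  have z_le: "z n \<le> (1 / M ^ 3)\<^sup>2 * (2 * e (r n) + 2 * y n)" for n
  proof -
    let ?T = "?A (?A (?A (F (r n))))"
    note T = A[OF A[OF A[OF F(1)[of "r n"]]]]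
    have 1: "(\<lambda>x. ?T x - M ^ 3 * F (r n) x) \<in> L2 expm"
      by (intro L2_diff T L2_scale F)
    have 2: "(\<lambda>x. ?T x - h x) \<in> L2 expm"
      by (intro L2_diff T hL2)
    have "z n = norm_sq (\<lambda>x. (1 / M ^ 3) * ((?T x - M ^ 3 * F (r n) x) - (?T x - h x)))"
      unfolding z_def f_def using M by (simp add: algebra_simps)
    also have "\<dots> = (1 / M ^ 3)\<^sup>2 * norm_sq (\<lambda>x. (?T x - M ^ 3 * F (r n) x) - (?T x - h x))"
      by (rule L2_scale[OF L2_diff(1)[OF 1 2]])
    also have "\<dots> \<le> (1 / M ^ 3)\<^sup>2 * (2 * e (r n) + 2 * y n)"
      unfolding e_def y_def by (intro mult_left_mono L2_diff 1 2) auto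
    finally show ?thesis .
  qed
  have z: "z \<longlonglongrightarrow> 0"
  proof (rule tendsto_sandwich)
    show "\<forall>\<^sub>F n in sequentially. 0 \<le> z n" by (simp add: z_def)
    show "\<forall>\<^sub>F n in sequentially. z n \<le> (1 / M ^ 3)\<^sup>2 * (2 * e (r n) + 2 * y n)"
      using z_le by simp
    have "(\<lambda>n. e (r n)) \<longlonglongrightarrow> 0"
      using LIMSEQ_subseq_LIMSEQ[OF e r] by (simp add: o_def)
    then have "(\<lambda>n. (1 / M ^ 3)\<^sup>2 * (2 * e (r n) + 2 * y n)) \<longlonglongrightarrow> (1 / M ^ 3)\<^sup>2 * (2 * 0 + 2 * 0)"
      using y by (intro tendsto_intros)
    then show "(\<lambda>n. (1 / M ^ 3)\<^sup>2 * (2 * e (r n) + 2 * y n)) \<longlonglongrightarrow> 0" by simp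
  qed simp
  \<comment> \<open>Pass to the limit in \<open>1 = \<parallel>F\<parallel>\<^sup>2 \<le> 2 \<parallel>f\<parallel>\<^sup>2 + 2 \<parallel>f - F\<parallel>\<^sup>2\<close>.\<close>
  have half: "1 / 2 \<le> norm_sq f"
  proof -
    have "1 \<le> 2 * norm_sq f + 2 * z n" for n
    proof -
      have "norm_sq (\<lambda>x. f x - (f x - F (r n) x)) \<le> 2 * norm_sq f + 2 * z n"
        unfolding z_def by (intro L2_diff f F)
      then show ?thesis by (simp add: F(2))
    qed
    moreover have "(\<lambda>n. 2 * norm_sq f + 2 * z n) \<longlonglongrightarrow> 2 * norm_sq f + 2 * 0"
      by (intro tendsto_intros z)
    ultimately have "1 \<le> 2 * norm_sq f + 2 * 0"
      by (intro tendsto_lowerbound) (auto intro!: always_eventually)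
    then show ?thesis by simp
  qed
  have not0: "\<not> (AE x in expm. f x = 0)"
    using half norm_sq_eq_0_iff[OF f] by auto
  \<comment> \<open>Split \<open>A f - M f = A (f - F) + (A F - M F) - M (f - F)\<close>.\<close>
  have res: "norm_sq (\<lambda>x. ?A f x - M * f x) \<le> 2 * (2 * (200 * z n) + 2 * d (r n)) + 2 * (M\<^sup>2 * z n)" for n
  proof -
    let ?p = "\<lambda>x. f x - F (r n) x"
    have p: "?p \<in> L2 expm" by (intro L2_diff f F)
    note [measurable] = p[THEN L2_measurable]
    let ?q = "\<lambda>x. ?A (F (r n)) x - M * F (r n) x"
    have q: "?q \<in> L2 expm" by (intro L2_diff A F L2_scale)
    have pq: "(\<lambda>x. ?A ?p x + ?q x) \<in> L2 expm" by (intro L2_add A p q)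
    have "AE x in expm. ?A ?p x = ?A f x - ?A (F (r n)) x"
      using kernel_op_add_scale[OF k f F(1)[of "r n"], of "-1"] by simp
    then have "AE x in expm. (?A ?p x + ?q x) - M * ?p x = ?A f x - M * f x"
      by eventually_elim (simp add: algebra_simps)
    then have "norm_sq (\<lambda>x. ?A f x - M * f x) = norm_sq (\<lambda>x. (?A ?p x + ?q x) - M * ?p x)"
      by (intro L2_cong_AE(2) L2_diff pq L2_scale p) measurable
    also have "\<dots> \<le> 2 * norm_sq (\<lambda>x. ?A ?p x + ?q x) + 2 * norm_sq (\<lambda>x. M * ?p x)"
      by (intro L2_diff pq L2_scale p)
    also have "norm_sq (\<lambda>x. M * ?p x) = M\<^sup>2 * z n"
      unfolding z_def by (rule L2_scale[OF p])
    also have "norm_sq (\<lambda>x. ?A ?p x + ?q x) \<le> 2 * norm_sq (?A ?p) + 2 * norm_sq ?q"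
      by (intro L2_add A p q)
    also have "norm_sq (?A ?p) \<le> 200 * z n"
      unfolding z_def by (rule kernel_op_L2[OF k p])
    finally show ?thesis by (simp add: d_def)
  qed
  have "norm_sq (\<lambda>x. ?A f x - M * f x) \<le> 2 * (2 * (200 * 0) + 2 * 0) + 2 * (M\<^sup>2 * 0)"
  proof (rule tendsto_lowerbound)
    have "(\<lambda>n. d (r n)) \<longlonglongrightarrow> 0"
      using LIMSEQ_subseq_LIMSEQ[OF d r] by (simp add: o_def)
    then show "(\<lambda>n. 2 * (2 * (200 * z n) + 2 * d (r n)) + 2 * (M\<^sup>2 * z n))
        \<longlonglongrightarrow> 2 * (2 * (200 * 0) + 2 * 0) + 2 * (M\<^sup>2 * 0)"
      using z by (intro tendsto_intros)
  qed (use res in auto)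
  then have "norm_sq (\<lambda>x. ?A f x - M * f x) = 0"
    using norm_sq_nonneg[of "\<lambda>x. ?A f x - M * f x"] by simp
  then have "AE x in expm. ?A f x - M * f x = 0"
    by (subst (asm) norm_sq_eq_0_iff) (intro L2_diff A f L2_scale)
  then have "AE x in expm. ?A f x = top_value k * f x"
    by eventually_elim (simp add: M_def)
  with f not0 that show ?thesis by blast
qed

lemma is_eigenvalue_top_value: "admissible k \<Longrightarrow> is_eigenvalue expm (kernel_op k) (top_value k)"
  using top_eigenfunction_exists[of k] unfolding is_eigenvalue_def by blast

lemma lambda_max_eq_top_value: "admissible k \<Longrightarrow> lambda_max expm (kernel_op k) = top_value k"
  unfolding lambda_max_def
  by (rule Greatest_equality) (auto simp: is_eigenvalue_top_value eigenvalue_le_top_value)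


section \<open>Comparison of top eigenvalues\<close>

lemma abs_qform_diff_le:
  assumes k: "admissible k" and k': "admissible k'" and f: "f \<in> L2 expm"
    and w: "\<And>t. 0 \<le> t \<Longrightarrow> \<bar>k t - k' t\<bar> \<le> w t"
    and X: "(\<integral>\<^sup>+p. ennreal (w \<bar>fst p - snd p\<bar> * \<bar>f (fst p)\<bar> * \<bar>f (snd p)\<bar>) \<partial>expm_sq) \<le> ennreal X" "0 \<le> X"
  shows "\<bar>qform k f f - qform k' f f\<bar> \<le> X"
proof -
  note int = qform_integrable[OF k f f] qform_integrable[OF k' f f]
  have diff: "qform k f f - qform k' f f
      = (\<integral>p. (k \<bar>fst p - snd p\<bar> - k' \<bar>fst p - snd p\<bar>) * f (fst p) * f (snd p) \<partial>expm_sq)"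
    unfolding qform_def using int by (simp add: left_diff_distrib)
  have int2: "integrable expm_sq (\<lambda>p. (k \<bar>fst p - snd p\<bar> - k' \<bar>fst p - snd p\<bar>) * f (fst p) * f (snd p))"
    using int by (simp add: left_diff_distrib)
  have "ennreal \<bar>qform k f f - qform k' f f\<bar>
    \<le> (\<integral>\<^sup>+p. ennreal (norm ((k \<bar>fst p - snd p\<bar> - k' \<bar>fst p - snd p\<bar>) * f (fst p) * f (snd p))) \<partial>expm_sq)"
    unfolding diff using integral_norm_bound_ennreal[OF int2] by simp
  also have "\<dots> \<le> (\<integral>\<^sup>+p. ennreal (w \<bar>fst p - snd p\<bar> * \<bar>f (fst p)\<bar> * \<bar>f (snd p)\<bar>) \<partial>expm_sq)"
    using w by (intro nn_integral_mono ennreal_leI) (auto simp: abs_mult intro!: mult_right_mono)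
  also note X(1)
  finally show ?thesis using X(2) by (simp add: ennreal_le_iff)
qed

lemma top_value_perturbation:
  assumes k: "admissible k" and k': "admissible k'"
    and le: "\<And>f. f \<in> L2 expm \<Longrightarrow> norm_sq f = 1 \<Longrightarrow> \<bar>qform k f f - qform k' f f\<bar> \<le> E"
  shows "\<bar>top_value k - top_value k'\<bar> \<le> E"
proof -
  have "top_value k \<le> top_value k' + E"
  proof (rule top_value_le)
    fix f assume f: "f \<in> L2 expm" "norm_sq f = 1"
    show "qform k f f \<le> top_value k' + E"
      using le[OF f] qform_le_top_value[OF k' f(1)] f(2) by simp
  qed
  moreover have "top_value k' \<le> top_value k + E"
  proof (rule top_value_le)
    fix f assume f: "f \<in> L2 expm" "norm_sq f = 1"
    show "qform k' f f \<le> top_value k + E"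
      using le[OF f] qform_le_top_value[OF k f(1)] f(2) by simp
  qed
  ultimately show ?thesis by simp
qed

text \<open>For differences with uniformly bounded row integrals; they may be as singular as
\<open>t\<^sup>-\<^sup>3\<^sup>/\<^sup>4\<close> at \<open>0\<close>.\<close>

lemma top_value_diff_Schur:
  assumes k: "admissible k" and k': "admissible k'" and [measurable]: "w \<in> borel_measurable borel"
    and w0: "\<And>t. 0 \<le> w t" and E: "0 \<le> E"
    and w: "\<And>t. 0 \<le> t \<Longrightarrow> \<bar>k t - k' t\<bar> \<le> w t"
    and wE: "\<And>u. (\<integral>\<^sup>+v. ennreal (w \<bar>u - v\<bar>) \<partial>expm) \<le> ennreal E"
  shows "\<bar>top_value k - top_value k'\<bar> \<le> E"
proof (rule top_value_perturbation[OF k k'])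
  fix f assume f: "f \<in> L2 expm" "norm_sq f = 1"
  show "\<bar>qform k f f - qform k' f f\<bar> \<le> E"
    using Schur_test[OF _ w0 E wE f(1) f(1)] f(2) E
    by (intro abs_qform_diff_le[OF k k' f(1) w]) auto
qed

text \<open>For differences that are square integrable; they may grow at infinity.\<close>

lemma top_value_diff_Hilbert_Schmidt:
  assumes k: "admissible k" and k': "admissible k'" and [measurable]: "w \<in> borel_measurable borel"
    and H: "0 \<le> H"
    and w: "\<And>t. 0 \<le> t \<Longrightarrow> \<bar>k t - k' t\<bar> \<le> w t"
    and wH: "(\<integral>\<^sup>+t. ennreal ((w t)\<^sup>2) \<partial>expm) \<le> ennreal H"
  shows "\<bar>top_value k - top_value k'\<bar> \<le> sqrt H"
proof (rule top_value_perturbation[OF k k'])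
  fix f assume f: "f \<in> L2 expm" "norm_sq f = 1"
  note [measurable] = f(1)[THEN L2_measurable]
  have 1: "(\<integral>\<^sup>+p. ennreal ((w \<bar>fst p - snd p\<bar>)\<^sup>2) \<partial>expm_sq) \<le> ennreal H"
    using wH by (subst expm.nn_integral_fst[symmetric])
      (auto simp: nn_integral_expm_abs_diff[of "\<lambda>t. ennreal ((w t)\<^sup>2)"])
  have 2: "(\<integral>\<^sup>+p. ennreal ((f (fst p) * f (snd p))\<^sup>2) \<partial>expm_sq) \<le> ennreal 1"
    by (subst expm.nn_integral_fst[symmetric])
      (auto simp: power_mult_distrib ennreal_mult nn_integral_cmult nn_integral_multc nn_integral_norm_sq f)
  have "(\<integral>\<^sup>+p. ennreal \<bar>w \<bar>fst p - snd p\<bar> * (f (fst p) * f (snd p))\<bar> \<partial>expm_sq) \<le> ennreal (sqrt (H * 1))"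
    by (intro nn_integral_Cauchy_Schwarz 1 2 H) auto
  moreover have w0: "0 \<le> w \<bar>t\<bar>" for t using w[of "\<bar>t\<bar>"] by linarith
  ultimately show "\<bar>qform k f f - qform k' f f\<bar> \<le> sqrt H"
    using H by (intro abs_qform_diff_le[OF k k' f(1) w]) (auto simp: abs_mult mult_ac)
qed

lemma qform_le_qform_abs:
  assumes k: "admissible k" and f: "f \<in> L2 expm"
  shows "qform k f f \<le> qform k (\<lambda>x. \<bar>f x\<bar>) (\<lambda>x. \<bar>f x\<bar>)"
  unfolding qform_def
proof (intro integral_mono qform_integrable k L2_abs f)
  fix p :: "real \<times> real"
  have "f (fst p) * f (snd p) \<le> \<bar>f (fst p)\<bar> * \<bar>f (snd p)\<bar>"
    by (metis abs_ge_self abs_mult)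
  then show "k \<bar>fst p - snd p\<bar> * f (fst p) * f (snd p) \<le> k \<bar>fst p - snd p\<bar> * \<bar>f (fst p)\<bar> * \<bar>f (snd p)\<bar>"
    using admissibleD(3)[OF k, of "\<bar>fst p - snd p\<bar>"] by (simp add: mult.assoc mult_left_mono)
qed

text \<open>Take a top eigenfunction \<open>f\<close> of the smaller kernel. Passing to \<open>\<bar>f\<bar>\<close> does not decrease its
Rayleigh quotient, and on the nonnegative function \<open>\<bar>f\<bar>\<close> the form of the larger kernel is strictly larger.\<close>

lemma top_value_strict_mono:
  assumes k: "admissible k" and k': "admissible k'"
    and le: "k 0 \<le> k' 0" and less: "\<And>t. 0 < t \<Longrightarrow> k t < k' t"
  shows "top_value k < top_value k'"
proof -
  obtain f where f: "f \<in> L2 expm" "\<not> (AE x in expm. f x = 0)"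
    and ev: "AE x in expm. kernel_op k f x = top_value k * f x"
    using top_eigenfunction_exists[OF k] .
  note [measurable] = f(1)[THEN L2_measurable] k[THEN admissible_measurable] k'[THEN admissible_measurable]
  have pos: "norm_sq f > 0"
    using f norm_sq_eq_0_iff[OF f(1)] norm_sq_nonneg[of f] by linarith
  let ?h = "\<lambda>x. \<bar>f x\<bar>"
  have h: "?h \<in> L2 expm" "norm_sq ?h = norm_sq f"
    using L2_abs f(1) by auto
  note int = qform_integrable[OF k h(1) h(1)] qform_integrable[OF k' h(1) h(1)]
  have "top_value k * norm_sq f = qform k f f"
    by (rule qform_eigenfunction[OF k f(1) ev, symmetric])
  also have "\<dots> \<le> qform k ?h ?h"
    by (rule qform_le_qform_abs[OF k f(1)])
  also have "\<dots> < qform k' ?h ?h"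
  proof -
    have "0 < (\<integral>p. (k' \<bar>fst p - snd p\<bar> - k \<bar>fst p - snd p\<bar>) * ?h (fst p) * ?h (snd p) \<partial>expm_sq)"
    proof (rule strictly_positive_kernel)
      show "0 \<le> k' t - k t" if "0 \<le> t" for t
        using that less[of t] le by (cases "t = 0") auto
      show "integrable expm_sq (\<lambda>p. (k' \<bar>fst p - snd p\<bar> - k \<bar>fst p - snd p\<bar>) * ?h (fst p) * ?h (snd p))"
        using int by (simp add: left_diff_distrib)
    qed (use less f(2) in auto)
    also have "\<dots> = qform k' ?h ?h - qform k ?h ?h"
      unfolding qform_def using int by (simp add: left_diff_distrib)
    finally show ?thesis by simp
  qed
  also have "\<dots> \<le> top_value k' * norm_sq f"
    using qform_le_top_value[OF k' h(1)] by (simp add: h(2))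
  finally show ?thesis using pos by simp
qed


section \<open>Estimates for the hyperbolic sine\<close>

lemma has_real_derivative_sinh_diff:
  "((\<lambda>x. sinh (c * x) - c * sinh x) has_real_derivative c * (cosh (c * x) - cosh x)) (at (x::real))"
  by (auto intro!: derivative_eq_intros simp: algebra_simps)

lemma sinh_mult_gt:
  fixes c x :: real
  assumes "1 < c" "0 < x"
  shows "c * sinh x < sinh (c * x)"
proof -
  have "sinh (c * 0) - c * sinh 0 < sinh (c * x) - c * sinh x"
  proof (rule DERIV_pos_imp_increasing_open[OF assms(2)])
    fix y assume y: "0 < y" "y < x"
    have "cosh y < cosh (c * y)"
      using y assms by (subst cosh_real_nonneg_less_iff) auto
    then show "\<exists>D. ((\<lambda>y. sinh (c * y) - c * sinh y) has_real_derivative D) (at y) \<and> 0 < D"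
      using assms by (intro exI[of _ "c * (cosh (c * y) - cosh y)"] conjI has_real_derivative_sinh_diff) auto
  qed (auto intro!: continuous_intros)
  then show ?thesis by simp
qed

lemma sinh_gt_self:
  fixes x :: real
  assumes "0 < x"
  shows "x < sinh x"
proof -
  have "sinh 0 - 0 < sinh x - x"
  proof (rule DERIV_pos_imp_increasing_open[OF assms])
    fix y :: real assume y: "0 < y" "y < x"
    have "cosh 0 < cosh y"
      using y by (subst cosh_real_nonneg_less_iff) auto
    then show "\<exists>D. ((\<lambda>y. sinh y - y) has_real_derivative D) (at y) \<and> 0 < D"
      by (intro exI[of _ "cosh y - 1"]) (auto intro!: derivative_eq_intros)
  qed (auto intro!: continuous_intros)
  then show ?thesis by simp
qed

text \<open>After factoring out \<open>exp (c x) / 2\<close> this is Bernoulli's inequality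
\<open>1 - y\<^sup>c \<le> c (1 - y)\<close> for \<open>y = exp (- 2 x)\<close>.\<close>

lemma sinh_mult_le:
  fixes c x :: real
  assumes c: "1 \<le> c" and x: "0 \<le> x"
  shows "sinh (c * x) \<le> c * sinh x * exp ((c - 1) * x)"
proof -
  have "c * (1 - exp (- (2 * 0))) - (1 - exp (- (2 * c * 0)))
      \<le> c * (1 - exp (- (2 * x))) - (1 - exp (- (2 * c * x)))"
  proof (rule DERIV_nonneg_imp_nondecreasing[OF x])
    fix y :: real assume y: "0 \<le> y" "y \<le> x"
    have "exp (- (2 * c * y)) \<le> exp (- (2 * y))"
      using c y by (simp add: mult_left_le_one_le mult_le_cancel_right1)
    then show "\<exists>D. ((\<lambda>y. c * (1 - exp (- (2 * y))) - (1 - exp (- (2 * c * y)))) has_real_derivative D) (at y) \<and> 0 \<le> D"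
      using c by (intro exI[of _ "2 * c * (exp (- (2 * y)) - exp (- (2 * c * y)))"])
        (auto intro!: derivative_eq_intros simp: algebra_simps)
  qed
  then have "1 - exp (- (2 * c * x)) \<le> c * (1 - exp (- (2 * x)))" by simp
  then have "exp (c * x) * (1 - exp (- (2 * c * x))) \<le> exp (c * x) * (c * (1 - exp (- (2 * x))))"
    by (rule mult_left_mono) simp
  moreover have "exp (c * x) * (1 - exp (- (2 * c * x))) = 2 * sinh (c * x)"
    by (simp add: sinh_def right_diff_distrib exp_add[symmetric])
  moreover have "exp (c * x) * (c * (1 - exp (- (2 * x)))) = 2 * (c * sinh x * exp ((c - 1) * x))"
    by (simp add: sinh_def right_diff_distrib left_diff_distrib exp_add[symmetric] mult.assoc[symmetric])
  ultimately show ?thesis by simp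
qed

lemma fact_odd_ge: "6 ^ n * fact n \<le> (fact (2 * n + 1) :: real)"
proof (induction n)
  case (Suc n)
  have "6 ^ Suc n * fact (Suc n) = (6 * real (Suc n)) * (6 ^ n * fact n)"
    by simp
  also have "\<dots> \<le> (6 * real (Suc n)) * fact (2 * n + 1)"
    by (intro mult_left_mono Suc.IH) auto
  also have "\<dots> \<le> (real (2 * n + 3) * real (2 * n + 2)) * fact (2 * n + 1)"
    by (intro mult_right_mono) (auto simp: algebra_simps)
  also have "\<dots> = fact (2 * Suc n + 1)"
    by (simp add: fact_Suc algebra_simps)
  finally show ?case .
qed simp

text \<open>Compare the power series term by term. The exponent \<open>x\<^sup>2 / 6\<close> is optimal at \<open>0\<close>, and it
produces the factor \<open>48 = 2 \<cdot> 24\<close> in the bound for the top eigenvalue.\<close>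

lemma sinh_le_exp_square:
  fixes x :: real
  assumes "0 \<le> x"
  shows "sinh x \<le> x * exp (x\<^sup>2 / 6)"
proof -
  have "(\<lambda>n. (\<lambda>n. if even n then 0 else x ^ n /\<^sub>R fact n) (2 * n + 1)) sums sinh x"
    by (subst sums_mono_reindex) (auto simp: strict_mono_def image_iff intro!: sinh_converges elim!: oddE)
  then have 1: "(\<lambda>n. x ^ (2 * n + 1) /\<^sub>R fact (2 * n + 1)) sums sinh x"
    by simp
  have 2: "(\<lambda>n. x * ((x\<^sup>2 / 6) ^ n /\<^sub>R fact n)) sums (x * exp (x\<^sup>2 / 6))"
    by (intro sums_mult exp_converges)
  show ?thesis
  proof (rule sums_le[OF _ 1 2])
    fix n
    have "x ^ (2 * n + 1) /\<^sub>R fact (2 * n + 1) = x ^ (2 * n + 1) / fact (2 * n + 1)"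
      by (simp add: field_simps)
    also have "\<dots> \<le> x ^ (2 * n + 1) / (6 ^ n * fact n)"
      using assms fact_odd_ge[of n] by (intro divide_left_mono) auto
    also have "\<dots> = x * ((x\<^sup>2 / 6) ^ n /\<^sub>R fact n)"
      by (simp add: field_simps power_divide flip: power_mult)
    finally show "x ^ (2 * n + 1) /\<^sub>R fact (2 * n + 1) \<le> x * ((x\<^sup>2 / 6) ^ n /\<^sub>R fact n)" .
  qed
qed


section \<open>The hyperbolic sine kernels\<close>

text \<open>This is \<open>\<bar>x - y\<bar>\<close> for \<open>x = exp (- u / \<kappa>)\<close>, \<open>y = exp (- v / \<kappa>)\<close> and \<open>t = \<bar>u - v\<bar>\<close>, divided by the
geometric mean of \<open>x\<close> and \<open>y\<close> and multiplied by \<open>\<kappa>\<close>, so that it tends to \<open>t\<close> as \<open>\<kappa>\<close> tends to \<open>\<infinity>\<close>.\<close>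

definition sinh_dist :: "real \<Rightarrow> real \<Rightarrow> real" where
  "sinh_dist \<kappa> t = 2 * \<kappa> * sinh (t / (2 * \<kappa>))"

lemma sinh_dist_continuous: "continuous_on A (sinh_dist \<kappa>)"
  unfolding sinh_dist_def divide_inverse by (intro continuous_intros)

lemma sinh_dist_measurable [measurable]: "sinh_dist \<kappa> \<in> borel_measurable borel"
  by (intro borel_measurable_continuous_onI sinh_dist_continuous)

lemma sinh_dist_gt: "0 < \<kappa> \<Longrightarrow> 0 < t \<Longrightarrow> t < sinh_dist \<kappa> t"
  using sinh_gt_self[of "t / (2 * \<kappa>)"] by (simp add: sinh_dist_def field_simps)

lemma sinh_dist_0 [simp]: "sinh_dist \<kappa> 0 = 0"
  by (simp add: sinh_dist_def)

lemma sinh_dist_le: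
  assumes "0 < \<kappa>" "0 \<le> t"
  shows "sinh_dist \<kappa> t \<le> t * exp (t\<^sup>2 / (24 * \<kappa>\<^sup>2))"
  using sinh_le_exp_square[of "t / (2 * \<kappa>)"] assms
  by (simp add: sinh_dist_def field_simps power_divide power_mult_distrib)

lemma sinh_dist_strict_antimono:
  assumes "0 < \<kappa>\<^sub>0" "\<kappa>\<^sub>0 < \<kappa>" "0 < t"
  shows "sinh_dist \<kappa> t < sinh_dist \<kappa>\<^sub>0 t"
  using sinh_mult_gt[of "\<kappa> / \<kappa>\<^sub>0" "t / (2 * \<kappa>)"] assms by (simp add: sinh_dist_def field_simps)

lemma sinh_dist_ratio_le:
  assumes "0 < \<kappa>\<^sub>0" "\<kappa>\<^sub>0 \<le> \<kappa>" "0 \<le> t"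
  shows "sinh_dist \<kappa>\<^sub>0 t \<le> sinh_dist \<kappa> t * exp (t * (\<kappa> - \<kappa>\<^sub>0) / (2 * \<kappa> * \<kappa>\<^sub>0))"
proof -
  have "sinh (\<kappa> / \<kappa>\<^sub>0 * (t / (2 * \<kappa>))) \<le> \<kappa> / \<kappa>\<^sub>0 * sinh (t / (2 * \<kappa>)) * exp ((\<kappa> / \<kappa>\<^sub>0 - 1) * (t / (2 * \<kappa>)))"
    using assms by (intro sinh_mult_le) auto
  moreover have "\<kappa> / \<kappa>\<^sub>0 * (t / (2 * \<kappa>)) = t / (2 * \<kappa>\<^sub>0)" "(\<kappa> / \<kappa>\<^sub>0 - 1) * (t / (2 * \<kappa>)) = t * (\<kappa> - \<kappa>\<^sub>0) / (2 * \<kappa> * \<kappa>\<^sub>0)"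
    using assms by (auto simp: field_simps)
  ultimately have "sinh (t / (2 * \<kappa>\<^sub>0)) \<le> \<kappa> / \<kappa>\<^sub>0 * sinh (t / (2 * \<kappa>)) * exp (t * (\<kappa> - \<kappa>\<^sub>0) / (2 * \<kappa> * \<kappa>\<^sub>0))"
    by simp
  then have "2 * \<kappa>\<^sub>0 * sinh (t / (2 * \<kappa>\<^sub>0)) \<le> 2 * \<kappa>\<^sub>0 * (\<kappa> / \<kappa>\<^sub>0 * sinh (t / (2 * \<kappa>)) * exp (t * (\<kappa> - \<kappa>\<^sub>0) / (2 * \<kappa> * \<kappa>\<^sub>0)))"
    using assms by (intro mult_left_mono) auto
  also have "\<dots> = sinh_dist \<kappa> t * exp (t * (\<kappa> - \<kappa>\<^sub>0) / (2 * \<kappa> * \<kappa>\<^sub>0))"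
    using assms by (simp add: sinh_dist_def)
  finally show ?thesis by (simp add: sinh_dist_def)
qed

definition sinh_kernel :: "real \<Rightarrow> real \<Rightarrow> real \<Rightarrow> real" where
  "sinh_kernel \<alpha> \<kappa> t = sinh_dist \<kappa> t powr (- \<alpha>)"

definition power_kernel :: "real \<Rightarrow> real \<Rightarrow> real" where
  "power_kernel \<alpha> t = t powr (- \<alpha>)"

lemma sinh_kernel_measurable [measurable]: "sinh_kernel \<alpha> \<kappa> \<in> borel_measurable borel"
  "power_kernel \<alpha> \<in> borel_measurable borel"
  unfolding sinh_kernel_def power_kernel_def by measurable

lemma sinh_kernel_nonneg [simp]: "0 \<le> sinh_kernel \<alpha> \<kappa> t" "0 \<le> power_kernel \<alpha> t"
  by (auto simp: sinh_kernel_def power_kernel_def)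

lemma sinh_kernel_0 [simp]: "sinh_kernel \<alpha> \<kappa> 0 = 0" "power_kernel \<alpha> 0 = 0"
  by (auto simp: sinh_kernel_def power_kernel_def)

lemma sinh_kernel_pos: "0 < \<kappa> \<Longrightarrow> 0 < t \<Longrightarrow> 0 < sinh_kernel \<alpha> \<kappa> t"
  using sinh_dist_gt[of \<kappa> t] by (simp add: sinh_kernel_def)

text \<open>A relative error \<open>exp y\<close> in the base costs a relative error \<open>a y\<close> in the power.\<close>

lemma powr_diff_le:
  fixes x x' :: real
  assumes a: "0 < a" and x: "0 < x" and x': "x \<le> x'" "x' \<le> x * exp y"
  shows "x powr (- a) - x' powr (- a) \<le> x powr (- a) * (a * y)"
proof -
  have "x powr (- a) * exp (- (a * y)) = (x * exp y) powr (- a)"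
    by (subst powr_mult) (auto simp: powr_def)
  also have "\<dots> \<le> x' powr (- a)"
    using assms by (intro powr_mono2') auto
  finally have "x powr (- a) - x' powr (- a) \<le> x powr (- a) * (1 - exp (- (a * y)))"
    by (simp add: right_diff_distrib)
  also have "\<dots> \<le> x powr (- a) * (a * y)"
    using exp_ge_add_one_self[of "- (a * y)"] by (intro mult_left_mono) auto
  finally show ?thesis .
qed

lemma sinh_kernel_le_power_kernel:
  assumes "0 \<le> a" "0 < \<kappa>" "0 \<le> t"
  shows "sinh_kernel a \<kappa> t \<le> power_kernel a t"
proof (cases "t = 0")
  case False
  with assms sinh_dist_gt[of \<kappa> t] show ?thesis
    unfolding sinh_kernel_def power_kernel_def by (intro powr_mono2') auto
qed simp

lemma power_kernel_diff_le:
  assumes a: "0 < a" and \<kappa>: "0 < \<kappa>" and t: "0 \<le> t"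
  shows "\<bar>sinh_kernel a \<kappa> t - power_kernel a t\<bar> \<le> a / (24 * \<kappa>\<^sup>2) * t powr (2 - a)"
proof (cases "t = 0")
  case False
  then have t0: "0 < t" using t by simp
  have "power_kernel a t - sinh_kernel a \<kappa> t \<le> t powr (- a) * (a * (t\<^sup>2 / (24 * \<kappa>\<^sup>2)))"
    unfolding sinh_kernel_def power_kernel_def using sinh_dist_gt[OF \<kappa> t0] sinh_dist_le[OF \<kappa> t] t0 a
    by (intro powr_diff_le) auto
  also have "\<dots> = a / (24 * \<kappa>\<^sup>2) * (t powr (- a) * t powr 2)"
    using t0 by simp
  also have "t powr (- a) * t powr 2 = t powr (2 - a)"
    by (simp add: powr_add[symmetric])
  finally show ?thesis
    using sinh_kernel_le_power_kernel[of a \<kappa> t] a \<kappa> t by simp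
qed simp

lemma sinh_kernel_strict_mono:
  assumes "0 < a" "0 < \<kappa>\<^sub>0" "\<kappa>\<^sub>0 < \<kappa>" "0 < t"
  shows "sinh_kernel a \<kappa>\<^sub>0 t < sinh_kernel a \<kappa> t"
  unfolding sinh_kernel_def using sinh_dist_strict_antimono[of \<kappa>\<^sub>0 \<kappa> t] sinh_dist_gt[of \<kappa> t] assms
  by (intro powr_less_mono2_neg) auto

lemma sinh_kernel_less_power_kernel:
  assumes "0 < a" "0 < \<kappa>" "0 < t"
  shows "sinh_kernel a \<kappa> t < power_kernel a t"
  unfolding sinh_kernel_def power_kernel_def using sinh_dist_gt[of \<kappa> t] assms
  by (intro powr_less_mono2_neg) auto

text \<open>Lipschitz continuity in \<open>1 / \<kappa>\<close>. At a fixed \<open>d\<close> the parameter \<open>\<kappa> = 1 - d - \<alpha>\<close> moves with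
\<open>\<alpha>\<close>, so continuity in \<open>\<kappa>\<close> is needed to identify the limit.\<close>

lemma sinh_kernel_diff_le:
  assumes a: "0 < a" and \<kappa>: "0 < \<kappa>\<^sub>0" "\<kappa>\<^sub>0 \<le> \<kappa>" and t: "0 \<le> t"
  shows "\<bar>sinh_kernel a \<kappa> t - sinh_kernel a \<kappa>\<^sub>0 t\<bar> \<le> a * (\<kappa> - \<kappa>\<^sub>0) / (2 * \<kappa> * \<kappa>\<^sub>0) * t powr (1 - a)"
proof (cases "t = 0")
  case False
  then have t0: "0 < t" using t by simp
  have \<kappa>': "0 < \<kappa>" using \<kappa> by simp
  have mono: "sinh_dist \<kappa> t \<le> sinh_dist \<kappa>\<^sub>0 t"
    using sinh_dist_strict_antimono[of \<kappa>\<^sub>0 \<kappa> t] \<kappa> t0 by (cases "\<kappa> = \<kappa>\<^sub>0") auto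
  have pos: "0 < sinh_dist \<kappa> t" using sinh_dist_gt[OF \<kappa>' t0] t0 by simp
  have nonneg: "0 \<le> a * (t * (\<kappa> - \<kappa>\<^sub>0) / (2 * \<kappa> * \<kappa>\<^sub>0))"
    using a \<kappa> t \<kappa>' by simp
  have "sinh_kernel a \<kappa> t - sinh_kernel a \<kappa>\<^sub>0 t \<le> sinh_kernel a \<kappa> t * (a * (t * (\<kappa> - \<kappa>\<^sub>0) / (2 * \<kappa> * \<kappa>\<^sub>0)))"
    unfolding sinh_kernel_def using sinh_dist_ratio_le[OF \<kappa> t] mono pos a
    by (intro powr_diff_le) auto
  also have "\<dots> \<le> power_kernel a t * (a * (t * (\<kappa> - \<kappa>\<^sub>0) / (2 * \<kappa> * \<kappa>\<^sub>0)))"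
    using nonneg sinh_kernel_le_power_kernel[of a \<kappa> t] a \<kappa>' t by (intro mult_right_mono) auto
  also have "\<dots> = a * (\<kappa> - \<kappa>\<^sub>0) / (2 * \<kappa> * \<kappa>\<^sub>0) * (t powr 1 * t powr (- a))"
    using t0 by (simp add: power_kernel_def)
  also have "t powr 1 * t powr (- a) = t powr (1 - a)"
    by (simp only: powr_add[symmetric]) simp
  finally have "sinh_kernel a \<kappa> t - sinh_kernel a \<kappa>\<^sub>0 t \<le> a * (\<kappa> - \<kappa>\<^sub>0) / (2 * \<kappa> * \<kappa>\<^sub>0) * t powr (1 - a)" .
  moreover have "sinh_kernel a \<kappa>\<^sub>0 t \<le> sinh_kernel a \<kappa> t"
    using sinh_kernel_strict_mono[of a \<kappa>\<^sub>0 \<kappa> t] a \<kappa> t0 by (cases "\<kappa> = \<kappa>\<^sub>0") auto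
  ultimately show ?thesis by simp
qed simp

text \<open>The derivative of \<open>r\<^sup>-\<^sup>a\<close> in \<open>a\<close> is \<open>- r\<^sup>-\<^sup>a ln r\<close>, and \<open>\<bar>ln r\<bar>\<close> is at most \<open>4 r\<^sup>-\<^sup>1\<^sup>/\<^sup>4\<close> for small and
\<open>4 r\<^sup>1\<^sup>/\<^sup>4\<close> for large \<open>r\<close>. For large \<open>r\<close> the decay \<open>r\<^sup>-\<^sup>\<alpha>\<close> absorbs the latter because \<open>\<alpha> \<ge> 1 / 4\<close>.
Since \<open>r \<ge> t\<close>, the bound is uniform in \<open>\<kappa>\<close>.\<close>

lemma sinh_kernel_exponent_diff_le:
  assumes \<alpha>: "1 / 4 \<le> \<alpha>" "\<alpha> \<le> 1 / 2" and \<kappa>: "0 < \<kappa>" and t: "0 \<le> t"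
  shows "\<bar>sinh_kernel \<alpha> \<kappa> t - sinh_kernel (1 / 2) \<kappa> t\<bar> \<le> 4 * (1 / 2 - \<alpha>) * (1 + \<bar>t\<bar> powr (- (3 / 4)))"
proof (cases "t = 0")
  case True
  then show ?thesis using \<alpha> by simp
next
  case False
  then have t0: "0 < t" using t by simp
  define r where "r = sinh_dist \<kappa> t"
  have r: "t < r" "0 < r" using sinh_dist_gt[OF \<kappa> t0] t0 by (auto simp: r_def)
  define \<delta> where "\<delta> = 1 / 2 - \<alpha>"
  have \<delta>: "0 \<le> \<delta>" using \<alpha> by (simp add: \<delta>_def)
  have ln_le: "ln x \<le> 4 * x powr (1 / 4)" if "0 < x" for x :: real
    using that ln_bound[of "x powr (1 / 4)"] by simp
  show ?thesis
  proof (cases "r \<le> 1")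
    case True
    have split: "r powr (- \<alpha>) = r powr (- (1 / 2)) * exp (\<delta> * ln r)"
      using r by (simp add: powr_def \<delta>_def exp_add[symmetric] algebra_simps)
    have "r powr (- \<alpha>) \<le> r powr (- (1 / 2))"
      using True r \<alpha> by (intro powr_mono') auto
    moreover have "r powr (- (1 / 2)) - r powr (- \<alpha>) \<le> 4 * \<delta> * t powr (- (3 / 4))"
    proof -
      have "r powr (- (1 / 2)) - r powr (- \<alpha>) = r powr (- (1 / 2)) * (1 - exp (\<delta> * ln r))"
        by (simp add: split right_diff_distrib)
      also have "\<dots> \<le> r powr (- (1 / 2)) * (\<delta> * (4 * r powr (- (1 / 4))))"
      proof (rule mult_left_mono)
        have "1 - exp (\<delta> * ln r) \<le> \<delta> * (- ln r)"
          using exp_ge_add_one_self[of "\<delta> * ln r"] unfolding mult_minus_right by linarith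
        also have "\<dots> = \<delta> * ln (1 / r)"
          using r by (simp add: ln_div)
        also have "\<dots> \<le> \<delta> * (4 * (1 / r) powr (1 / 4))"
          using \<delta> r by (intro mult_left_mono ln_le) auto
        also have "(1 / r) powr (1 / 4) = r powr (- (1 / 4))"
          by (simp add: powr_divide powr_minus_divide)
        finally show "1 - exp (\<delta> * ln r) \<le> \<delta> * (4 * r powr (- (1 / 4)))" .
      qed simp
      also have "\<dots> = 4 * \<delta> * (r powr (- (1 / 2)) * r powr (- (1 / 4)))" by simp
      also have "r powr (- (1 / 2)) * r powr (- (1 / 4)) = r powr (- (3 / 4))"
        by (simp add: powr_add[symmetric])
      also have "4 * \<delta> * r powr (- (3 / 4)) \<le> 4 * \<delta> * t powr (- (3 / 4))"
        using \<delta> r t0 by (intro mult_left_mono powr_mono2') auto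
      finally show ?thesis .
    qed
    moreover have "4 * \<delta> * t powr (- (3 / 4)) \<le> 4 * \<delta> * (1 + t powr (- (3 / 4)))"
      using \<delta> by (intro mult_left_mono) auto
    ultimately show ?thesis using t0 by (simp add: sinh_kernel_def r_def[symmetric] \<delta>_def)
  next
    case False
    have split: "r powr (- (1 / 2)) = r powr (- \<alpha>) * exp (- (\<delta> * ln r))"
      using r by (simp add: powr_def \<delta>_def exp_add[symmetric] algebra_simps)
    have "r powr (- (1 / 2)) \<le> r powr (- \<alpha>)"
      using False \<alpha> by (intro powr_mono) auto
    moreover have "r powr (- \<alpha>) - r powr (- (1 / 2)) \<le> 4 * \<delta>"
    proof -
      have "r powr (- \<alpha>) - r powr (- (1 / 2)) = r powr (- \<alpha>) * (1 - exp (- (\<delta> * ln r)))"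
        by (simp add: split right_diff_distrib)
      also have "\<dots> \<le> r powr (- \<alpha>) * (\<delta> * (4 * r powr (1 / 4)))"
      proof (rule mult_left_mono)
        have "1 - exp (- (\<delta> * ln r)) \<le> \<delta> * ln r"
          using exp_ge_add_one_self[of "- (\<delta> * ln r)"] by simp
        also have "\<dots> \<le> \<delta> * (4 * r powr (1 / 4))"
          using \<delta> r by (intro mult_left_mono ln_le) auto
        finally show "1 - exp (- (\<delta> * ln r)) \<le> \<delta> * (4 * r powr (1 / 4))" .
      qed simp
      also have "\<dots> = 4 * \<delta> * r powr (1 / 4 - \<alpha>)"
        by (simp add: powr_add[symmetric] algebra_simps powr_diff powr_minus_divide)
      also have "\<dots> \<le> 4 * \<delta> * r powr 0"
        using \<delta> False \<alpha> by (intro mult_left_mono powr_mono) auto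
      finally show ?thesis using r by simp
    qed
    moreover have "4 * \<delta> * 1 \<le> 4 * \<delta> * (1 + t powr (- (3 / 4)))"
      using \<delta> by (intro mult_left_mono) auto
    ultimately show ?thesis using t0 by (simp add: sinh_kernel_def r_def[symmetric] \<delta>_def)
  qed
qed

lemma power_kernel_le:
  assumes "0 \<le> a" "a \<le> 1 / 2" "0 \<le> t"
  shows "power_kernel a t \<le> 1 + t powr (- 1 / 2)"
proof (cases "t \<le> 1")
  case True
  then have "t powr (- a) \<le> t powr (- 1 / 2)"
    using assms by (intro powr_mono') auto
  then show ?thesis by (simp add: power_kernel_def)
next
  case False
  then have "t powr (- a) \<le> 1 powr (- a)"
    using assms by (intro powr_mono2') auto
  then show ?thesis by (simp add: power_kernel_def add_increasing2)
qed

lemma admissible_sinh_kernel: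
  assumes "0 < a" "a \<le> 1 / 2" "0 < \<kappa>"
  shows "admissible (sinh_kernel a \<kappa>)"
proof -
  have "sinh_kernel a \<kappa> t \<le> 1 + t powr (- 1 / 2)" if "0 \<le> t" for t
    using sinh_kernel_le_power_kernel[of a \<kappa> t] power_kernel_le[of a t] that assms by linarith
  moreover have "continuous_on {0<..} (sinh_kernel a \<kappa>)"
    unfolding sinh_kernel_def
  proof (intro continuous_on_powr sinh_dist_continuous continuous_intros ballI)
    show "sinh_dist \<kappa> t \<noteq> 0" if "t \<in> {0<..}" for t
      using sinh_dist_gt[of \<kappa> t] assms that by auto
  qed
  ultimately show ?thesis
    using assms sinh_kernel_pos by (auto simp: admissible_def)
qed

lemma admissible_power_kernel:
  assumes "0 < a" "a \<le> 1 / 2"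
  shows "admissible (power_kernel a)"
proof -
  have "continuous_on {0<..} (power_kernel a)"
    unfolding power_kernel_def by (intro continuous_intros) auto
  then show ?thesis
    using assms power_kernel_le by (auto simp: admissible_def power_kernel_def)
qed


section \<open>Dependence of the top eigenvalue on the parameters\<close>

lemma top_value_sinh_kernel_exponent:
  assumes "1 / 4 \<le> \<alpha>" "\<alpha> \<le> 1 / 2" "0 < \<kappa>"
  shows "\<bar>top_value (sinh_kernel \<alpha> \<kappa>) - top_value (sinh_kernel (1 / 2) \<kappa>)\<bar> \<le> 40 * (1 / 2 - \<alpha>)"
proof (rule top_value_diff_Schur)
  show "\<bar>sinh_kernel \<alpha> \<kappa> t - sinh_kernel (1 / 2) \<kappa> t\<bar> \<le> 4 * (1 / 2 - \<alpha>) * (1 + \<bar>t\<bar> powr (- (3 / 4)))" if "0 \<le> t" for t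
    using sinh_kernel_exponent_diff_le assms that by blast
  show "(\<integral>\<^sup>+ v. ennreal (4 * (1 / 2 - \<alpha>) * (1 + \<bar>\<bar>u - v\<bar>\<bar> powr (- (3 / 4)))) \<partial>expm) \<le> ennreal (40 * (1 / 2 - \<alpha>))" for u
    using nn_integral_cmult_weight_le[of "3 / 4" "4 * (1 / 2 - \<alpha>)" u] assms by simp
qed (use assms admissible_sinh_kernel in auto)

lemma moment_expm_cmult:
  assumes "0 \<le> c"
  shows "(\<integral>\<^sup>+t. ennreal (c * t ^ n) \<partial>expm) = ennreal (c * fact n)"
  using assms by (simp add: ennreal_mult' nn_integral_cmult moment_expm ennreal_mult[of _ "fact n"])

text \<open>The Hilbert--Schmidt norm of \<open>t\<^sup>3\<^sup>/\<^sup>2\<close> is the square root of the third moment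
\<open>3! = 6\<close>.\<close>

lemma top_value_sinh_kernel_half_inf:
  assumes \<kappa>: "0 < \<kappa>"
  shows "\<bar>top_value (sinh_kernel (1 / 2) \<kappa>) - top_value (power_kernel (1 / 2))\<bar> \<le> sqrt 6 / (48 * \<kappa>\<^sup>2)"
proof -
  define c where "c = 1 / (48 * \<kappa>\<^sup>2)"
  have "\<bar>top_value (sinh_kernel (1 / 2) \<kappa>) - top_value (power_kernel (1 / 2))\<bar> \<le> sqrt (c\<^sup>2 * 6)"
  proof (rule top_value_diff_Hilbert_Schmidt)
    show "\<bar>sinh_kernel (1 / 2) \<kappa> t - power_kernel (1 / 2) t\<bar> \<le> c * t powr (3 / 2)" if "0 \<le> t" for t
      using power_kernel_diff_le[of "1 / 2" \<kappa> t] \<kappa> that by (simp add: c_def)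
    have "(\<integral>\<^sup>+ t. ennreal ((c * t powr (3 / 2))\<^sup>2) \<partial>expm) = (\<integral>\<^sup>+ t. ennreal (c\<^sup>2 * t ^ 3) \<partial>expm)"
    proof (rule nn_integral_cong_AE, unfold AE_expm, intro AE_I2 impI)
      fix t :: real assume "0 \<le> t"
      then have "(t powr (3 / 2))\<^sup>2 = t ^ 3"
        by (simp add: power2_eq_square powr_add[symmetric])
      then show "ennreal ((c * t powr (3 / 2))\<^sup>2) = ennreal (c\<^sup>2 * t ^ 3)"
        by (simp add: power_mult_distrib)
    qed
    also have "\<dots> = ennreal (c\<^sup>2 * 6)"
      by (simp add: moment_expm_cmult fact_numeral)
    finally show "(\<integral>\<^sup>+ t. ennreal ((c * t powr (3 / 2))\<^sup>2) \<partial>expm) \<le> ennreal (c\<^sup>2 * 6)"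
      by simp
  qed (use \<kappa> admissible_sinh_kernel admissible_power_kernel in auto)
  also have "sqrt (c\<^sup>2 * 6) = sqrt 6 / (48 * \<kappa>\<^sup>2)"
    by (simp add: real_sqrt_mult c_def)
  finally show ?thesis .
qed

lemma top_value_sinh_kernel_half_diff:
  assumes \<kappa>: "0 < \<kappa>\<^sub>0" "\<kappa>\<^sub>0 \<le> \<kappa>"
  shows "\<bar>top_value (sinh_kernel (1 / 2) \<kappa>) - top_value (sinh_kernel (1 / 2) \<kappa>\<^sub>0)\<bar> \<le> (\<kappa> - \<kappa>\<^sub>0) / (4 * \<kappa> * \<kappa>\<^sub>0)"
proof -
  define c where "c = (\<kappa> - \<kappa>\<^sub>0) / (4 * \<kappa> * \<kappa>\<^sub>0)"
  have c: "0 \<le> c" using \<kappa> by (simp add: c_def)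
  have "\<bar>top_value (sinh_kernel (1 / 2) \<kappa>) - top_value (sinh_kernel (1 / 2) \<kappa>\<^sub>0)\<bar> \<le> sqrt (c\<^sup>2)"
  proof (rule top_value_diff_Hilbert_Schmidt)
    show "\<bar>sinh_kernel (1 / 2) \<kappa> t - sinh_kernel (1 / 2) \<kappa>\<^sub>0 t\<bar> \<le> c * t powr (1 / 2)" if "0 \<le> t" for t
      using sinh_kernel_diff_le[of "1 / 2" \<kappa>\<^sub>0 \<kappa> t] \<kappa> that by (simp add: c_def)
    have "(\<integral>\<^sup>+ t. ennreal ((c * t powr (1 / 2))\<^sup>2) \<partial>expm) = (\<integral>\<^sup>+ t. ennreal (c\<^sup>2 * t ^ 1) \<partial>expm)"
    proof (rule nn_integral_cong_AE, unfold AE_expm, intro AE_I2 impI)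
      fix t :: real assume "0 \<le> t"
      then have "(t powr (1 / 2))\<^sup>2 = t"
        by (simp add: power2_eq_square powr_add[symmetric])
      then show "ennreal ((c * t powr (1 / 2))\<^sup>2) = ennreal (c\<^sup>2 * t ^ 1)"
        by (simp add: power_mult_distrib)
    qed
    also have "\<dots> = ennreal (c\<^sup>2)"
      by (simp only: moment_expm_cmult zero_le_power2) simp
    finally show "(\<integral>\<^sup>+ t. ennreal ((c * t powr (1 / 2))\<^sup>2) \<partial>expm) \<le> ennreal (c\<^sup>2)"
      by simp
  qed (use \<kappa> admissible_sinh_kernel in auto)
  then show ?thesis using c by (simp add: c_def)
qed

lemma powr_le_one_plus_square:
  fixes t :: real
  assumes "0 \<le> t" "0 \<le> b" "b \<le> 2"
  shows "t powr b \<le> 1 + t\<^sup>2"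
proof (cases "t \<le> 1")
  case True
  then have "t powr b \<le> 1" using assms by (intro powr_le1) auto
  then show ?thesis by (simp add: add_increasing2)
next
  case False
  then have "t powr b \<le> t powr 2" using assms by (intro powr_mono) auto
  then show ?thesis using False by simp
qed

lemma top_value_power_kernel_diff:
  assumes \<alpha>: "0 < \<alpha>" "\<alpha> \<le> 1 / 2" and \<kappa>: "0 < \<kappa>"
  shows "\<bar>top_value (sinh_kernel \<alpha> \<kappa>) - top_value (power_kernel \<alpha>)\<bar> \<le> sqrt 50 / (48 * \<kappa>\<^sup>2)"
proof -
  define c where "c = 1 / (48 * \<kappa>\<^sup>2)"
  have c: "0 \<le> c" by (simp add: c_def)
  have "\<bar>top_value (sinh_kernel \<alpha> \<kappa>) - top_value (power_kernel \<alpha>)\<bar> \<le> sqrt (c\<^sup>2 * 50)"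
  proof (rule top_value_diff_Hilbert_Schmidt)
    show "\<bar>sinh_kernel \<alpha> \<kappa> t - power_kernel \<alpha> t\<bar> \<le> c * (1 + t\<^sup>2)" if t: "0 \<le> t" for t
    proof -
      have "\<bar>sinh_kernel \<alpha> \<kappa> t - power_kernel \<alpha> t\<bar> \<le> \<alpha> / (24 * \<kappa>\<^sup>2) * t powr (2 - \<alpha>)"
        by (rule power_kernel_diff_le[OF \<alpha>(1) \<kappa> t])
      also have "\<dots> \<le> c * (1 + t\<^sup>2)"
        using \<alpha> \<kappa> t by (intro mult_mono powr_le_one_plus_square) (auto simp: c_def field_simps)
      finally show ?thesis .
    qed
    have "(\<integral>\<^sup>+ t. ennreal ((c * (1 + t\<^sup>2))\<^sup>2) \<partial>expm) \<le> (\<integral>\<^sup>+ t. ennreal (c\<^sup>2 * 2 * t ^ 0) + ennreal (c\<^sup>2 * 2 * t ^ 4) \<partial>expm)"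
    proof (rule nn_integral_mono)
      fix t :: real
      have "(1 + t\<^sup>2)\<^sup>2 \<le> 2 + 2 * t ^ 4"
        using sum_squares_bound[of 1 "t\<^sup>2"] by (simp add: power2_sum power_mult[symmetric])
      then have "c\<^sup>2 * (1 + t\<^sup>2)\<^sup>2 \<le> c\<^sup>2 * (2 + 2 * t ^ 4)"
        by (rule mult_left_mono) simp
      then have "ennreal ((c * (1 + t\<^sup>2))\<^sup>2) \<le> ennreal (c\<^sup>2 * 2 * t ^ 0 + c\<^sup>2 * 2 * t ^ 4)"
        unfolding power_mult_distrib[of c] by (intro ennreal_leI) (simp add: algebra_simps)
      then show "ennreal ((c * (1 + t\<^sup>2))\<^sup>2) \<le> ennreal (c\<^sup>2 * 2 * t ^ 0) + ennreal (c\<^sup>2 * 2 * t ^ 4)"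
        by simp
    qed
    also have "\<dots> = ennreal (c\<^sup>2 * 2 * fact 0) + ennreal (c\<^sup>2 * 2 * fact 4)"
      using moment_expm_cmult[of "c\<^sup>2 * 2" 0] moment_expm_cmult[of "c\<^sup>2 * 2" 4]
      by (subst nn_integral_add) auto
    also have "\<dots> = ennreal (c\<^sup>2 * 50)"
      by (subst ennreal_plus[symmetric]) (auto simp: fact_numeral)
    finally show "(\<integral>\<^sup>+ t. ennreal ((c * (1 + t\<^sup>2))\<^sup>2) \<partial>expm) \<le> ennreal (c\<^sup>2 * 50)" .
  qed (use \<alpha> \<kappa> admissible_sinh_kernel admissible_power_kernel in auto)
  also have "sqrt (c\<^sup>2 * 50) = sqrt 50 / (48 * \<kappa>\<^sup>2)"
    using c by (simp add: real_sqrt_mult c_def)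
  finally show ?thesis .
qed

lemma top_value_sinh_kernel_half_strict_mono:
  assumes "0 < \<kappa>\<^sub>0" "\<kappa>\<^sub>0 < \<kappa>"
  shows "top_value (sinh_kernel (1 / 2) \<kappa>\<^sub>0) < top_value (sinh_kernel (1 / 2) \<kappa>)"
  using assms by (intro top_value_strict_mono admissible_sinh_kernel sinh_kernel_strict_mono) auto

lemma top_value_sinh_kernel_half_less_inf:
  assumes "0 < \<kappa>"
  shows "top_value (sinh_kernel (1 / 2) \<kappa>) < top_value (power_kernel (1 / 2))"
  using assms by (intro top_value_strict_mono admissible_sinh_kernel admissible_power_kernel sinh_kernel_less_power_kernel) auto


section \<open>The trace\<close>

lemma sinh_kernel_trace_upper:
  assumes a: "0 < a" "a < 1"
  shows "(\<integral>\<^sup>+t. ennreal (power_kernel a t) \<partial>expm) \<le> ennreal (1 / (1 - a) + 1)"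
proof -
  have one: "(\<integral>\<^sup>+t. ennreal (t powr (- a)) * indicator {0..1} t \<partial>lborel) = ennreal (1 / (1 - a))"
    using nn_integral_powr_01[of "- a"] a by simp
  have "(\<integral>\<^sup>+t. ennreal (power_kernel a t) \<partial>expm)
      = (\<integral>\<^sup>+t. ennreal (indicator {0..} t * exp (- t)) * ennreal (power_kernel a t) \<partial>lborel)"
    by (rule nn_integral_expm) measurable
  also have "\<dots> \<le> (\<integral>\<^sup>+t. ennreal (t powr (- a)) * indicator {0..1} t + ennreal (indicator {0..} t * exp (- t)) \<partial>lborel)"
  proof (rule nn_integral_mono)
    fix t :: real
    show "ennreal (indicator {0..} t * exp (- t)) * ennreal (power_kernel a t)
      \<le> ennreal (t powr (- a)) * indicator {0..1} t + ennreal (indicator {0..} t * exp (- t))"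
    proof (cases "0 \<le> t \<and> t \<le> 1")
      case True
      then have "exp (- t) * t powr (- a) \<le> t powr (- a)"
        by (intro mult_left_le_one_le) auto
      then show ?thesis
        using True by (auto simp: power_kernel_def intro!: add_increasing2 ennreal_leI simp flip: ennreal_mult)
    next
      case False
      show ?thesis
      proof (cases "0 \<le> t")
        case True
        then have "t powr (- a) \<le> 1 powr (- a)"
          using False a by (intro powr_mono2') auto
        then have "exp (- t) * t powr (- a) \<le> exp (- t)"
          by (intro mult_right_le_one_le) auto
        then show ?thesis
          using True False by (auto simp: power_kernel_def intro!: ennreal_leI simp flip: ennreal_mult)
      qed simp
    qed
  qed
  also have "\<dots> = ennreal (1 / (1 - a)) + (\<integral>\<^sup>+t. ennreal (indicator {0..} t * exp (- t)) \<partial>lborel)"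
    by (subst nn_integral_add) (auto simp: one)
  also have "(\<integral>\<^sup>+t. ennreal (indicator {0..} t * exp (- t)) \<partial>lborel) = ennreal 1"
    using nn_integral_expm[of "\<lambda>_. 1"] emeasure_expm_UNIV by simp
  also have "ennreal (1 / (1 - a)) + ennreal 1 = ennreal (1 / (1 - a) + 1)"
    using a by (intro ennreal_plus[symmetric]) auto
  finally show ?thesis .
qed

text \<open>On \<open>(0, 1]\<close> and for \<open>\<kappa> \<ge> 1 / 2\<close> the argument \<open>2 \<kappa> sinh (t / (2 \<kappa>))\<close> is at most \<open>t exp t\<close>. So
\<open>exp (- t)\<close> times the kernel is at least \<open>t\<^sup>-\<^sup>a (1 - 2 t)\<close>, and the integral of \<open>2 t\<^sup>1\<^sup>-\<^sup>a\<close> is moved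
to the other side to keep all integrands nonnegative.\<close>

lemma sinh_kernel_trace_lower:
  assumes a: "0 < a" "a < 1" and \<kappa>: "1 / 2 \<le> \<kappa>"
  shows "ennreal (1 / (1 - a)) \<le> (\<integral>\<^sup>+t. ennreal (sinh_kernel a \<kappa> t) \<partial>expm) + ennreal (2 / (2 - a))"
proof -
  have "ennreal (1 / (1 - a)) = (\<integral>\<^sup>+t. ennreal (t powr (- a)) * indicator {0..1} t \<partial>lborel)"
    using nn_integral_powr_01[of "- a"] a by simp
  also have "\<dots> \<le> (\<integral>\<^sup>+t. ennreal (indicator {0..} t * exp (- t)) * ennreal (sinh_kernel a \<kappa> t)
      + 2 * (ennreal (t powr (1 - a)) * indicator {0..1} t) \<partial>lborel)"
  proof (rule nn_integral_mono)
    fix t :: real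
    show "ennreal (t powr (- a)) * indicator {0..1} t \<le> ennreal (indicator {0..} t * exp (- t)) * ennreal (sinh_kernel a \<kappa> t)
      + 2 * (ennreal (t powr (1 - a)) * indicator {0..1} t)"
    proof (cases "0 < t \<and> t \<le> 1")
      case True
      have \<kappa>2: "1 / 4 \<le> \<kappa>\<^sup>2"
        using power_mono[OF \<kappa>, of 2] by (simp add: power2_eq_square)
      have tt: "t\<^sup>2 / (24 * \<kappa>\<^sup>2) \<le> t"
      proof -
        have "t * t \<le> t * 1" using True by (intro mult_left_mono) auto
        moreover have "t * 1 \<le> t * (24 * \<kappa>\<^sup>2)" using True \<kappa>2 by (intro mult_left_mono) auto
        ultimately have "t\<^sup>2 \<le> t * (24 * \<kappa>\<^sup>2)" by (simp add: power2_eq_square)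
        then show ?thesis using \<kappa>2 by (subst pos_divide_le_eq) auto
      qed
      have "sinh_dist \<kappa> t \<le> t * exp (t\<^sup>2 / (24 * \<kappa>\<^sup>2))"
        using \<kappa> True by (intro sinh_dist_le) auto
      also have "\<dots> \<le> t * exp t" using True tt by (intro mult_left_mono) auto
      finally have "t powr (- a) - sinh_kernel a \<kappa> t \<le> t powr (- a) * (a * t)"
        unfolding sinh_kernel_def using a True sinh_dist_gt[of \<kappa> t] \<kappa> by (intro powr_diff_le) auto
      also have "\<dots> \<le> t powr (- a) * t"
        using a True by (intro mult_left_mono) (auto intro!: mult_left_le_one_le)
      also have "\<dots> = t powr (1 - a)"
        using True by (simp add: powr_diff powr_minus_divide)
      finally have 1: "t powr (- a) \<le> sinh_kernel a \<kappa> t + t powr (1 - a)" by simp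
      have "sinh_kernel a \<kappa> t * (1 - t) \<le> sinh_kernel a \<kappa> t * exp (- t)"
        using exp_ge_add_one_self[of "- t"] by (intro mult_left_mono) auto
      moreover have "sinh_kernel a \<kappa> t * t \<le> t powr (- a) * t"
        using sinh_kernel_le_power_kernel[of a \<kappa> t] a \<kappa> True by (intro mult_right_mono) (auto simp: power_kernel_def)
      moreover have "t powr (- a) * t = t powr (1 - a)"
        using True by (simp add: powr_diff powr_minus_divide)
      ultimately have "t powr (- a) \<le> exp (- t) * sinh_kernel a \<kappa> t + 2 * t powr (1 - a)"
        using 1 by (simp add: algebra_simps)
      then have "ennreal (t powr (- a)) \<le> ennreal (exp (- t) * sinh_kernel a \<kappa> t + 2 * t powr (1 - a))"
        by (rule ennreal_leI)
      also have "\<dots> = ennreal (exp (- t)) * ennreal (sinh_kernel a \<kappa> t) + 2 * ennreal (t powr (1 - a))"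
        by (simp add: ennreal_mult)
      finally show ?thesis using True by simp
    next
      case False
      then show ?thesis by (cases "t = 0") auto
    qed
  qed
  also have "\<dots> = (\<integral>\<^sup>+t. ennreal (indicator {0..} t * exp (- t)) * ennreal (sinh_kernel a \<kappa> t) \<partial>lborel)
      + 2 * (\<integral>\<^sup>+t. ennreal (t powr (1 - a)) * indicator {0..1} t \<partial>lborel)"
    by (simp add: nn_integral_add nn_integral_cmult)
  also have "(\<integral>\<^sup>+t. ennreal (indicator {0..} t * exp (- t)) * ennreal (sinh_kernel a \<kappa> t) \<partial>lborel)
      = (\<integral>\<^sup>+t. ennreal (sinh_kernel a \<kappa> t) \<partial>expm)"
    by (rule nn_integral_expm[symmetric]) measurable
  also have "(\<integral>\<^sup>+t. ennreal (t powr (1 - a)) * indicator {0..1} t \<partial>lborel) = ennreal (1 / (2 - a))"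
    using nn_integral_powr_01[of "1 - a"] a by simp
  also have "2 * ennreal (1 / (2 - a)) = ennreal (2 / (2 - a))"
    using a by (simp flip: ennreal_mult ennreal_numeral)
  finally show ?thesis .
qed

lemma sinh_kernel_integrable:
  assumes a: "0 < a" "a < 1"
  shows "integrable expm (power_kernel a)" "0 < \<kappa> \<Longrightarrow> integrable expm (sinh_kernel a \<kappa>)"
proof -
  show int: "integrable expm (power_kernel a)"
    using sinh_kernel_trace_upper[OF a] by (intro integrableI_bounded) (auto intro: order.strict_trans1)
  assume "0 < \<kappa>"
  then have "AE t in expm. norm (sinh_kernel a \<kappa> t) \<le> norm (power_kernel a t)"
    unfolding AE_expm using sinh_kernel_le_power_kernel[of a \<kappa>] a by auto
  then show "integrable expm (sinh_kernel a \<kappa>)"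
    by (intro Bochner_Integration.integrable_bound[OF int]) auto
qed

lemma sinh_kernel_trace_estimate:
  assumes a: "0 < a" "a < 1" and \<kappa>: "1 / 2 \<le> \<kappa>"
  shows "\<bar>(1 - a) * (\<integral>t. sinh_kernel a \<kappa> t \<partial>expm) - 1\<bar> \<le> 2 * (1 - a)"
proof -
  have \<kappa>0: "0 < \<kappa>" using \<kappa> by simp
  define I where "I = (\<integral>t. sinh_kernel a \<kappa> t \<partial>expm)"
  have I: "(\<integral>\<^sup>+t. ennreal (sinh_kernel a \<kappa> t) \<partial>expm) = ennreal I"
    unfolding I_def using sinh_kernel_integrable(2)[OF a \<kappa>0] by (intro nn_integral_eq_integral) auto
  have I0: "0 \<le> I" unfolding I_def by (intro Bochner_Integration.integral_nonneg) simp
  have "ennreal (1 / (1 - a)) \<le> ennreal (I + 2 / (2 - a))"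
    using sinh_kernel_trace_lower[OF a \<kappa>] I0 a by (simp add: I)
  then have "1 / (1 - a) \<le> I + 2 / (2 - a)"
    using a I0 by (subst (asm) ennreal_le_iff) auto
  moreover have "2 / (2 - a) \<le> 2" using a by (simp add: field_simps)
  ultimately have "1 / (1 - a) \<le> I + 2" by simp
  then have low: "1 \<le> (1 - a) * I + 2 * (1 - a)"
    using a by (simp add: field_simps)
  have "I \<le> (\<integral>t. power_kernel a t \<partial>expm)"
    unfolding I_def using sinh_kernel_integrable[OF a] \<kappa>0 sinh_kernel_le_power_kernel[of a \<kappa>] a
    by (intro integral_mono_AE) (auto simp: AE_expm)
  also have "\<dots> \<le> 1 / (1 - a) + 1"
  proof -
    have "ennreal (\<integral>t. power_kernel a t \<partial>expm) = (\<integral>\<^sup>+t. ennreal (power_kernel a t) \<partial>expm)"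
      using sinh_kernel_integrable(1)[OF a] by (intro nn_integral_eq_integral[symmetric]) auto
    also note sinh_kernel_trace_upper[OF a]
    finally show ?thesis using a by (subst (asm) ennreal_le_iff) auto
  qed
  finally have "(1 - a) * I \<le> (1 - a) * (1 / (1 - a) + 1)"
    using a by (intro mult_left_mono) auto
  moreover have "(1 - a) * (1 / (1 - a) + 1) = 1 + (1 - a)"
    using a by (simp add: distrib_left)
  ultimately have "(1 - a) * I \<le> 1 + (1 - a)" by simp
  with low a have "(1 - a) * I - 1 \<le> 2 * (1 - a)" "- ((1 - a) * I - 1) \<le> 2 * (1 - a)"
    by argo+
  then show ?thesis unfolding I_def[symmetric] by (rule abs_leI)
qed

lemma sinh_kernel_trace_pos:
  assumes a: "0 < a" "a < 1"
  shows "0 < (\<integral>t. power_kernel a t \<partial>expm)"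
proof -
  have "(\<integral>t. power_kernel a t \<partial>expm) \<noteq> 0"
  proof
    assume "(\<integral>t. power_kernel a t \<partial>expm) = 0"
    then have "AE t in expm. power_kernel a t = 0"
      using sinh_kernel_integrable(1)[OF a] by (subst (asm) integral_nonneg_eq_0_iff_AE) auto
    then have "AE t in expm. t = 0"
      by eventually_elim (auto simp: power_kernel_def)
    with AE_expm_neq[of 0] have "AE t in expm. False"
      by eventually_elim simp
    then show False by simp
  qed
  moreover have "0 \<le> (\<integral>t. power_kernel a t \<partial>expm)"
    by (intro Bochner_Integration.integral_nonneg) simp
  ultimately show ?thesis by (simp add: less_le)
qed

lemma sinh_kernel_trace_diff:
  assumes a: "0 < a" "a < 1" and \<kappa>: "0 < \<kappa>"
  shows "\<bar>(\<integral>t. sinh_kernel a \<kappa> t \<partial>expm) - (\<integral>t. power_kernel a t \<partial>expm)\<bar> \<le> 1 / (8 * \<kappa>\<^sup>2)"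
proof -
  note int = sinh_kernel_integrable(1)[OF a] sinh_kernel_integrable(2)[OF a \<kappa>]
  have "ennreal \<bar>(\<integral>t. sinh_kernel a \<kappa> t \<partial>expm) - (\<integral>t. power_kernel a t \<partial>expm)\<bar>
      = ennreal \<bar>\<integral>t. sinh_kernel a \<kappa> t - power_kernel a t \<partial>expm\<bar>"
    using int by simp
  also have "\<dots> \<le> (\<integral>\<^sup>+t. ennreal (norm (sinh_kernel a \<kappa> t - power_kernel a t)) \<partial>expm)"
    using integral_norm_bound_ennreal[of expm "\<lambda>t. sinh_kernel a \<kappa> t - power_kernel a t"] int by simp
  also have "\<dots> \<le> (\<integral>\<^sup>+t. ennreal (1 / (24 * \<kappa>\<^sup>2) * t ^ 0) + ennreal (1 / (24 * \<kappa>\<^sup>2) * t ^ 2) \<partial>expm)"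
  proof (rule nn_integral_mono_AE, unfold AE_expm, intro AE_I2 impI)
    fix t :: real assume t: "0 \<le> t"
    have "\<bar>sinh_kernel a \<kappa> t - power_kernel a t\<bar> \<le> a / (24 * \<kappa>\<^sup>2) * t powr (2 - a)"
      by (rule power_kernel_diff_le[OF a(1) \<kappa> t])
    also have "\<dots> \<le> 1 / (24 * \<kappa>\<^sup>2) * (1 + t\<^sup>2)"
      using a \<kappa> t by (intro mult_mono powr_le_one_plus_square divide_right_mono) auto
    finally have "ennreal (norm (sinh_kernel a \<kappa> t - power_kernel a t)) \<le> ennreal (1 / (24 * \<kappa>\<^sup>2) * t ^ 0 + 1 / (24 * \<kappa>\<^sup>2) * t ^ 2)"
      by (intro ennreal_leI) (simp add: algebra_simps add_divide_distrib)
    then show "ennreal (norm (sinh_kernel a \<kappa> t - power_kernel a t)) \<le> ennreal (1 / (24 * \<kappa>\<^sup>2) * t ^ 0) + ennreal (1 / (24 * \<kappa>\<^sup>2) * t ^ 2)"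
      by (subst ennreal_plus[symmetric]) auto
  qed
  also have "\<dots> = ennreal (1 / (24 * \<kappa>\<^sup>2) * fact 0) + ennreal (1 / (24 * \<kappa>\<^sup>2) * fact 2)"
    using moment_expm_cmult[of "1 / (24 * \<kappa>\<^sup>2)" 0] moment_expm_cmult[of "1 / (24 * \<kappa>\<^sup>2)" 2]
    by (subst nn_integral_add) auto
  also have "\<dots> = ennreal (1 / (8 * \<kappa>\<^sup>2))"
    using \<kappa> by (subst ennreal_plus[symmetric]) (auto simp: field_simps)
  finally show ?thesis by (subst (asm) ennreal_le_iff) auto
qed


section \<open>The limiting operators on the half-line\<close>

lemma integral_expm:
  assumes [measurable]: "(h :: real \<Rightarrow> real) \<in> borel_measurable borel"
  shows "(LBINT v:{0..}. h v * exp (- v)) = (\<integral>v. h v \<partial>expm)"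
  unfolding expm_def set_lebesgue_integral_def
  by (subst integral_density) (auto simp: indicator_def intro!: Bochner_Integration.integral_cong)

lemma L2_nu_iff: "f \<in> L2 \<nu> \<longleftrightarrow> (\<lambda>x. indicator {0..} x * f x) \<in> L2 expm"
proof -
  define F where "F = (\<lambda>x. indicator {0..} x * f x)"
  have meas: "f \<in> borel_measurable \<nu> \<longleftrightarrow> F \<in> borel_measurable borel"
    unfolding \<nu>_def F_def by (simp add: borel_measurable_restrict_space_iff)
  have int: "integrable \<nu> (\<lambda>x. (f x)\<^sup>2) \<longleftrightarrow> integrable expm (\<lambda>x. (F x)\<^sup>2)" if f: "f \<in> borel_measurable \<nu>"
  proof -
    have [measurable]: "F \<in> borel_measurable borel" using meas f by simp
    have f': "f \<in> borel_measurable (restrict_space lborel {0..})" using f by (simp add: \<nu>_def)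
    have "integrable \<nu> (\<lambda>x. (f x)\<^sup>2) \<longleftrightarrow> integrable (restrict_space lborel {0..}) (\<lambda>x. exp (- x) *\<^sub>R (f x)\<^sup>2)"
      unfolding \<nu>_def using f'
      by (intro integrable_density) (auto intro!: measurable_restrict_space1)
    also have "\<dots> \<longleftrightarrow> integrable lborel (\<lambda>x. indicator {0..} x *\<^sub>R (exp (- x) *\<^sub>R (f x)\<^sup>2))"
      by (rule integrable_restrict_space) auto
    also have "\<dots> \<longleftrightarrow> integrable lborel (\<lambda>x. (indicator {0..} x * exp (- x)) *\<^sub>R (F x)\<^sup>2)"
      by (intro arg_cong[where f = "integrable lborel"] ext) (auto simp: F_def indicator_def)
    also have "\<dots> \<longleftrightarrow> integrable expm (\<lambda>x. (F x)\<^sup>2)"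
      unfolding expm_def by (intro integrable_density[symmetric]) auto
    finally show ?thesis .
  qed
  show ?thesis
    using meas int by (auto simp: L2_def F_def[symmetric])
qed

lemma AE_nu: "(AE u in \<nu>. P u) \<longleftrightarrow> (AE u in expm. P u)"
proof -
  have "(AE u in \<nu>. P u) \<longleftrightarrow> (AE u in restrict_space lborel {0..}. P u)"
    unfolding \<nu>_def by (subst AE_density) (auto intro!: measurable_restrict_space1)
  also have "\<dots> \<longleftrightarrow> (AE u in lborel. u \<in> {0..} \<longrightarrow> P u)"
    by (rule AE_restrict_space_iff) auto
  finally show ?thesis by (simp add: AE_expm)
qed

text \<open>Square-integrable functions for \<open>\<nu>\<close> are measurable only on the half-line, so an eigenfunction
is first cut off outside it; the operator does not see the difference.\<close>

lemma is_eigenvalue_nu_iff: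
  assumes [measurable]: "k \<in> borel_measurable borel"
    and A: "\<And>h u. A h u = (LBINT v:{0..}. k \<bar>u - v\<bar> * h v * exp (- v))"
  shows "is_eigenvalue \<nu> A l \<longleftrightarrow> is_eigenvalue expm (kernel_op k) l"
proof -
  let ?r = "\<lambda>f x. indicator {0..} x * f x :: real"
  have A_eq: "A f = kernel_op k (?r f)" if "f \<in> L2 \<nu>" for f
  proof
    fix u
    have [measurable]: "?r f \<in> borel_measurable borel" using that by (simp add: L2_nu_iff L2_measurable)
    have "A f u = (LBINT v:{0..}. (k \<bar>u - v\<bar> * ?r f v) * exp (- v))"
      unfolding A by (intro set_lebesgue_integral_cong) auto
    also have "\<dots> = kernel_op k (?r f) u"
      unfolding kernel_op_def by (rule integral_expm) measurable
    finally show "A f u = kernel_op k (?r f) u" .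
  qed
  have AE_r: "AE x in expm. ?r f x = f x" for f
    unfolding AE_expm by auto
  show ?thesis
  proof
    assume "is_eigenvalue \<nu> A l"
    then obtain f where f: "f \<in> L2 \<nu>" and not0: "\<not> (AE x in \<nu>. f x = 0)" and ev: "AE x in \<nu>. A f x = l * f x"
      by (auto simp: is_eigenvalue_def)
    have "\<not> (AE x in expm. ?r f x = 0)"
    proof
      assume "AE x in expm. ?r f x = 0"
      with AE_r[of f] have "AE x in expm. f x = 0" by eventually_elim simp
      then show False using not0 by (simp add: AE_nu)
    qed
    moreover have "AE x in expm. kernel_op k (?r f) x = l * ?r f x"
      using ev[unfolded AE_nu] AE_r[of f] by eventually_elim (simp add: A_eq[OF f])
    ultimately show "is_eigenvalue expm (kernel_op k) l"
      unfolding is_eigenvalue_def using f by (intro bexI[of _ "?r f"]) (simp_all add: L2_nu_iff)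
  next
    assume "is_eigenvalue expm (kernel_op k) l"
    then obtain f where f: "f \<in> L2 expm" and not0: "\<not> (AE x in expm. f x = 0)"
      and ev: "AE x in expm. kernel_op k f x = l * f x"
      by (auto simp: is_eigenvalue_def)
    note [measurable] = L2_measurable[OF f]
    have rf: "?r f \<in> L2 expm"
      by (rule L2_cong_AE(1)[OF f]) (use AE_r[of f] in auto)
    then have f': "f \<in> L2 \<nu>" by (simp add: L2_nu_iff)
    have "kernel_op k (?r f) = kernel_op k f"
      by (rule ext, rule kernel_op_cong_AE) (use AE_r[of f] in auto)
    with f' not0 ev show "is_eigenvalue \<nu> A l"
      unfolding is_eigenvalue_def AE_nu using A_eq[OF f'] by auto
  qed
qed

lemma lambda_max_S_half: "lambda_max \<nu> S_half = top_value (power_kernel (1 / 2))"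
proof -
  have "is_eigenvalue \<nu> S_half = is_eigenvalue expm (kernel_op (power_kernel (1 / 2)))"
    by (rule ext, rule is_eigenvalue_nu_iff) (auto simp: S_half_def power_kernel_def)
  then have "lambda_max \<nu> S_half = lambda_max expm (kernel_op (power_kernel (1 / 2)))"
    by (simp add: lambda_max_def)
  also have "\<dots> = top_value (power_kernel (1 / 2))"
    by (intro lambda_max_eq_top_value admissible_power_kernel) auto
  finally show ?thesis .
qed

lemma lambda_max_S_half_kappa:
  assumes "0 < \<kappa>"
  shows "lambda_max \<nu> (S_half_kappa \<kappa>) = top_value (sinh_kernel (1 / 2) \<kappa>)"
proof -
  have "is_eigenvalue \<nu> (S_half_kappa \<kappa>) = is_eigenvalue expm (kernel_op (sinh_kernel (1 / 2) \<kappa>))"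
    by (rule ext, rule is_eigenvalue_nu_iff) (auto simp: S_half_kappa_def sinh_kernel_def sinh_dist_def)
  then have "lambda_max \<nu> (S_half_kappa \<kappa>) = lambda_max expm (kernel_op (sinh_kernel (1 / 2) \<kappa>))"
    by (simp add: lambda_max_def)
  also have "\<dots> = top_value (sinh_kernel (1 / 2) \<kappa>)"
    using assms by (intro lambda_max_eq_top_value admissible_sinh_kernel) auto
  finally show ?thesis .
qed


section \<open>The logarithmic change of variable\<close>

text \<open>Both sides assign \<open>1 - x\<^sup>\<kappa>\<close> to \<open>{x<..}\<close> for \<open>0 < x < 1\<close>. This single identity transports
integrals and null sets between the half-line and the unit interval.\<close>

lemma distr_expm_exp:
  assumes \<kappa>: "0 < \<kappa>"
  shows "distr expm borel (\<lambda>u. exp (- u / \<kappa>))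
    = density lborel (\<lambda>x. ennreal (indicator {0<..<1} x * (\<kappa> * x powr (\<kappa> - 1))))" (is "?L = ?R")
proof (rule measure_eqI_lessThan)
  show sets: "sets ?L = sets borel" "sets ?R = sets borel" by auto
  have L: "emeasure ?L {x<..} = emeasure expm {u. x < exp (- u / \<kappa>)}" for x
    by (subst emeasure_distr) (auto simp: vimage_def)
  have R: "emeasure ?R {x<..} = (\<integral>\<^sup>+y. ennreal (indicator {0<..<1} y * (\<kappa> * y powr (\<kappa> - 1))) * indicator {x<..} y \<partial>lborel)" for x
    by (subst emeasure_density) auto
  show "emeasure ?L {x<..} < \<infinity>" for x
    unfolding L by (simp add: expm.emeasure_eq_measure)
  show "emeasure ?L {x<..} = emeasure ?R {x<..}" for x
  proof -
    consider "1 \<le> x" | "x \<le> 0" | "0 < x" "x < 1" by linarith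
    then show ?thesis
    proof cases
      case 1
      have "emeasure expm {u. x < exp (- u / \<kappa>)} = 0"
      proof -
        have "AE u in expm. \<not> x < exp (- u / \<kappa>)"
          unfolding AE_expm
        proof (intro AE_I2 impI)
          fix u :: real assume "0 \<le> u"
          then have "exp (- u / \<kappa>) \<le> exp 0"
            using \<kappa> by (subst exp_le_cancel_iff) simp
          then show "\<not> x < exp (- u / \<kappa>)" using 1 unfolding not_less exp_zero by (rule order.trans)
        qed
        then show ?thesis by (subst (asm) AE_iff_measurable[OF _ refl]) auto
      qed
      moreover have "emeasure ?R {x<..} = (\<integral>\<^sup>+y. 0 \<partial>(lborel :: real measure))"
        unfolding R by (intro nn_integral_cong) (use 1 in \<open>auto simp: indicator_def\<close>)
      ultimately show ?thesis unfolding L by simp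
    next
      case 2
      have "x < exp (- u / \<kappa>)" for u using 2 by (meson exp_gt_zero le_less_trans)
      then have "emeasure ?L {x<..} = 1" unfolding L by (simp add: emeasure_expm_UNIV)
      moreover have "emeasure ?R {x<..} = 1"
      proof -
        have "emeasure ?R {x<..} = (\<integral>\<^sup>+y. ennreal \<kappa> * (ennreal (y powr (\<kappa> - 1)) * indicator {0..1} y) \<partial>lborel)"
          unfolding R
        proof (rule nn_integral_cong_AE)
          show "AE y in lborel. ennreal (indicator {0<..<1} y * (\<kappa> * y powr (\<kappa> - 1))) * indicator {x<..} y
            = ennreal \<kappa> * (ennreal (y powr (\<kappa> - 1)) * indicator {0..1} y)"
            using AE_lborel_singleton[of "0 :: real"] AE_lborel_singleton[of "1 :: real"]
            by eventually_elim (use 2 \<kappa> in \<open>auto simp: indicator_def simp flip: ennreal_mult\<close>)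
        qed
        also have "\<dots> = ennreal \<kappa> * (\<integral>\<^sup>+y. ennreal (y powr (\<kappa> - 1)) * indicator {0..1} y \<partial>lborel)"
          by (rule nn_integral_cmult) auto
        also have "(\<integral>\<^sup>+y. ennreal (y powr (\<kappa> - 1)) * indicator {0..1} y \<partial>lborel) = ennreal (1 / \<kappa>)"
          using nn_integral_powr_01[of "\<kappa> - 1"] \<kappa> by simp
        also have "ennreal \<kappa> * ennreal (1 / \<kappa>) = 1"
          using \<kappa> by (simp flip: ennreal_mult)
        finally show ?thesis .
      qed
      ultimately show ?thesis by simp
    next
      case 3
      define b where "b = - \<kappa> * ln x"
      have b: "0 < b" using 3 \<kappa> by (simp add: b_def mult_pos_neg)
      have iff: "x < exp (- u / \<kappa>) \<longleftrightarrow> u < b" for u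
      proof -
        have "x < exp (- u / \<kappa>) \<longleftrightarrow> ln x < - u / \<kappa>"
          using 3 by (metis exp_gt_zero ln_exp ln_less_cancel_iff)
        also have "\<dots> \<longleftrightarrow> u < b" using \<kappa> by (simp add: b_def field_simps) linarith
        finally show ?thesis .
      qed
      have "emeasure ?L {x<..} = emeasure expm {..<b}"
        unfolding L by (simp only: iff lessThan_def)
      also have "\<dots> = (\<integral>\<^sup>+u. ennreal (indicator {0..} u * exp (- u)) * indicator {..<b} u \<partial>lborel)"
        unfolding expm_def by (subst emeasure_density) auto
      also have "\<dots> = (\<integral>\<^sup>+u. ennreal (exp (- u)) * indicator {0..b} u \<partial>lborel)"
      proof (rule nn_integral_cong_AE)
        show "AE u in lborel. ennreal (indicator {0..} u * exp (- u)) * indicator {..<b} u = ennreal (exp (- u)) * indicator {0..b} u"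
          using AE_lborel_singleton[of b] by eventually_elim (auto simp: indicator_def)
      qed
      also have "\<dots> = ennreal (- exp (- b) - (- exp (- 0)))"
        using b by (intro nn_integral_FTC_Icc)
          (auto intro!: derivative_eq_intros simp: has_real_derivative_iff_has_vector_derivative[symmetric])
      also have "- exp (- b) - (- exp (- 0)) = 1 - x powr \<kappa>"
        using 3 by (simp add: b_def powr_def)
      finally have LL: "emeasure ?L {x<..} = ennreal (1 - x powr \<kappa>)" .
      have "emeasure ?R {x<..} = (\<integral>\<^sup>+y. ennreal (\<kappa> * y powr (\<kappa> - 1)) * indicator {x..1} y \<partial>lborel)"
        unfolding R
      proof (rule nn_integral_cong_AE)
        show "AE y in lborel. ennreal (indicator {0<..<1} y * (\<kappa> * y powr (\<kappa> - 1))) * indicator {x<..} y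
          = ennreal (\<kappa> * y powr (\<kappa> - 1)) * indicator {x..1} y"
          using AE_lborel_singleton[of x] AE_lborel_singleton[of "1 :: real"]
          by eventually_elim (use 3 in \<open>auto simp: indicator_def\<close>)
      qed
      also have "\<dots> = ennreal (1 powr \<kappa> - x powr \<kappa>)"
        using 3 \<kappa> by (intro nn_integral_FTC_Icc)
          (auto intro!: derivative_eq_intros simp: has_real_derivative_iff_has_vector_derivative[symmetric])
      finally show ?thesis using LL by simp
    qed
  qed
qed

lemma integral_unit_interval:
  fixes F :: "real \<Rightarrow> real"
  assumes \<kappa>: "0 < \<kappa>" and [measurable]: "F \<in> borel_measurable borel"
  shows "(LBINT x:{0<..<1}. F x) = (\<integral>u. F (exp (- u / \<kappa>)) * exp (- u / \<kappa>) powr (1 - \<kappa>) / \<kappa> \<partial>expm)"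
    and "integrable lborel (\<lambda>x. indicator {0<..<1} x *\<^sub>R F x)
      \<longleftrightarrow> integrable expm (\<lambda>u. F (exp (- u / \<kappa>)) * exp (- u / \<kappa>) powr (1 - \<kappa>) / \<kappa>)"
proof -
  let ?G = "\<lambda>x. F x * x powr (1 - \<kappa>) / \<kappa>"
  have eq: "(indicator {0<..<1} x * (\<kappa> * x powr (\<kappa> - 1))) *\<^sub>R ?G x = indicator {0<..<1} x *\<^sub>R F x" for x
  proof (cases "0 < x \<and> x < 1")
    case True
    have "x powr (\<kappa> - 1) * x powr (1 - \<kappa>) = 1"
      using True by (simp add: powr_add[symmetric])
    then show ?thesis using True \<kappa> by (simp add: field_simps)
  qed auto
  have "(LBINT x:{0<..<1}. F x) = (LBINT x. (indicator {0<..<1} x * (\<kappa> * x powr (\<kappa> - 1))) *\<^sub>R ?G x)"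
    unfolding set_lebesgue_integral_def by (simp only: eq)
  also have "\<dots> = integral\<^sup>L (density lborel (\<lambda>x. ennreal (indicator {0<..<1} x * (\<kappa> * x powr (\<kappa> - 1))))) ?G"
    using \<kappa> by (intro integral_density[symmetric]) auto
  also have "\<dots> = (\<integral>u. ?G (exp (- u / \<kappa>)) \<partial>expm)"
    unfolding distr_expm_exp[OF \<kappa>, symmetric] by (rule integral_distr) auto
  finally show "(LBINT x:{0<..<1}. F x) = (\<integral>u. F (exp (- u / \<kappa>)) * exp (- u / \<kappa>) powr (1 - \<kappa>) / \<kappa> \<partial>expm)" .
  have "integrable lborel (\<lambda>x. indicator {0<..<1} x *\<^sub>R F x)
      \<longleftrightarrow> integrable lborel (\<lambda>x. (indicator {0<..<1} x * (\<kappa> * x powr (\<kappa> - 1))) *\<^sub>R ?G x)"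
    by (simp only: eq)
  also have "\<dots> \<longleftrightarrow> integrable (density lborel (\<lambda>x. ennreal (indicator {0<..<1} x * (\<kappa> * x powr (\<kappa> - 1))))) ?G"
    using \<kappa> by (intro integrable_density[symmetric]) auto
  also have "\<dots> \<longleftrightarrow> integrable expm (\<lambda>u. ?G (exp (- u / \<kappa>)))"
    unfolding distr_expm_exp[OF \<kappa>, symmetric] by (rule integrable_distr_eq) auto
  finally show "integrable lborel (\<lambda>x. indicator {0<..<1} x *\<^sub>R F x)
      \<longleftrightarrow> integrable expm (\<lambda>u. F (exp (- u / \<kappa>)) * exp (- u / \<kappa>) powr (1 - \<kappa>) / \<kappa>)" .
qed

lemma AE_unit_interval: "(AE x in unit_interval. P x) \<longleftrightarrow> (AE x in lborel. x \<in> {0<..<1} \<longrightarrow> P x)"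
  unfolding unit_interval_def by (rule AE_restrict_space_iff) auto

lemma AE_unit_interval_iff:
  assumes \<kappa>: "0 < \<kappa>" and P: "{x. P x} \<in> sets borel"
  shows "(AE x in unit_interval. P x) \<longleftrightarrow> (AE u in expm. P (exp (- u / \<kappa>)))"
proof -
  have "(AE u in expm. P (exp (- u / \<kappa>))) \<longleftrightarrow> (AE x in distr expm borel (\<lambda>u. exp (- u / \<kappa>)). P x)"
    using P by (subst AE_distr_iff) auto
  also have "\<dots> \<longleftrightarrow> (AE x in lborel. 0 < ennreal (indicator {0<..<1} x * (\<kappa> * x powr (\<kappa> - 1))) \<longrightarrow> P x)"
    unfolding distr_expm_exp[OF \<kappa>] by (subst AE_density) auto
  also have "\<dots> \<longleftrightarrow> (AE x in lborel. x \<in> {0<..<1} \<longrightarrow> P x)"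
    using \<kappa> by (intro AE_cong) (auto simp: indicator_def)
  finally show ?thesis by (simp add: AE_unit_interval)
qed

text \<open>The identity \<open>e\<^sup>-\<^sup>p - e\<^sup>-\<^sup>q = 2 e\<^sup>-\<^sup>(\<^sup>p\<^sup>+\<^sup>q\<^sup>)\<^sup>/\<^sup>2 sinh ((q - p) / 2)\<close>.\<close>

lemma abs_exp_diff_powr:
  assumes \<kappa>: "0 < \<kappa>"
  shows "\<bar>exp (- u / \<kappa>) - exp (- v / \<kappa>)\<bar> powr (- a)
    = exp (- u / \<kappa>) powr (- a / 2) * exp (- v / \<kappa>) powr (- a / 2) * (\<kappa> powr a * sinh_kernel a \<kappa> \<bar>u - v\<bar>)"
proof -
  have diff: "exp (- u / \<kappa>) - exp (- v / \<kappa>)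
      = exp (- u / (2 * \<kappa>)) * exp (- v / (2 * \<kappa>)) * (2 * sinh ((v - u) / (2 * \<kappa>)))" for u v
  proof -
    let ?z = "exp (- u / (2 * \<kappa>)) * exp (- v / (2 * \<kappa>))"
    have "?z * exp ((v - u) / (2 * \<kappa>)) = exp (- u / \<kappa>)" "?z * exp (- ((v - u) / (2 * \<kappa>))) = exp (- v / \<kappa>)"
      unfolding exp_add[symmetric] using \<kappa> by (simp_all add: field_simps)
    then show ?thesis by (simp add: sinh_def right_diff_distrib)
  qed
  have nonneg: "0 \<le> sinh (\<bar>u - v\<bar> / (2 * \<kappa>))" using \<kappa> by simp
  have "\<bar>exp (- u / \<kappa>) - exp (- v / \<kappa>)\<bar>
      = exp (- u / (2 * \<kappa>)) * exp (- v / (2 * \<kappa>)) * (2 * sinh (\<bar>u - v\<bar> / (2 * \<kappa>)))"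
  proof (cases "u \<le> v")
    case True
    then have "\<bar>u - v\<bar> = v - u" by simp
    then show ?thesis using nonneg unfolding diff[of u v] by (simp add: abs_mult)
  next
    case False
    then have "\<bar>u - v\<bar> = u - v" by simp
    then show ?thesis using nonneg
      unfolding abs_minus_commute[of "exp (- u / \<kappa>)"] diff[of v u] by (simp add: abs_mult)
  qed
  also have "\<dots> = exp (- u / (2 * \<kappa>)) * exp (- v / (2 * \<kappa>)) * (inverse \<kappa> * sinh_dist \<kappa> \<bar>u - v\<bar>)"
    using \<kappa> by (simp add: sinh_dist_def)
  finally have "\<bar>exp (- u / \<kappa>) - exp (- v / \<kappa>)\<bar> powr (- a)
      = exp (- u / (2 * \<kappa>)) powr (- a) * exp (- v / (2 * \<kappa>)) powr (- a)
        * (inverse \<kappa> powr (- a) * sinh_dist \<kappa> \<bar>u - v\<bar> powr (- a))"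
    by (simp only: powr_mult)
  moreover have "exp (- u / (2 * \<kappa>)) powr (- a) = exp (- u / \<kappa>) powr (- a / 2)" for u
    by (simp add: exp_powr_real)
  moreover have "inverse \<kappa> powr (- a) = \<kappa> powr a"
    by (simp add: inverse_powr powr_minus)
  ultimately show ?thesis by (simp only: sinh_kernel_def)
qed

text \<open>Up to the constant \<open>sqrt \<kappa>\<close>, this is a unitary map from \<open>L\<^sup>2\<close> of the unit interval to \<open>L\<^sup>2\<close> of the
exponential law. Leaving the constant out does not affect eigenvalues.\<close>

definition log_pullback :: "real \<Rightarrow> (real \<Rightarrow> real) \<Rightarrow> real \<Rightarrow> real" where
  "log_pullback \<kappa> f u = f (exp (- u / \<kappa>)) * exp (- u / \<kappa>) powr ((1 - \<kappa>) / 2)"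

lemma log_pullback_measurable [measurable]:
  assumes [measurable]: "f \<in> borel_measurable borel"
  shows "log_pullback \<kappa> f \<in> borel_measurable borel"
  unfolding log_pullback_def by measurable

text \<open>The value \<open>\<kappa> = 1 - d - \<alpha>\<close> is the one for which all powers of \<open>y = exp (- v / \<kappa>)\<close> are absorbed
by the pullback, and those of \<open>x\<close> by undoing it.\<close>

lemma T_op_log:
  assumes [measurable]: "f \<in> borel_measurable borel" and \<kappa>: "0 < \<kappa>" "\<kappa> = 1 - d - \<alpha>"
  shows "T_op \<alpha> d f (exp (- u / \<kappa>))
    = \<kappa> powr (\<alpha> - 1) * exp (- u / \<kappa>) powr ((\<kappa> - 1) / 2) * kernel_op (sinh_kernel \<alpha> \<kappa>) (log_pullback \<kappa> f) u"
proof -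
  let ?X = "exp (- u / \<kappa>)"
  have "T_op \<alpha> d f ?X = (\<integral>v. (?X powr (- d / 2) * exp (- v / \<kappa>) powr (- d / 2)
      * \<bar>?X - exp (- v / \<kappa>)\<bar> powr (- \<alpha>) * f (exp (- v / \<kappa>))) * exp (- v / \<kappa>) powr (1 - \<kappa>) / \<kappa> \<partial>expm)"
    unfolding T_op_def by (rule integral_unit_interval[OF \<kappa>(1)]) measurable
  also have "\<dots> = (\<integral>v. \<kappa> powr (\<alpha> - 1) * ?X powr ((\<kappa> - 1) / 2) * (sinh_kernel \<alpha> \<kappa> \<bar>u - v\<bar> * log_pullback \<kappa> f v) \<partial>expm)"
  proof (rule Bochner_Integration.integral_cong[OF refl])
    fix v
    let ?Y = "exp (- v / \<kappa>)"
    have X: "?X powr (- d / 2) * ?X powr (- \<alpha> / 2) = ?X powr ((\<kappa> - 1) / 2)"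
      unfolding powr_add[symmetric] using \<kappa>(2) by (intro arg_cong[where f = "(powr) ?X"]) (simp add: field_simps)
    have Y: "?Y powr (- d / 2) * ?Y powr (- \<alpha> / 2) * ?Y powr (1 - \<kappa>) = ?Y powr ((1 - \<kappa>) / 2)"
      unfolding powr_add[symmetric] using \<kappa>(2) by (intro arg_cong[where f = "(powr) ?Y"]) (simp add: field_simps)
    have K: "\<kappa> powr \<alpha> / \<kappa> = \<kappa> powr (\<alpha> - 1)"
      using \<kappa>(1) by (simp add: powr_diff)
    have "(?X powr (- d / 2) * ?Y powr (- d / 2) * \<bar>?X - ?Y\<bar> powr (- \<alpha>) * f ?Y) * ?Y powr (1 - \<kappa>) / \<kappa>
      = (\<kappa> powr \<alpha> / \<kappa>) * (?X powr (- d / 2) * ?X powr (- \<alpha> / 2)) * (sinh_kernel \<alpha> \<kappa> \<bar>u - v\<bar> *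
         (f ?Y * (?Y powr (- d / 2) * ?Y powr (- \<alpha> / 2) * ?Y powr (1 - \<kappa>))))"
      unfolding abs_exp_diff_powr[OF \<kappa>(1)] by simp
    then show "(?X powr (- d / 2) * ?Y powr (- d / 2) * \<bar>?X - ?Y\<bar> powr (- \<alpha>) * f ?Y) * ?Y powr (1 - \<kappa>) / \<kappa>
      = \<kappa> powr (\<alpha> - 1) * ?X powr ((\<kappa> - 1) / 2) * (sinh_kernel \<alpha> \<kappa> \<bar>u - v\<bar> * log_pullback \<kappa> f v)"
      unfolding X Y K log_pullback_def .
  qed
  also have "\<dots> = \<kappa> powr (\<alpha> - 1) * ?X powr ((\<kappa> - 1) / 2) * kernel_op (sinh_kernel \<alpha> \<kappa>) (log_pullback \<kappa> f) u"
    by (simp add: kernel_op_def)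
  finally show ?thesis .
qed

lemma L2_unit_interval_iff:
  assumes [measurable]: "f \<in> borel_measurable borel" and \<kappa>: "0 < \<kappa>"
  shows "f \<in> L2 unit_interval \<longleftrightarrow> log_pullback \<kappa> f \<in> L2 expm"
proof -
  have sq: "(f (exp (- u / \<kappa>)))\<^sup>2 * exp (- u / \<kappa>) powr (1 - \<kappa>) / \<kappa> = (1 / \<kappa>) * (log_pullback \<kappa> f u)\<^sup>2" for u
  proof -
    have "(exp (- u / \<kappa>) powr ((1 - \<kappa>) / 2))\<^sup>2 = exp (- u / \<kappa>) powr (1 - \<kappa>)"
      by (simp add: power2_eq_square powr_add[symmetric])
    then show ?thesis by (simp add: log_pullback_def power_mult_distrib)
  qed
  have "f \<in> L2 unit_interval \<longleftrightarrow> integrable unit_interval (\<lambda>x. (f x)\<^sup>2)"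
    by (auto simp: L2_def unit_interval_def intro!: measurable_restrict_space1)
  also have "\<dots> \<longleftrightarrow> integrable lborel (\<lambda>x. indicator {0<..<1} x *\<^sub>R (f x)\<^sup>2)"
    unfolding unit_interval_def by (rule integrable_restrict_space) auto
  also have "\<dots> \<longleftrightarrow> integrable expm (\<lambda>u. (1 / \<kappa>) * (log_pullback \<kappa> f u)\<^sup>2)"
    by (subst integral_unit_interval(2)[OF \<kappa>]) (auto simp only: sq, measurable)
  also have "\<dots> \<longleftrightarrow> log_pullback \<kappa> f \<in> L2 expm"
    unfolding integrable_mult_left_iff integrable_mult_right_iff using \<kappa> by (simp add: L2_def)
  finally show ?thesis .
qed

lemma T_op_measurable [measurable]:
  assumes [measurable]: "f \<in> borel_measurable borel"
  shows "T_op \<alpha> d f \<in> borel_measurable borel"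
  unfolding T_op_def set_lebesgue_integral_def by measurable

lemma eigenfunction_log_pullback_iff:
  assumes [measurable]: "f \<in> borel_measurable borel" and \<kappa>: "0 < \<kappa>" "\<kappa> = 1 - d - \<alpha>"
  shows "(AE x in unit_interval. f x = 0) \<longleftrightarrow> (AE u in expm. log_pullback \<kappa> f u = 0)"
    and "(AE x in unit_interval. T_op \<alpha> d f x = l * f x)
      \<longleftrightarrow> (AE u in expm. kernel_op (sinh_kernel \<alpha> \<kappa>) (log_pullback \<kappa> f) u = \<kappa> powr (1 - \<alpha>) * l * log_pullback \<kappa> f u)"
proof -
  show "(AE x in unit_interval. f x = 0) \<longleftrightarrow> (AE u in expm. log_pullback \<kappa> f u = 0)"
    by (subst AE_unit_interval_iff[OF \<kappa>(1)]) (auto simp: log_pullback_def)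
  have iff: "T_op \<alpha> d f (exp (- u / \<kappa>)) = l * f (exp (- u / \<kappa>))
      \<longleftrightarrow> kernel_op (sinh_kernel \<alpha> \<kappa>) (log_pullback \<kappa> f) u = \<kappa> powr (1 - \<alpha>) * l * log_pullback \<kappa> f u" for u
  proof -
    let ?X = "exp (- u / \<kappa>)" and ?S = "kernel_op (sinh_kernel \<alpha> \<kappa>) (log_pullback \<kappa> f) u"
    define c where "c = \<kappa> powr (1 - \<alpha>) * ?X powr ((1 - \<kappa>) / 2)"
    have c: "c \<noteq> 0" using \<kappa>(1) by (simp add: c_def)
    have c1: "c * (\<kappa> powr (\<alpha> - 1) * ?X powr ((\<kappa> - 1) / 2)) = 1"
    proof -
      have "\<kappa> powr (1 - \<alpha>) * \<kappa> powr (\<alpha> - 1) = 1"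
        using \<kappa>(1) by (simp add: powr_add[symmetric])
      moreover have "?X powr ((1 - \<kappa>) / 2) * ?X powr ((\<kappa> - 1) / 2) = 1"
        by (simp add: powr_add[symmetric] diff_divide_distrib)
      moreover have "c * (\<kappa> powr (\<alpha> - 1) * ?X powr ((\<kappa> - 1) / 2))
          = (\<kappa> powr (1 - \<alpha>) * \<kappa> powr (\<alpha> - 1)) * (?X powr ((1 - \<kappa>) / 2) * ?X powr ((\<kappa> - 1) / 2))"
        by (simp only: c_def mult_ac)
      ultimately show ?thesis by simp
    qed
    have "c * T_op \<alpha> d f ?X = (c * (\<kappa> powr (\<alpha> - 1) * ?X powr ((\<kappa> - 1) / 2))) * ?S"
      unfolding T_op_log[OF assms(1) \<kappa>] by (rule mult.assoc[symmetric])
    then have "c * T_op \<alpha> d f ?X = ?S"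
      unfolding c1 by simp
    moreover have "c * (l * f ?X) = \<kappa> powr (1 - \<alpha>) * l * log_pullback \<kappa> f u"
      by (simp add: c_def log_pullback_def)
    ultimately show ?thesis using c by (metis mult_left_cancel)
  qed
  show "(AE x in unit_interval. T_op \<alpha> d f x = l * f x)
      \<longleftrightarrow> (AE u in expm. kernel_op (sinh_kernel \<alpha> \<kappa>) (log_pullback \<kappa> f) u = \<kappa> powr (1 - \<alpha>) * l * log_pullback \<kappa> f u)"
    unfolding iff[symmetric] by (rule AE_unit_interval_iff[OF \<kappa>(1)]) measurable
qed

text \<open>From left to right, an eigenfunction is first replaced by its extension by \<open>0\<close> to a Borel
function on the line; from right to left, the pullback is inverted explicitly.\<close>

lemma is_eigenvalue_T_op_iff:
  assumes \<kappa>: "0 < \<kappa>" "\<kappa> = 1 - d - \<alpha>"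
  shows "is_eigenvalue unit_interval (T_op \<alpha> d) l
    \<longleftrightarrow> is_eigenvalue expm (kernel_op (sinh_kernel \<alpha> \<kappa>)) (\<kappa> powr (1 - \<alpha>) * l)"
proof
  assume "is_eigenvalue unit_interval (T_op \<alpha> d) l"
  then obtain f where f: "f \<in> L2 unit_interval" and not0: "\<not> (AE x in unit_interval. f x = 0)"
    and ev: "AE x in unit_interval. T_op \<alpha> d f x = l * f x"
    by (auto simp: is_eigenvalue_def)
  define g where "g = (\<lambda>x. indicator {0<..<1} x * f x)"
  have g [measurable]: "g \<in> borel_measurable borel"
    using f unfolding L2_def unit_interval_def g_def
    by (auto simp: borel_measurable_restrict_space_iff)
  have fg: "f x = g x" if "x \<in> space unit_interval" for x
    using that by (simp add: g_def unit_interval_def)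
  have gL2: "g \<in> L2 unit_interval"
  proof -
    have "integrable unit_interval (\<lambda>x. (g x)\<^sup>2) \<longleftrightarrow> integrable unit_interval (\<lambda>x. (f x)\<^sup>2)"
      by (intro Bochner_Integration.integrable_cong) (auto simp: fg)
    moreover have "g \<in> borel_measurable unit_interval"
      unfolding unit_interval_def by (intro measurable_restrict_space1) simp
    ultimately show ?thesis using f by (simp add: L2_def)
  qed
  have T: "T_op \<alpha> d g = T_op \<alpha> d f"
    unfolding T_op_def by (intro ext set_lebesgue_integral_cong) (auto simp: g_def)
  have not0': "\<not> (AE x in unit_interval. g x = 0)"
    using not0 fg by (simp cong: AE_cong)
  have ev': "AE x in unit_interval. T_op \<alpha> d g x = l * g x"
    using ev unfolding T by (rule AE_mp) (auto simp: fg)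
  show "is_eigenvalue expm (kernel_op (sinh_kernel \<alpha> \<kappa>)) (\<kappa> powr (1 - \<alpha>) * l)"
    unfolding is_eigenvalue_def
    using gL2 not0' ev' unfolding L2_unit_interval_iff[OF g \<kappa>(1)] eigenfunction_log_pullback_iff[OF g \<kappa>]
    by blast
next
  assume "is_eigenvalue expm (kernel_op (sinh_kernel \<alpha> \<kappa>)) (\<kappa> powr (1 - \<alpha>) * l)"
  then obtain h where h: "h \<in> L2 expm" and not0: "\<not> (AE u in expm. h u = 0)"
    and ev: "AE u in expm. kernel_op (sinh_kernel \<alpha> \<kappa>) h u = \<kappa> powr (1 - \<alpha>) * l * h u"
    by (auto simp: is_eigenvalue_def)
  note [measurable] = L2_measurable[OF h]
  define f where "f = (\<lambda>x. h (- \<kappa> * ln x) * x powr ((\<kappa> - 1) / 2))"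
  have f [measurable]: "f \<in> borel_measurable borel" unfolding f_def by measurable
  have hf: "log_pullback \<kappa> f = h"
  proof
    fix u
    have "exp (- u / \<kappa>) powr ((\<kappa> - 1) / 2) * exp (- u / \<kappa>) powr ((1 - \<kappa>) / 2) = 1"
      by (simp add: powr_add[symmetric] diff_divide_distrib)
    then show "log_pullback \<kappa> f u = h u"
      using \<kappa>(1) by (simp add: log_pullback_def f_def)
  qed
  show "is_eigenvalue unit_interval (T_op \<alpha> d) l"
    unfolding is_eigenvalue_def
    using h not0 ev L2_unit_interval_iff[OF f \<kappa>(1)] eigenfunction_log_pullback_iff[OF f \<kappa>] unfolding hf
    by blast
qed

lemma lambda_max_T_op:
  assumes \<alpha>: "0 < \<alpha>" "\<alpha> \<le> 1 / 2" and \<kappa>: "0 < \<kappa>" "\<kappa> = 1 - d - \<alpha>"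
  shows "lambda_max unit_interval (T_op \<alpha> d) = \<kappa> powr (\<alpha> - 1) * top_value (sinh_kernel \<alpha> \<kappa>)"
proof -
  note adm = admissible_sinh_kernel[OF \<alpha> \<kappa>(1)]
  have inv: "\<kappa> powr (1 - \<alpha>) * \<kappa> powr (\<alpha> - 1) = 1"
    using \<kappa>(1) by (simp add: powr_add[symmetric])
  show ?thesis
    unfolding lambda_max_def
  proof (rule Greatest_equality)
    show "is_eigenvalue unit_interval (T_op \<alpha> d) (\<kappa> powr (\<alpha> - 1) * top_value (sinh_kernel \<alpha> \<kappa>))"
      unfolding is_eigenvalue_T_op_iff[OF \<kappa>] mult.assoc[symmetric] inv
      using is_eigenvalue_top_value[OF adm] by simp
  next
    fix l assume "is_eigenvalue unit_interval (T_op \<alpha> d) l"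
    then have "\<kappa> powr (1 - \<alpha>) * l \<le> top_value (sinh_kernel \<alpha> \<kappa>)"
      unfolding is_eigenvalue_T_op_iff[OF \<kappa>] by (rule eigenvalue_le_top_value[OF adm])
    then have "\<kappa> powr (\<alpha> - 1) * (\<kappa> powr (1 - \<alpha>) * l) \<le> \<kappa> powr (\<alpha> - 1) * top_value (sinh_kernel \<alpha> \<kappa>)"
      by (rule mult_left_mono) simp
    moreover have "\<kappa> powr (\<alpha> - 1) * (\<kappa> powr (1 - \<alpha>) * l) = l"
      using inv by (simp add: mult_ac)
    ultimately show "l \<le> \<kappa> powr (\<alpha> - 1) * top_value (sinh_kernel \<alpha> \<kappa>)" by simp
  qed
qed

lemma integral_abs_diff_expm:
  fixes w :: "real \<Rightarrow> real"
  assumes [measurable]: "w \<in> borel_measurable borel" and w: "\<And>t. 0 \<le> w t" and int: "integrable expm w"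
  shows "(\<integral>v. (\<integral>u. w \<bar>u - v\<bar> \<partial>expm) \<partial>expm) = (\<integral>t. w t \<partial>expm)"
proof -
  have nn: "(\<integral>\<^sup>+p. ennreal (w \<bar>snd p - fst p\<bar>) \<partial>expm_sq) = ennreal (\<integral>t. w t \<partial>expm)"
  proof -
    have "(\<integral>\<^sup>+p. ennreal (w \<bar>snd p - fst p\<bar>) \<partial>expm_sq) = (\<integral>\<^sup>+u. (\<integral>\<^sup>+v. ennreal (w \<bar>u - v\<bar>) \<partial>expm) \<partial>expm)"
      by (subst expm.nn_integral_fst[symmetric]) (auto simp: abs_minus_commute)
    also have "\<dots> = (\<integral>\<^sup>+t. ennreal (w t) \<partial>expm)"
      by (rule nn_integral_expm_abs_diff) measurable
    also have "\<dots> = ennreal (\<integral>t. w t \<partial>expm)"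
      using int w by (intro nn_integral_eq_integral) auto
    finally show ?thesis .
  qed
  have int2: "integrable expm_sq (\<lambda>p. w \<bar>snd p - fst p\<bar>)"
    using w by (intro integrableI_bounded) (auto simp: nn)
  have "(\<integral>v. (\<integral>u. w \<bar>u - v\<bar> \<partial>expm) \<partial>expm) = (\<integral>p. w \<bar>snd p - fst p\<bar> \<partial>expm_sq)"
    using expm2.integral_fst'[OF int2] by simp
  also have "\<dots> = enn2real (ennreal (\<integral>t. w t \<partial>expm))"
    using w by (subst integral_eq_nn_integral) (auto simp: nn)
  also have "\<dots> = (\<integral>t. w t \<partial>expm)"
    using w by (simp add: Bochner_Integration.integral_nonneg)
  finally show ?thesis .
qed

lemma trace_T_sq_eq:
  assumes \<alpha>: "0 < \<alpha>" "\<alpha> < 1 / 2" and \<kappa>: "0 < \<kappa>" "\<kappa> = 1 - d - \<alpha>"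
  shows "trace_T_sq \<alpha> d = (\<kappa> powr (\<alpha> - 1))\<^sup>2 * (\<integral>t. sinh_kernel (2 * \<alpha>) \<kappa> t \<partial>expm)"
proof -
  let ?e = "\<lambda>u. exp (- u / \<kappa>)"
  define J where "J = (\<lambda>y. LBINT x:{0<..<1}. x powr (- d) * y powr (- d) * \<bar>x - y\<bar> powr (- 2 * \<alpha>))"
  have J_meas [measurable]: "J \<in> borel_measurable borel"
    unfolding J_def set_lebesgue_integral_def by measurable
  have Ka: "\<kappa> powr (2 * \<alpha>) / \<kappa> / \<kappa> = (\<kappa> powr (\<alpha> - 1))\<^sup>2"
    using \<kappa>(1) by (simp add: power2_eq_square powr_add[symmetric] powr_diff divide_divide_eq_left)
  have J: "J (?e v) * ?e v powr (1 - \<kappa>) / \<kappa> = (\<kappa> powr (\<alpha> - 1))\<^sup>2 * (\<integral>u. sinh_kernel (2 * \<alpha>) \<kappa> \<bar>u - v\<bar> \<partial>expm)" for v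
  proof -
    let ?Y = "?e v"
    have "J ?Y = (\<integral>u. (?e u powr (- d) * ?Y powr (- d) * \<bar>?e u - ?Y\<bar> powr (- 2 * \<alpha>)) * ?e u powr (1 - \<kappa>) / \<kappa> \<partial>expm)"
      unfolding J_def by (rule integral_unit_interval[OF \<kappa>(1)]) measurable
    also have "\<dots> = (\<integral>u. (\<kappa> powr (2 * \<alpha>) / \<kappa> * ?Y powr (\<kappa> - 1)) * sinh_kernel (2 * \<alpha>) \<kappa> \<bar>u - v\<bar> \<partial>expm)"
    proof (rule Bochner_Integration.integral_cong[OF refl])
      fix u
      have X: "?e u powr (- d) * ?e u powr (- (2 * \<alpha>) / 2) * ?e u powr (1 - \<kappa>) = 1"
        unfolding powr_add[symmetric] using \<kappa>(2) by simp
      have Y: "?Y powr (- d) * ?Y powr (- (2 * \<alpha>) / 2) = ?Y powr (\<kappa> - 1)"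
        unfolding powr_add[symmetric] using \<kappa>(2) by simp
      have "(?e u powr (- d) * ?Y powr (- d) * \<bar>?e u - ?Y\<bar> powr (- 2 * \<alpha>)) * ?e u powr (1 - \<kappa>) / \<kappa>
        = (?e u powr (- d) * ?e u powr (- (2 * \<alpha>) / 2) * ?e u powr (1 - \<kappa>))
          * (\<kappa> powr (2 * \<alpha>) / \<kappa> * (?Y powr (- d) * ?Y powr (- (2 * \<alpha>) / 2))) * sinh_kernel (2 * \<alpha>) \<kappa> \<bar>u - v\<bar>"
        using abs_exp_diff_powr[OF \<kappa>(1), of u v "2 * \<alpha>"] by simp
      then show "(?e u powr (- d) * ?Y powr (- d) * \<bar>?e u - ?Y\<bar> powr (- 2 * \<alpha>)) * ?e u powr (1 - \<kappa>) / \<kappa>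
        = (\<kappa> powr (2 * \<alpha>) / \<kappa> * ?Y powr (\<kappa> - 1)) * sinh_kernel (2 * \<alpha>) \<kappa> \<bar>u - v\<bar>"
        unfolding X Y by simp
    qed
    also have "\<dots> = (\<kappa> powr (2 * \<alpha>) / \<kappa> * ?Y powr (\<kappa> - 1)) * (\<integral>u. sinh_kernel (2 * \<alpha>) \<kappa> \<bar>u - v\<bar> \<partial>expm)"
      by simp
    finally have "J ?Y * ?Y powr (1 - \<kappa>) / \<kappa>
       = (\<kappa> powr (2 * \<alpha>) / \<kappa> / \<kappa>) * (?Y powr (\<kappa> - 1) * ?Y powr (1 - \<kappa>)) * (\<integral>u. sinh_kernel (2 * \<alpha>) \<kappa> \<bar>u - v\<bar> \<partial>expm)"
      by simp
    also have "?Y powr (\<kappa> - 1) * ?Y powr (1 - \<kappa>) = 1"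
      by (simp add: powr_add[symmetric])
    finally show ?thesis by (simp only: Ka mult_1_right)
  qed
  have "trace_T_sq \<alpha> d = (LBINT y:{0<..<1}. J y)"
    by (simp add: trace_T_sq_def J_def)
  also have "\<dots> = (\<integral>v. J (?e v) * ?e v powr (1 - \<kappa>) / \<kappa> \<partial>expm)"
    by (rule integral_unit_interval[OF \<kappa>(1) J_meas])
  also have "\<dots> = (\<kappa> powr (\<alpha> - 1))\<^sup>2 * (\<integral>v. (\<integral>u. sinh_kernel (2 * \<alpha>) \<kappa> \<bar>u - v\<bar> \<partial>expm) \<partial>expm)"
    unfolding J by simp
  also have "(\<integral>v. (\<integral>u. sinh_kernel (2 * \<alpha>) \<kappa> \<bar>u - v\<bar> \<partial>expm) \<partial>expm) = (\<integral>t. sinh_kernel (2 * \<alpha>) \<kappa> t \<partial>expm)"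
    using \<alpha> \<kappa> sinh_kernel_integrable(2)[of "2 * \<alpha>" \<kappa>] by (intro integral_abs_diff_expm) auto
  finally show ?thesis .
qed

lemma Lambda2_eq:
  assumes \<alpha>: "0 < \<alpha>" "\<alpha> < 1 / 2" and \<kappa>: "0 < \<kappa>" "\<kappa> = 1 - d - \<alpha>"
  shows "Lambda2 \<alpha> d = top_value (sinh_kernel \<alpha> \<kappa>) / sqrt (2 * (\<integral>t. sinh_kernel (2 * \<alpha>) \<kappa> t \<partial>expm))"
proof -
  have "\<kappa> powr (\<alpha> - 1) > 0" using \<kappa>(1) by simp
  then show ?thesis
    unfolding Lambda2_def lambda_max_T_op[OF \<alpha>(1) less_imp_le[OF \<alpha>(2)] \<kappa>] trace_T_sq_eq[OF \<alpha> \<kappa>]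
    by (simp add: real_sqrt_mult)
qed


section \<open>Limits of the rank-two constant\<close>

text \<open>By \<open>Lambda2_eq\<close> the normalised constant is \<open>M / sqrt (2 J)\<close> with \<open>J = (1 - 2 \<alpha>) I\<close>, and
\<open>\<bar>J - 1\<bar> \<le> 2 (1 - 2 \<alpha>)\<close>. So it is as close to \<open>m / sqrt 2\<close> as \<open>M\<close> is to \<open>m\<close>, up to a constant
factor and \<open>O(1 - 2 \<alpha>)\<close>. The restriction \<open>\<alpha> \<ge> 3 / 8\<close> keeps \<open>J\<close> away from \<open>0\<close>.\<close>

lemma Lambda2_near:
  assumes \<alpha>: "3 / 8 \<le> \<alpha>" "\<alpha> < 1 / 2" and d: "d \<le> 0"
    and E: "\<bar>top_value (sinh_kernel \<alpha> (1 - d - \<alpha>)) - m\<bar> \<le> E" and m: "0 \<le> m" "m \<le> 6"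
  shows "\<bar>Lambda2 \<alpha> d / sqrt (1 - 2 * \<alpha>) - m / sqrt 2\<bar> \<le> 2 * E + 24 * (1 - 2 * \<alpha>)"
proof -
  define \<kappa> where "\<kappa> = 1 - d - \<alpha>"
  define \<epsilon> where "\<epsilon> = 1 - 2 * \<alpha>"
  define M where "M = top_value (sinh_kernel \<alpha> \<kappa>)"
  define I where "I = (\<integral>t. sinh_kernel (2 * \<alpha>) \<kappa> t \<partial>expm)"
  define J where "J = \<epsilon> * I"
  have \<epsilon>: "0 < \<epsilon>" "\<epsilon> \<le> 1 / 4" using \<alpha> by (auto simp: \<epsilon>_def)
  have \<kappa>: "1 / 2 \<le> \<kappa>" using \<alpha> d by (simp add: \<kappa>_def)
  have J1: "\<bar>J - 1\<bar> \<le> 2 * \<epsilon>"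
    using sinh_kernel_trace_estimate[of "2 * \<alpha>" \<kappa>] \<alpha> \<kappa> by (simp add: J_def I_def \<epsilon>_def)
  then have J: "1 / 4 \<le> J" using \<epsilon> by linarith
  have sJ: "1 / 2 \<le> sqrt J"
    using real_sqrt_le_mono[OF J] by (simp add: real_sqrt_divide)
  have "Lambda2 \<alpha> d / sqrt \<epsilon> = M / sqrt (2 * I) / sqrt \<epsilon>"
    using Lambda2_eq[of \<alpha> \<kappa> d] \<alpha> \<kappa> by (simp add: M_def I_def \<kappa>_def)
  also have "\<dots> = M / sqrt J / sqrt 2"
    by (simp add: J_def real_sqrt_mult mult_ac)
  finally have "Lambda2 \<alpha> d / sqrt \<epsilon> - m / sqrt 2 = (M / sqrt J - m) / sqrt 2"
    by (simp add: diff_divide_distrib)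
  then have "\<bar>Lambda2 \<alpha> d / sqrt \<epsilon> - m / sqrt 2\<bar> = \<bar>M / sqrt J - m\<bar> / sqrt 2"
    by simp
  also have "\<dots> \<le> \<bar>M / sqrt J - m\<bar>"
    by (simp add: divide_le_eq mult_le_cancel_left1)
  also have "\<dots> \<le> 2 * E + 24 * \<epsilon>"
  proof -
    have "\<bar>1 - sqrt J\<bar> \<le> \<bar>1 - sqrt J\<bar> * (1 + sqrt J)"
      using J by (simp add: mult_le_cancel_left1)
    also have "\<dots> = \<bar>(1 - sqrt J) * (1 + sqrt J)\<bar>"
      using J by (simp add: abs_mult)
    also have "(1 - sqrt J) * (1 + sqrt J) = 1 - J"
      using J by (simp add: algebra_simps)
    also have "\<bar>1 - J\<bar> \<le> 2 * \<epsilon>" using J1 by linarith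
    finally have s1: "\<bar>1 - sqrt J\<bar> \<le> 2 * \<epsilon>" .
    have "\<bar>M - m * sqrt J\<bar> \<le> \<bar>M - m\<bar> + \<bar>m * (1 - sqrt J)\<bar>"
      by (simp add: right_diff_distrib)
    also have "\<dots> \<le> E + 6 * (2 * \<epsilon>)"
      unfolding abs_mult using E m s1 by (intro add_mono mult_mono) (auto simp: M_def \<kappa>_def)
    finally have num: "\<bar>M - m * sqrt J\<bar> \<le> E + 12 * \<epsilon>" by simp
    have "M / sqrt J - m = (M - m * sqrt J) / sqrt J"
      using J by (simp add: diff_divide_distrib)
    then have "\<bar>M / sqrt J - m\<bar> = \<bar>M - m * sqrt J\<bar> / sqrt J"
      using J by simp
    also have "\<dots> \<le> \<bar>M - m * sqrt J\<bar> / (1 / 2)"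
      using sJ J by (intro divide_left_mono) auto
    also have "\<dots> \<le> 2 * E + 24 * \<epsilon>" using num by simp
    finally show ?thesis .
  qed
  finally show ?thesis by (simp add: \<epsilon>_def)
qed

lemma C_exp_eq: "C_exp = top_value (power_kernel (1 / 2)) / sqrt 2"
  by (simp add: C_exp_def lambda_max_S_half)

lemma top_value_range:
  "0 \<le> top_value (power_kernel (1 / 2))" "top_value (power_kernel (1 / 2)) \<le> 6"
  "0 < \<kappa> \<Longrightarrow> 0 \<le> top_value (sinh_kernel (1 / 2) \<kappa>)" "0 < \<kappa> \<Longrightarrow> top_value (sinh_kernel (1 / 2) \<kappa>) \<le> 6"
  using admissible_power_kernel[of "1 / 2"] admissible_sinh_kernel[of "1 / 2" \<kappa>] top_value_pos top_value_le_6
  by (auto simp: less_imp_le)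

text \<open>The intermediate kernel is the one with exponent \<open>1 / 2\<close> and the same \<open>\<kappa>\<close>. Schur's test leads
to it, uniformly in \<open>\<kappa>\<close>, and the Hilbert--Schmidt bound leads on to \<open>t\<^sup>-\<^sup>1\<^sup>/\<^sup>2\<close>.\<close>

lemma Lambda2_joint_estimate:
  assumes \<alpha>: "3 / 8 \<le> \<alpha>" "\<alpha> < 1 / 2" and d: "d \<le> 0"
  shows "\<bar>Lambda2 \<alpha> d / sqrt (1 - 2 * \<alpha>) - C_exp\<bar> \<le> 64 * (1 - 2 * \<alpha> + 1 / (1 - d)\<^sup>2)"
proof -
  define \<kappa> where "\<kappa> = 1 - d - \<alpha>"
  have \<kappa>: "0 < \<kappa>" "(1 - d) / 2 \<le> \<kappa>" using \<alpha> d by (auto simp: \<kappa>_def field_simps)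
  have "\<bar>top_value (sinh_kernel \<alpha> \<kappa>) - top_value (sinh_kernel (1 / 2) \<kappa>)\<bar> \<le> 40 * (1 / 2 - \<alpha>)"
    using \<alpha> \<kappa> by (intro top_value_sinh_kernel_exponent) auto
  moreover have "\<bar>top_value (sinh_kernel (1 / 2) \<kappa>) - top_value (power_kernel (1 / 2))\<bar> \<le> sqrt 6 / (48 * \<kappa>\<^sup>2)"
    by (rule top_value_sinh_kernel_half_inf[OF \<kappa>(1)])
  ultimately have E: "\<bar>top_value (sinh_kernel \<alpha> (1 - d - \<alpha>)) - top_value (power_kernel (1 / 2))\<bar>
      \<le> 20 * (1 - 2 * \<alpha>) + sqrt 6 / (48 * \<kappa>\<^sup>2)"
    by (simp add: \<kappa>_def)
  have "sqrt 6 \<le> 3" by (rule real_le_lsqrt) auto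
  then have "sqrt 6 / (48 * \<kappa>\<^sup>2) \<le> 3 / (48 * \<kappa>\<^sup>2)"
    by (intro divide_right_mono) auto
  also have "\<dots> \<le> 3 / (48 * ((1 - d) / 2)\<^sup>2)"
    using \<kappa> d by (intro divide_left_mono mult_left_mono power_mono mult_pos_pos) auto
  also have "\<dots> \<le> 1 / (1 - d)\<^sup>2"
    using d by (simp add: power_divide field_simps)
  finally have k: "sqrt 6 / (48 * \<kappa>\<^sup>2) \<le> 1 / (1 - d)\<^sup>2" .
  have "\<bar>Lambda2 \<alpha> d / sqrt (1 - 2 * \<alpha>) - C_exp\<bar>
      \<le> 2 * (20 * (1 - 2 * \<alpha>) + sqrt 6 / (48 * \<kappa>\<^sup>2)) + 24 * (1 - 2 * \<alpha>)"
    unfolding C_exp_eq by (rule Lambda2_near[OF \<alpha> d E top_value_range(1,2)])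
  also have "\<dots> \<le> 64 * (1 - 2 * \<alpha>) + 2 * (1 / (1 - d)\<^sup>2)"
    using k by simp
  also have "\<dots> \<le> 64 * (1 - 2 * \<alpha> + 1 / (1 - d)\<^sup>2)"
    by (simp add: divide_right_mono)
  finally show ?thesis .
qed

lemma eventually_at_left_half: "\<forall>\<^sub>F \<alpha> in at_left (1 / 2 :: real). 3 / 8 \<le> \<alpha> \<and> \<alpha> < 1 / 2"
  using eventually_at_left_real[of "3 / 8" "1 / 2 :: real"] by (auto elim: eventually_mono)

text \<open>The parameters \<open>\<kappa> = 1 - d - \<alpha>\<close> and \<open>\<kappa>\<^sub>0 = 1 / 2 - d\<close> differ by \<open>1 / 2 - \<alpha>\<close>, so changing the exponent
and changing \<open>\<kappa>\<close> both cost \<open>O(1 / 2 - \<alpha>)\<close>.\<close>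

lemma tendsto_fixed_d:
  assumes d: "d \<le> 0"
  shows "((\<lambda>\<alpha>. Lambda2 \<alpha> d / sqrt (1 - 2 * \<alpha>)) \<longlongrightarrow> top_value (sinh_kernel (1 / 2) (1 / 2 - d)) / sqrt 2) (at_left (1 / 2))"
proof (rule LIM_zero_cancel, rule Lim_null_comparison)
  define \<kappa>\<^sub>0 where "\<kappa>\<^sub>0 = 1 / 2 - d"
  have \<kappa>0: "1 / 2 \<le> \<kappa>\<^sub>0" using d by (simp add: \<kappa>\<^sub>0_def)
  show "\<forall>\<^sub>F \<alpha> in at_left (1 / 2). norm (Lambda2 \<alpha> d / sqrt (1 - 2 * \<alpha>) - top_value (sinh_kernel (1 / 2) (1 / 2 - d)) / sqrt 2)
      \<le> 66 * (1 - 2 * \<alpha>)"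
    using eventually_at_left_half
  proof eventually_elim
    case (elim \<alpha>)
    define \<kappa> where "\<kappa> = 1 - d - \<alpha>"
    have \<kappa>: "\<kappa> - \<kappa>\<^sub>0 = 1 / 2 - \<alpha>" "\<kappa>\<^sub>0 \<le> \<kappa>" "0 < \<kappa>" using elim \<kappa>0 by (auto simp: \<kappa>_def \<kappa>\<^sub>0_def)
    have "\<bar>top_value (sinh_kernel \<alpha> \<kappa>) - top_value (sinh_kernel (1 / 2) \<kappa>)\<bar> \<le> 40 * (1 / 2 - \<alpha>)"
      using elim \<kappa> by (intro top_value_sinh_kernel_exponent) auto
    moreover have "\<bar>top_value (sinh_kernel (1 / 2) \<kappa>) - top_value (sinh_kernel (1 / 2) \<kappa>\<^sub>0)\<bar> \<le> 1 / 2 - \<alpha>"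
    proof -
      have "\<bar>top_value (sinh_kernel (1 / 2) \<kappa>) - top_value (sinh_kernel (1 / 2) \<kappa>\<^sub>0)\<bar> \<le> (\<kappa> - \<kappa>\<^sub>0) / (4 * \<kappa> * \<kappa>\<^sub>0)"
        using \<kappa> \<kappa>0 by (intro top_value_sinh_kernel_half_diff) auto
      also have "\<dots> \<le> (\<kappa> - \<kappa>\<^sub>0) / 1"
      proof (rule divide_left_mono)
        have "(1 / 2) * (1 / 2) \<le> \<kappa> * \<kappa>\<^sub>0" using \<kappa> \<kappa>0 by (intro mult_mono) auto
        then show "1 \<le> 4 * \<kappa> * \<kappa>\<^sub>0" by simp
      qed (use \<kappa> \<kappa>0 in auto)
      finally show ?thesis using \<kappa> by simp
    qed
    ultimately have E: "\<bar>top_value (sinh_kernel \<alpha> (1 - d - \<alpha>)) - top_value (sinh_kernel (1 / 2) \<kappa>\<^sub>0)\<bar> \<le> 41 * (1 / 2 - \<alpha>)"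
      by (simp add: \<kappa>_def)
    have "\<bar>Lambda2 \<alpha> d / sqrt (1 - 2 * \<alpha>) - top_value (sinh_kernel (1 / 2) \<kappa>\<^sub>0) / sqrt 2\<bar>
       \<le> 2 * (41 * (1 / 2 - \<alpha>)) + 24 * (1 - 2 * \<alpha>)"
      using elim \<kappa>0 by (intro Lambda2_near d E top_value_range) auto
    also have "\<dots> \<le> 66 * (1 - 2 * \<alpha>)" using elim by simp
    finally show ?case by (simp add: \<kappa>\<^sub>0_def)
  qed
  have "((\<lambda>\<alpha>::real. 66 * (1 - 2 * \<alpha>)) \<longlongrightarrow> 66 * (1 - 2 * (1 / 2))) (at_left (1 / 2))"
    by (intro tendsto_intros)
  then show "((\<lambda>\<alpha>::real. 66 * (1 - 2 * \<alpha>)) \<longlongrightarrow> 0) (at_left (1 / 2))" by simp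
qed

lemma C2_eq: "d \<le> 0 \<Longrightarrow> C2 d = top_value (sinh_kernel (1 / 2) (1 / 2 - d)) / sqrt 2"
  unfolding C2_def by (intro tendsto_Lim tendsto_fixed_d) auto

lemma C_exp_minus_C2:
  assumes "d \<le> 0" shows "0 < C_exp - C2 d" "C_exp - C2 d \<le> sqrt 3 / (48 * (1 / 2 - d)\<^sup>2)"
proof -
  have \<kappa>: "0 < 1 / 2 - d" using assms by simp
  have diff: "C_exp - C2 d = (top_value (power_kernel (1 / 2)) - top_value (sinh_kernel (1 / 2) (1 / 2 - d))) / sqrt 2"
    by (simp add: C_exp_eq C2_eq[OF assms] diff_divide_distrib)
  show "0 < C_exp - C2 d"
    unfolding diff using top_value_sinh_kernel_half_less_inf[OF \<kappa>] by simp
  have "C_exp - C2 d \<le> (sqrt 6 / (48 * (1 / 2 - d)\<^sup>2)) / sqrt 2"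
    unfolding diff using top_value_sinh_kernel_half_inf[OF \<kappa>] by (intro divide_right_mono) auto
  also have "\<dots> = sqrt 3 / (48 * (1 / 2 - d)\<^sup>2)"
    using real_sqrt_mult[of 3 2] by simp
  finally show "C_exp - C2 d \<le> sqrt 3 / (48 * (1 / 2 - d)\<^sup>2)" .
qed

lemma C2_tendsto_C_exp: "(C2 \<longlongrightarrow> C_exp) at_bot"
proof (rule LIM_zero_cancel, rule Lim_null_comparison)
  show "\<forall>\<^sub>F d in at_bot. norm (C2 d - C_exp) \<le> sqrt 3 / (48 * (1 / 2 - d)\<^sup>2)"
    using eventually_le_at_bot[of "0 :: real"]
  proof eventually_elim
    case (elim d)
    then show ?case using C_exp_minus_C2[of d] by simp
  qed
  show "((\<lambda>d::real. sqrt 3 / (48 * (1 / 2 - d)\<^sup>2)) \<longlongrightarrow> 0) at_bot"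
    by real_asymp
qed

text \<open>The limit of \<open>Lambda2 \<alpha> d / sqrt (1 - 2 * \<alpha>)\<close> as \<open>d\<close> tends to \<open>-\<infinity>\<close>, that is, as \<open>\<kappa>\<close> tends to
\<open>\<infinity>\<close>.\<close>

definition Lambda2_limit :: "real \<Rightarrow> real" where
  "Lambda2_limit \<alpha> = top_value (power_kernel \<alpha>) / sqrt (2 * (\<integral>t. power_kernel (2 * \<alpha>) t \<partial>expm)) / sqrt (1 - 2 * \<alpha>)"

lemma tendsto_fixed_alpha:
  assumes \<alpha>: "0 < \<alpha>" "\<alpha> < 1 / 2"
  shows "((\<lambda>d. Lambda2 \<alpha> d / sqrt (1 - 2 * \<alpha>)) \<longlongrightarrow> Lambda2_limit \<alpha>) at_bot"
proof -
  have top: "((\<lambda>d. top_value (sinh_kernel \<alpha> (1 - d - \<alpha>))) \<longlongrightarrow> top_value (power_kernel \<alpha>)) at_bot"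
  proof (rule LIM_zero_cancel, rule Lim_null_comparison)
    show "\<forall>\<^sub>F d in at_bot. norm (top_value (sinh_kernel \<alpha> (1 - d - \<alpha>)) - top_value (power_kernel \<alpha>)) \<le> sqrt 50 / (48 * (1 - d - \<alpha>)\<^sup>2)"
      using eventually_le_at_bot[of "0 :: real"]
    proof eventually_elim
      case (elim d)
      then show ?case using \<alpha> top_value_power_kernel_diff[of \<alpha> "1 - d - \<alpha>"] by simp
    qed
    show "((\<lambda>d::real. sqrt 50 / (48 * (1 - d - \<alpha>)\<^sup>2)) \<longlongrightarrow> 0) at_bot"
      by real_asymp
  qed
  have tr: "((\<lambda>d. \<integral>t. sinh_kernel (2 * \<alpha>) (1 - d - \<alpha>) t \<partial>expm) \<longlongrightarrow> (\<integral>t. power_kernel (2 * \<alpha>) t \<partial>expm)) at_bot"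
  proof (rule LIM_zero_cancel, rule Lim_null_comparison)
    show "\<forall>\<^sub>F d in at_bot. norm ((\<integral>t. sinh_kernel (2 * \<alpha>) (1 - d - \<alpha>) t \<partial>expm) - (\<integral>t. power_kernel (2 * \<alpha>) t \<partial>expm)) \<le> 1 / (8 * (1 - d - \<alpha>)\<^sup>2)"
      using eventually_le_at_bot[of "0 :: real"]
    proof eventually_elim
      case (elim d)
      then show ?case using \<alpha> sinh_kernel_trace_diff[of "2 * \<alpha>" "1 - d - \<alpha>"] by simp
    qed
    show "((\<lambda>d::real. 1 / (8 * (1 - d - \<alpha>)\<^sup>2)) \<longlongrightarrow> 0) at_bot"
      by real_asymp
  qed
  have pos: "0 < (\<integral>t. power_kernel (2 * \<alpha>) t \<partial>expm)"
    using \<alpha> by (intro sinh_kernel_trace_pos) auto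
  have "((\<lambda>d. top_value (sinh_kernel \<alpha> (1 - d - \<alpha>)) / sqrt (2 * (\<integral>t. sinh_kernel (2 * \<alpha>) (1 - d - \<alpha>) t \<partial>expm)) / sqrt (1 - 2 * \<alpha>))
      \<longlongrightarrow> Lambda2_limit \<alpha>) at_bot"
    unfolding Lambda2_limit_def using pos \<alpha> by (intro tendsto_intros top tr) auto
  moreover have "\<forall>\<^sub>F d in at_bot. top_value (sinh_kernel \<alpha> (1 - d - \<alpha>)) / sqrt (2 * (\<integral>t. sinh_kernel (2 * \<alpha>) (1 - d - \<alpha>) t \<partial>expm)) / sqrt (1 - 2 * \<alpha>)
      = Lambda2 \<alpha> d / sqrt (1 - 2 * \<alpha>)"
    using eventually_le_at_bot[of "0 :: real"]
  proof eventually_elim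
    case (elim d)
    then show ?case using \<alpha> Lambda2_eq[of \<alpha> "1 - d - \<alpha>" d] by simp
  qed
  ultimately show ?thesis by (rule Lim_transform_eventually)
qed

text \<open>The joint estimate is uniform in \<open>d\<close>, so it survives the limit in \<open>d\<close>.\<close>

lemma Lambda2_limit_tendsto: "(Lambda2_limit \<longlongrightarrow> C_exp) (at_left (1 / 2))"
proof (rule LIM_zero_cancel, rule Lim_null_comparison)
  show "\<forall>\<^sub>F \<alpha> in at_left (1 / 2). norm (Lambda2_limit \<alpha> - C_exp) \<le> 64 * (1 - 2 * \<alpha>)"
    using eventually_at_left_half
  proof eventually_elim
    case (elim \<alpha>)
    have l: "((\<lambda>d. \<bar>Lambda2 \<alpha> d / sqrt (1 - 2 * \<alpha>) - C_exp\<bar>) \<longlongrightarrow> \<bar>Lambda2_limit \<alpha> - C_exp\<bar>) at_bot"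
      using elim by (intro tendsto_intros tendsto_fixed_alpha) auto
    have "((\<lambda>d::real. 1 / (1 - d)\<^sup>2) \<longlongrightarrow> 0) at_bot" by real_asymp
    then have u: "((\<lambda>d. 64 * (1 - 2 * \<alpha> + 1 / (1 - d)\<^sup>2)) \<longlongrightarrow> 64 * (1 - 2 * \<alpha> + 0)) at_bot"
      by (intro tendsto_intros)
    have "\<bar>Lambda2_limit \<alpha> - C_exp\<bar> \<le> 64 * (1 - 2 * \<alpha> + 0)"
    proof (rule tendsto_le[OF _ u l])
      show "\<forall>\<^sub>F d in at_bot. \<bar>Lambda2 \<alpha> d / sqrt (1 - 2 * \<alpha>) - C_exp\<bar> \<le> 64 * (1 - 2 * \<alpha> + 1 / (1 - d)\<^sup>2)"
        using eventually_le_at_bot[of "0 :: real"]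
        by eventually_elim (rule Lambda2_joint_estimate, use elim in auto)
    qed simp
    then show ?case by simp
  qed
  have "((\<lambda>\<alpha>::real. 64 * (1 - 2 * \<alpha>)) \<longlongrightarrow> 64 * (1 - 2 * (1 / 2))) (at_left (1 / 2))"
    by (intro tendsto_intros)
  then show "((\<lambda>\<alpha>::real. 64 * (1 - 2 * \<alpha>)) \<longlongrightarrow> 0) (at_left (1 / 2))" by simp
qed

theorem theorem6p6:
  shows
    "(\<exists>C. \<exists>\<alpha>\<^sub>0\<in>{0<..<1 / 2::real}. \<forall>\<alpha>\<in>{\<alpha>\<^sub>0<..<1 / 2}. \<forall>d\<le>0.
        \<bar>Lambda2 \<alpha> d / sqrt (1 - 2 * \<alpha>) - C_exp\<bar> \<le> C * (1 - 2 * \<alpha> + 1 / (1 - d)\<^sup>2))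
     \<and> (\<forall>d\<le>0. ((\<lambda>\<alpha>. Lambda2 \<alpha> d / sqrt (1 - 2 * \<alpha>)) \<longlongrightarrow> C2 d) (at_left (1 / 2)))
     \<and> (\<forall>d\<le>0. \<forall>\<kappa>\<^sub>0. \<kappa>\<^sub>0 = 1 / 2 - d \<longrightarrow>
          C2 d = lambda_max \<nu> (S_half_kappa \<kappa>\<^sub>0) / sqrt 2 \<and>
          0 < C_exp - C2 d \<and> C_exp - C2 d \<le> sqrt 3 / (48 * \<kappa>\<^sub>0\<^sup>2))
     \<and> (\<forall>d d'. d' < d \<and> d \<le> 0 \<longrightarrow> C2 d < C2 d')
     \<and> (C2 \<longlongrightarrow> C_exp) at_bot
     \<and> (\<exists>L. (\<forall>\<alpha>\<in>{0<..<1 / 2}.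
               ((\<lambda>d. Lambda2 \<alpha> d / sqrt (1 - 2 * \<alpha>)) \<longlongrightarrow> L \<alpha>) at_bot) \<and>
            (L \<longlongrightarrow> C_exp) (at_left (1 / 2)))"
proof (intro conjI)
  have "\<forall>\<alpha>\<in>{3 / 8<..<1 / 2}. \<forall>d\<le>0.
      \<bar>Lambda2 \<alpha> d / sqrt (1 - 2 * \<alpha>) - C_exp\<bar> \<le> 64 * (1 - 2 * \<alpha> + 1 / (1 - d)\<^sup>2)"
    using Lambda2_joint_estimate by auto
  then show "\<exists>C. \<exists>\<alpha>\<^sub>0\<in>{0<..<1 / 2::real}. \<forall>\<alpha>\<in>{\<alpha>\<^sub>0<..<1 / 2}. \<forall>d\<le>0.
        \<bar>Lambda2 \<alpha> d / sqrt (1 - 2 * \<alpha>) - C_exp\<bar> \<le> C * (1 - 2 * \<alpha> + 1 / (1 - d)\<^sup>2)"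
    by (intro exI[of _ 64] bexI[of _ "3 / 8"]) auto
  show "\<forall>d\<le>0. ((\<lambda>\<alpha>. Lambda2 \<alpha> d / sqrt (1 - 2 * \<alpha>)) \<longlongrightarrow> C2 d) (at_left (1 / 2))"
    using tendsto_fixed_d C2_eq by simp
  show "\<forall>d\<le>0. \<forall>\<kappa>\<^sub>0. \<kappa>\<^sub>0 = 1 / 2 - d \<longrightarrow>
          C2 d = lambda_max \<nu> (S_half_kappa \<kappa>\<^sub>0) / sqrt 2 \<and>
          0 < C_exp - C2 d \<and> C_exp - C2 d \<le> sqrt 3 / (48 * \<kappa>\<^sub>0\<^sup>2)"
    using C_exp_minus_C2 by (auto simp: C2_eq lambda_max_S_half_kappa)
  show "\<forall>d d'. d' < d \<and> d \<le> 0 \<longrightarrow> C2 d < C2 d'"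
    using top_value_sinh_kernel_half_strict_mono by (auto simp: C2_eq divide_strict_right_mono)
  show "(C2 \<longlongrightarrow> C_exp) at_bot" by (rule C2_tendsto_C_exp)
  show "\<exists>L. (\<forall>\<alpha>\<in>{0<..<1 / 2}.
               ((\<lambda>d. Lambda2 \<alpha> d / sqrt (1 - 2 * \<alpha>)) \<longlongrightarrow> L \<alpha>) at_bot) \<and>
            (L \<longlongrightarrow> C_exp) (at_left (1 / 2))"
    using tendsto_fixed_alpha Lambda2_limit_tendsto by (intro exI[of _ Lambda2_limit]) auto
qed

end
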